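(* Let $A=\varprojlim_n A(n)$ be the Hecke algebra acting on $\mathcal{F}$, and let $\psi:\mathbf{F}_2[[x,y]]\to A$ be the homomorphism of $\mathbf{F}_2$-algebras, obtained by passage to the limit from the homomorphisms $\psi_n:\mathbf{F}_2[x,y]\to A(n)$ with $\psi_n(x)=T_3$ and $\psi_n(y)=T_5$, so that $\psi(x)=T_3$ and $\psi(y)=T_5$. Then $\psi$ is an isomorphism.
   Context: Let $\Delta=\sum_{m\ge 0} q^{(2m+1)^2}\in\mathbf{F}_2[[q]]$ (the reduction mod $2$ of $\sum_{n\ge1}\tau(n)q^n$), and let $\mathcal{F}\subset\mathbf{F}_2[[q]]$ be the $\mathbf{F}_2$-vector space spanned by $\Delta,\Delta^3,\Delta^5,\dots$. For an odd prime $p$, the Hecke operator $T_p$ sends $f=\sum a_n q^n$ to $\sum b_nq^n$, with $b_n=a_{pn}$ if $p\nmid n$ and $b_n=a_{pn}+a_{n/p}$ if $p\mid n$. The $T_p$ commute and preserve $\mathcal{F}$. For an integer $n\ge 1$, $\mathcal{F}(n)$ is the subspace of $\mathcal{F}$ with basis $\{\Delta,\Delta^3,\dots,\Delta^{2n-1}\}$; it is stable under all $T_p$, $p$ an odd prime. $A(n)$ is the $\mathbf{F}_2$-subalgebra of $\mathrm{End}(\mathcal{F}(n))$ generated by $\mathbf{F}_2$ and the $T_p$, $p$ odd prime. One has $A(n)=\mathbf{F}_2\oplus\mathfrak{m}(n)$, where $\mathfrak{m}(n)$ is the unique maximal ideal, spanned by the $T_p$ and their products; it is nilpotent. Restriction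 from $\mathcal{F}(n+1)$ to $\mathcal{F}(n)$ gives surjective homomorphisms $A(n+1)\to A(n)$, and $A$ is the projective limit of this system, a commutative local ring, compact for the projective limit topology, with maximal ideal $\mathfrak{m}=\varprojlim\mathfrak{m}(n)$. It acts naturally on $\mathcal{F}$. Since $T_3,T_5\in\mathfrak{m}(n)$ are nilpotent in $A(n)$, each $\psi_n$ extends to $\mathbf{F}_2[[x,y]]$, compatibly in $n$, and $\psi$ is the resulting homomorphism to the projective limit. *)

theory Defs
  imports
    "HOL-Library.Z2"
    "HOL-Computational_Algebra.Computational_Algebra"
    "HOL-Algebra.Generated_Rings"
    "HOL-Algebra.Algebraic_Closure_Type"
begin

hide_const (open) Divisibility.prime

text \<open>The field with two elements is the type \<^typ>\<open>bit\<close>; the ring of formal power series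
  in \<open>q\<close> over it is \<^typ>\<open>bit fps\<close>.\<close>

definition Delta :: "bit fps" where
  "Delta = Abs_fps (\<lambda>k. if \<exists>m. k = (2 * m + 1)\<^sup>2 then 1 else 0)"

definition scaleF2 :: "bit \<Rightarrow> bit fps \<Rightarrow> bit fps" where
  "scaleF2 c f = fps_const c * f"

interpretation scaleF2: vector_space scaleF2
  by unfold_locales
    (simp_all add: scaleF2_def distrib_left distrib_right mult.assoc
      del: add_bit_eq_xor flip: fps_const_add fps_const_mult)

text \<open>The span \<open>\<F>\<close> of the powers of \<open>\<Delta>\<close> with odd exponent, and its filtration by the
  subspaces \<open>\<F>(n)\<close>. Only the latter enter the construction of the Hecke algebra.\<close>

definition cuspF :: "bit fps set" where
  "cuspF = module.span scaleF2 {Delta ^ (2 * k - 1) | k. 1 \<le> k}"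

definition cuspF_upto :: "nat \<Rightarrow> bit fps set" where
  "cuspF_upto n = module.span scaleF2 {Delta ^ (2 * k - 1) | k. 1 \<le> k \<and> k \<le> n}"

lemma cuspF_eq_Union: "cuspF = (\<Union>n\<in>{1..}. cuspF_upto n)"
proof
  show "(\<Union>n\<in>{1..}. cuspF_upto n) \<subseteq> cuspF"
    unfolding cuspF_def cuspF_upto_def by (intro UN_least scaleF2.span_mono) auto
next
  have mono: "cuspF_upto m \<subseteq> cuspF_upto n" if "m \<le> n" for m n
    unfolding cuspF_upto_def using that by (intro scaleF2.span_mono) auto
  show "cuspF \<subseteq> (\<Union>n\<in>{1..}. cuspF_upto n)"
  proof
    fix f assume "f \<in> cuspF"
    then show "f \<in> (\<Union>n\<in>{1..}. cuspF_upto n)"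
      unfolding cuspF_def
    proof (induction rule: scaleF2.span_induct_alt)
      case base
      show ?case
        unfolding cuspF_upto_def by (auto intro: scaleF2.span_zero)
    next
      case (step c g h)
      then obtain k n where k: "g = Delta ^ (2 * k - 1)" "1 \<le> k" and n: "h \<in> cuspF_upto n" "1 \<le> n"
        by auto
      have "g \<in> cuspF_upto (max k n)"
        unfolding cuspF_upto_def k(1) by (rule scaleF2.span_base) (use k(2) in auto)
      moreover have "h \<in> cuspF_upto (max k n)"
        using n mono[of n "max k n"] by auto
      ultimately have "scaleF2 c g + h \<in> cuspF_upto (max k n)"
        unfolding cuspF_upto_def by (intro scaleF2.span_add scaleF2.span_scale)
      then show ?case
        using n(2) by (intro UN_I[of "max k n"]) auto
    qed
  qed
qed

definition Hecke :: "nat \<Rightarrow> bit fps \<Rightarrow> bit fps" where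
  "Hecke p f = Abs_fps (\<lambda>k. fps_nth f (p * k) + (if p dvd k then fps_nth f (k div p) else 0))"

text \<open>The ring of linear endomorphisms of \<open>\<F>(n)\<close>. An endomorphism is represented by a function
  that is \<^term>\<open>undefined\<close> outside \<open>\<F>(n)\<close>, so that equality in the carrier is equality of maps
  on \<open>\<F>(n)\<close>.\<close>

definition EndF :: "nat \<Rightarrow> (bit fps \<Rightarrow> bit fps) ring" where
  "EndF n = \<lparr>
     carrier = {\<phi> \<in> cuspF_upto n \<rightarrow>\<^sub>E cuspF_upto n.
        (\<forall>f\<in>cuspF_upto n. \<forall>g\<in>cuspF_upto n. \<phi> (f + g) = \<phi> f + \<phi> g) \<and>
        (\<forall>c. \<forall>f\<in>cuspF_upto n. \<phi> (scaleF2 c f) = scaleF2 c (\<phi> f))},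
     monoid.mult = (\<lambda>\<phi> \<chi>. compose (cuspF_upto n) \<phi> \<chi>),
     one = (\<lambda>f\<in>cuspF_upto n. f),
     zero = (\<lambda>f\<in>cuspF_upto n. 0),
     add = (\<lambda>\<phi> \<chi>. \<lambda>f\<in>cuspF_upto n. \<phi> f + \<chi> f)\<rparr>"

lemma EndF_ring: "ring (EndF n)"
proof -
  have 0: "0 \<in> cuspF_upto n"
    and add: "\<And>f g. f \<in> cuspF_upto n \<Longrightarrow> g \<in> cuspF_upto n \<Longrightarrow> f + g \<in> cuspF_upto n"
    and scale: "\<And>c f. f \<in> cuspF_upto n \<Longrightarrow> scaleF2 c f \<in> cuspF_upto n"
    by (simp_all add: cuspF_upto_def scaleF2.span_zero scaleF2.span_add scaleF2.span_scale)
  have double: "f + f = 0" for f :: "bit fps"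
    by (rule fps_ext) (simp only: fps_add_nth fps_zero_nth, simp)
  show ?thesis
  proof (rule ringI)
    show "abelian_group (EndF n)"
    proof (rule abelian_groupI)
      fix \<phi> assume "\<phi> \<in> carrier (EndF n)"
      then show "\<exists>\<chi>\<in>carrier (EndF n). \<chi> \<oplus>\<^bsub>EndF n\<^esub> \<phi> = \<zero>\<^bsub>EndF n\<^esub>"
        by (intro bexI[of _ \<phi>]) (auto simp: EndF_def double)
    qed (auto simp: EndF_def 0 add scale PiE_iff extensional_def fun_eq_iff algebra_simps
          scaleF2.scale_right_distrib)
    show "monoid (EndF n)"
      by (rule monoidI)
        (auto simp: EndF_def 0 add scale PiE_iff extensional_def fun_eq_iff compose_def)
  qed (auto simp: EndF_def 0 add scale PiE_iff extensional_def fun_eq_iff compose_def)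
qed

definition HeckeEnd :: "nat \<Rightarrow> nat \<Rightarrow> bit fps \<Rightarrow> bit fps" where
  "HeckeEnd n p = restrict (Hecke p) (cuspF_upto n)"

definition scalarEnd :: "nat \<Rightarrow> bit \<Rightarrow> bit fps \<Rightarrow> bit fps" where
  "scalarEnd n c = restrict (scaleF2 c) (cuspF_upto n)"

definition HeckeAlg_upto :: "nat \<Rightarrow> (bit fps \<Rightarrow> bit fps) ring" where
  "HeckeAlg_upto n = (EndF n)\<lparr>carrier :=
     generate_ring (EndF n) (range (scalarEnd n) \<union> {HeckeEnd n p | p. prime p \<and> odd p})\<rparr>"

text \<open>The projective limit of the rings \<open>A(n)\<close>, \<open>n \<ge> 1\<close>, along the restriction maps.\<close>

definition HeckeAlg :: "(nat \<Rightarrow> bit fps \<Rightarrow> bit fps) ring" where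
  "HeckeAlg = \<lparr>
     carrier = {a \<in> (\<Pi>\<^sub>E n\<in>{1..}. carrier (HeckeAlg_upto n)).
        \<forall>n\<ge>1. restrict (a (Suc n)) (cuspF_upto n) = a n},
     monoid.mult = (\<lambda>a b. \<lambda>n\<in>{1..}. a n \<otimes>\<^bsub>HeckeAlg_upto n\<^esub> b n),
     one = (\<lambda>n\<in>{1..}. \<one>\<^bsub>HeckeAlg_upto n\<^esub>),
     zero = (\<lambda>n\<in>{1..}. \<zero>\<^bsub>HeckeAlg_upto n\<^esub>),
     add = (\<lambda>a b. \<lambda>n\<in>{1..}. a n \<oplus>\<^bsub>HeckeAlg_upto n\<^esub> b n)\<rparr>"

definition HeckeT :: "nat \<Rightarrow> nat \<Rightarrow> bit fps \<Rightarrow> bit fps" where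
  "HeckeT p = (\<lambda>n\<in>{1..}. HeckeEnd n p)"

text \<open>Polynomials and power series in two variables are nested: the coefficient of
  \<open>x\<^sup>i y\<^sup>j\<close> is obtained by taking the \<open>i\<close>-th coefficient first and the \<open>j\<close>-th one after that.\<close>

definition X_var :: "bit fps fps" where
  "X_var = fps_X"

definition Y_var :: "bit fps fps" where
  "Y_var = fps_const fps_X"

abbreviation power_series_ring_XY :: "bit fps fps ring" where
  "power_series_ring_XY \<equiv> ring_of_type_algebra"

definition psi_poly :: "nat \<Rightarrow> bit poly poly \<Rightarrow> bit fps \<Rightarrow> bit fps" where
  "psi_poly n P =
     (\<Oplus>\<^bsub>HeckeAlg_upto n\<^esub> i\<in>{..Polynomial.degree P}.
      \<Oplus>\<^bsub>HeckeAlg_upto n\<^esub> j\<in>{..Polynomial.degree (Polynomial.coeff P i)}.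
        scalarEnd n (Polynomial.coeff (Polynomial.coeff P i) j)
          \<otimes>\<^bsub>HeckeAlg_upto n\<^esub> (HeckeEnd n 3 [^]\<^bsub>HeckeAlg_upto n\<^esub> i)
          \<otimes>\<^bsub>HeckeAlg_upto n\<^esub> (HeckeEnd n 5 [^]\<^bsub>HeckeAlg_upto n\<^esub> j))"

text \<open>The extension of \<open>\<psi>\<^sub>n\<close> to power series. Since \<open>T\<^sub>3\<close> and \<open>T\<^sub>5\<close> are nilpotent in \<open>A(n)\<close>,
  all monomials with large exponents are sent to 0, so the value on a power series is that on a
  truncation of it.\<close>

definition nilp_exponent :: "nat \<Rightarrow> nat" where
  "nilp_exponent n = (LEAST N.
     HeckeEnd n 3 [^]\<^bsub>HeckeAlg_upto n\<^esub> N = \<zero>\<^bsub>HeckeAlg_upto n\<^esub> \<and>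
     HeckeEnd n 5 [^]\<^bsub>HeckeAlg_upto n\<^esub> N = \<zero>\<^bsub>HeckeAlg_upto n\<^esub>)"

definition truncate_XY :: "nat \<Rightarrow> bit fps fps \<Rightarrow> bit poly poly" where
  "truncate_XY N f = map_poly (truncate_fps N) (truncate_fps N f)"

definition psi_upto :: "nat \<Rightarrow> bit fps fps \<Rightarrow> bit fps \<Rightarrow> bit fps" where
  "psi_upto n f = psi_poly n (truncate_XY (nilp_exponent n) f)"

definition psi :: "bit fps fps \<Rightarrow> nat \<Rightarrow> bit fps \<Rightarrow> bit fps" where
  "psi f = (\<lambda>n\<in>{1..}. psi_upto n f)"

end

theory Submission
  imports Defs
    "HOL-Complex_Analysis.Complex_Analysis"
    "HOL-Probability.Distributions"
    "HOL-Number_Theory.Number_Theory"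
begin

hide_const (open) Divisibility.prime
unbundle no vec_syntax

text \<open>Modulo 2, the modular equations of level 3 and 5 between \<open>\<Delta>(q)\<close> and \<open>\<Delta>(q\<^sup>p)\<close> give recurrences
  for \<open>T\<^sub>3\<close> and \<open>T\<^sub>5\<close> on the powers of \<open>\<Delta>\<close>. Index the odd powers by pairs \<open>(a, b)\<close>, the binary digits
  of \<open>k\<close> in even and odd position for \<open>\<Delta>\<^bsup>2k+1\<^esup>\<close>, and give \<open>(a, b)\<close> the weight \<open>2a + 3b\<close>. By the
  recurrences \<open>T\<^sub>3\<close> maps the power indexed by \<open>(a, b)\<close> to that indexed by \<open>(a - 1, b)\<close>, and \<open>T\<^sub>5\<close> to
  that indexed by \<open>(a, b - 1)\<close>, up to powers of smaller weight. Hence the pairing of a power series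
  in \<open>T\<^sub>3, T\<^sub>5\<close> with a form \<open>f\<close> that takes the first coefficient of the transform of \<open>f\<close> is triangular:
  \<open>\<psi>\<close> is injective, and for every \<open>a\<close> in the Hecke algebra there is a power series \<open>b\<close> such that
  \<open>a f\<close> and \<open>\<psi>(b) f\<close> have the same first coefficient for all \<open>f\<close>. The forms \<open>a f - \<psi>(b) f\<close> are mapped to each other by
  all Hecke operators and have first coefficient 0, so they vanish, and \<open>a = \<psi>(b)\<close>.

  That the Hecke operators preserve the filtration is a statement about modular forms of level one
  with integral coefficients: these are polynomials in \<open>\<Delta>\<close> and \<open>E\<^sub>4\<close> with integral coefficients,
  as far as weights divisible by 12 are concerned, and \<open>E\<^sub>4\<close> is 1 modulo 2. The forms \<open>\<Delta>\<close> and \<open>E\<^sub>4\<close> are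
  built from the theta function, whose inversion formula follows from the uniqueness of the
  arithmetic-geometric mean.\<close>

section \<open>Generating series\<close>

text \<open>For a general prime p no explicit modular equation is at hand, so the bound on the
  powers of \<Delta> in T_p(\<Delta>^m) comes from characteristic 0: T_p keeps the weight 12 m of
  the lift, its factor p^(12 m - 1) is odd, and integrality survives because the lifts of \<Delta>^i
  have leading coefficient 1. For the same reason no T_p is ever expressed through T_3 and T_5:
  surjectivity only uses that an element of the algebra commutes with all T_p.

  At 3 and 5 the equations come from counting. Over F_2 a product of two theta series counts
  representations by a binary quadratic form modulo 2; an automorph of the form, a unit or a
  reflection, pairs off the representations, and only its fixed points contribute.

  The inversion of theta is reached without Poisson summation: the agm is strictly increasing in the
  ratio of its arguments, so comparing its limits at t and 1/t identifies the theta constants at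
  both points.\<close>

definition gen_series :: "'i set \<Rightarrow> ('i \<Rightarrow> nat) \<Rightarrow> ('i \<Rightarrow> 'a::comm_ring_1) \<Rightarrow> 'a fps" where
  "gen_series A u f = Abs_fps (\<lambda>n. \<Sum>i\<in>{i\<in>A. u i = n}. f i)"

lemma gen_series_nth: "gen_series A u f $ n = (\<Sum>i\<in>{i\<in>A. u i = n}. f i)"
  by (simp add: gen_series_def)

text \<open>A sum over an infinite set is 0 by convention, so without finite fibres the coefficients
  would not multiply as those of a product.\<close>

lemma gen_series_mult:
  assumes "\<And>n. finite {i\<in>A. u i = n}" "\<And>n. finite {j\<in>B. v j = n}"
  shows "gen_series A u f * gen_series B v g =
    gen_series (A \<times> B) (\<lambda>(i, j). u i + v j) (\<lambda>(i, j). f i * g j)"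
proof (rule fps_ext)
  fix n
  have "(gen_series A u f * gen_series B v g) $ n =
      (\<Sum>k=0..n. \<Sum>p\<in>{i\<in>A. u i = k} \<times> {j\<in>B. v j = n - k}. f (fst p) * g (snd p))"
    by (simp add: fps_mult_nth gen_series_nth sum_product sum.cartesian_product case_prod_unfold)
  also have "\<dots> = (\<Sum>p\<in>(\<Union>k\<in>{0..n}. {i\<in>A. u i = k} \<times> {j\<in>B. v j = n - k}). f (fst p) * g (snd p))"
    by (rule sum.UNION_disjoint[symmetric]) (use assms in auto)
  also have "(\<Union>k\<in>{0..n}. {i\<in>A. u i = k} \<times> {j\<in>B. v j = n - k}) =
      {p\<in>A \<times> B. (\<lambda>(i, j). u i + v j) p = n}"
    by auto
  finally show "(gen_series A u f * gen_series B v g) $ n =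
      gen_series (A \<times> B) (\<lambda>(i, j). u i + v j) (\<lambda>(i, j). f i * g j) $ n"
    by (simp add: gen_series_nth case_prod_unfold)
qed

lemma gen_series_reindex:
  assumes "bij_betw h A B" "\<And>a. a \<in> A \<Longrightarrow> v (h a) = u a" "\<And>a. a \<in> A \<Longrightarrow> g (h a) = f a"
  shows "gen_series A u f = gen_series B v g"
proof (rule fps_ext)
  fix n
  have "bij_betw h {i\<in>A. u i = n} {j\<in>B. v j = n}"
    using assms(1,2) unfolding bij_betw_def by (auto intro: inj_on_subset)
  from sum.reindex_bij_betw[OF this, of g]
  have "(\<Sum>i\<in>{i\<in>A. u i = n}. g (h i)) = (\<Sum>j\<in>{j\<in>B. v j = n}. g j)" .
  moreover have "(\<Sum>i\<in>{i\<in>A. u i = n}. g (h i)) = (\<Sum>i\<in>{i\<in>A. u i = n}. f i)"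
    by (rule sum.cong) (use assms(3) in auto)
  ultimately show "gen_series A u f $ n = gen_series B v g $ n"
    by (simp add: gen_series_nth)
qed

lemma gen_series_cong:
  "\<lbrakk>A = B; \<And>a. a \<in> B \<Longrightarrow> u a = v a; \<And>a. a \<in> B \<Longrightarrow> f a = g a\<rbrakk> \<Longrightarrow> gen_series A u f = gen_series B v g"
  by (rule gen_series_reindex[of id]) auto

lemma gen_series_Un:
  assumes "A \<inter> B = {}" "\<And>n. finite {i\<in>A. u i = n}" "\<And>n. finite {j\<in>B. u j = n}"
  shows "gen_series (A \<union> B) u f = gen_series A u f + gen_series B u f"
proof (rule fps_ext)
  fix n
  have "{i\<in>A \<union> B. u i = n} = {i\<in>A. u i = n} \<union> {j\<in>B. u j = n}" by auto
  then show "gen_series (A \<union> B) u f $ n = (gen_series A u f + gen_series B u f) $ n"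
    by (simp add: gen_series_nth fps_add_nth) (rule sum.union_disjoint, use assms in auto)
qed

lemma gen_series_add:
  "gen_series A u f + gen_series A u g = gen_series A u (\<lambda>i. f i + g i)"
  by (rule fps_ext) (simp add: gen_series_nth fps_add_nth sum.distrib)

lemma gen_series_uminus:
  "- gen_series A u f = gen_series A u (\<lambda>i. - f i)"
  by (rule fps_ext) (simp add: gen_series_nth sum_negf)

lemma fps_compose_X_power_nth:
  fixes F :: "'a::comm_ring_1 fps"
  assumes "d > 0"
  shows "(F oo fps_X ^ d) $ n = (if d dvd n then F $ (n div d) else 0)"
proof -
  have "(F oo fps_X ^ d) $ n = (\<Sum>i=0..n. if n = d * i then F $ i else 0)"
    by (simp add: fps_compose_nth flip: power_mult) (intro sum.cong, auto)
  also have "\<dots> = (if d dvd n then F $ (n div d) else 0)"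
  proof (cases "d dvd n")
    case True
    then obtain m where m: "n = d * m" by auto
    have "(\<Sum>i=0..n. if n = d * i then F $ i else 0) = (\<Sum>i=0..n. if i = m then F $ i else 0)"
      by (rule sum.cong) (use assms m in auto)
    moreover have "m \<le> n" using assms m by simp
    ultimately show ?thesis using assms m by simp
  next
    case False
    then show ?thesis by (auto intro!: sum.neutral)
  qed
  finally show ?thesis .
qed

lemma fps_compose_neg_X_nth:
  fixes F :: "'a::comm_ring_1 fps"
  shows "(F oo - fps_X) $ n = (-1) ^ n * F $ n"
proof -
  have "(- fps_X :: 'a fps) = fps_const (-1) * fps_X"
    by (simp flip: fps_const_neg)
  then show ?thesis by (simp only: fps_compose_linear fps_nth_Abs_fps)
qed

lemma gen_series_compose_X_power:
  assumes "d > 0"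
  shows "gen_series A u f oo fps_X ^ d = gen_series A (\<lambda>i. d * u i) f"
proof (rule fps_ext)
  fix n
  have "{i \<in> A. d * u i = n} = (if d dvd n then {i \<in> A. u i = n div d} else {})"
    using assms by auto
  then show "(gen_series A u f oo fps_X ^ d) $ n = gen_series A (\<lambda>i. d * u i) f $ n"
    by (simp add: fps_compose_X_power_nth[OF assms] gen_series_nth)
qed

lemma gen_series_compose_neg_X:
  "gen_series A u f oo - fps_X = gen_series A u (\<lambda>i. (-1) ^ u i * f i)"
  by (rule fps_ext) (auto simp: fps_compose_neg_X_nth gen_series_nth sum_distrib_left intro: sum.cong)

section \<open>Integral power series and their evaluation\<close>

definition of_int_fps :: "int fps \<Rightarrow> 'a::comm_ring_1 fps" where
  "of_int_fps F = Abs_fps (\<lambda>n. of_int (F $ n))"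

lemma of_int_fps_nth [simp]: "of_int_fps F $ n = of_int (F $ n)"
  by (simp add: of_int_fps_def)

lemma of_int_fps_0 [simp]: "of_int_fps 0 = 0"
  and of_int_fps_1 [simp]: "of_int_fps 1 = 1"
  and of_int_fps_add: "of_int_fps (F + G) = of_int_fps F + of_int_fps G"
  and of_int_fps_diff: "of_int_fps (F - G) = of_int_fps F - of_int_fps G"
  and of_int_fps_mult: "of_int_fps (F * G) = of_int_fps F * of_int_fps G"
  by (rule fps_ext, simp add: fps_mult_nth fps_add_nth fps_one_nth)+

lemma of_int_fps_power: "of_int_fps (F ^ n) = of_int_fps F ^ n"
  by (induction n) (simp_all add: of_int_fps_mult)

lemma of_int_fps_const: "of_int_fps (fps_const c) = fps_const (of_int c)"
  by (rule fps_ext) simp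

lemma of_int_fps_numeral [simp]: "of_int_fps (numeral k) = numeral k"
  by (rule fps_ext) (simp add: numeral_fps_const)

lemma of_int_fps_sum: "of_int_fps (\<Sum>i\<in>A. f i) = (\<Sum>i\<in>A. of_int_fps (f i))"
  by (rule fps_ext) (simp add: fps_sum_nth)

text \<open>Radius at least 1 makes the series holomorphic for |q| < 1, hence on the whole upper
  half plane.\<close>

definition cvg :: "int fps \<Rightarrow> bool" where
  "cvg F \<longleftrightarrow> fps_conv_radius (of_int_fps F :: complex fps) \<ge> 1"

definition ev :: "int fps \<Rightarrow> complex \<Rightarrow> complex" where
  "ev F z = eval_fps (of_int_fps F) z"

lemma cvg_add: "cvg F \<Longrightarrow> cvg G \<Longrightarrow> cvg (F + G)"
  unfolding cvg_def of_int_fps_add using fps_conv_radius_add by (metis min.boundedI order_trans)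

lemma cvg_diff: "cvg F \<Longrightarrow> cvg G \<Longrightarrow> cvg (F - G)"
  unfolding cvg_def of_int_fps_diff using fps_conv_radius_diff by (metis min.boundedI order_trans)

lemma cvg_mult: "cvg F \<Longrightarrow> cvg G \<Longrightarrow> cvg (F * G)"
  unfolding cvg_def of_int_fps_mult using fps_conv_radius_mult by (metis min.boundedI order_trans)

lemma cvg_power: "cvg F \<Longrightarrow> cvg (F ^ n)"
  unfolding cvg_def of_int_fps_power using fps_conv_radius_power by (metis order_trans)

lemma cvg_const: "cvg (fps_const c)" "cvg (numeral k)"
  unfolding cvg_def by (simp_all add: of_int_fps_const)

lemma cvg_0: "cvg 0"
  unfolding cvg_def by simp

lemma cvg_summable:
  fixes z :: complex
  assumes "cvg F" "norm z < 1"
  shows "summable (\<lambda>n. norm (of_int (F $ n) * z ^ n))"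
proof -
  have "ereal (norm z) < fps_conv_radius (of_int_fps F :: complex fps)"
    using assms by (simp add: cvg_def) (metis ereal_less(3) order_less_le_trans)
  from norm_summable_fps[OF this] show ?thesis by simp
qed

lemma cvgI:
  assumes "\<And>r. 0 < r \<Longrightarrow> r < 1 \<Longrightarrow> summable (\<lambda>n. of_int (F $ n) * complex_of_real r ^ n)"
  shows "cvg F"
  unfolding cvg_def fps_conv_radius_def
  by (rule conv_radius_geI_ex') (use assms in auto)

lemma cvg_bounded:
  assumes "\<And>n. \<bar>F $ n\<bar> \<le> c"
  shows "cvg F"
proof (rule cvgI)
  fix r :: real assume r: "0 < r" "r < 1"
  show "summable (\<lambda>n. of_int (F $ n) * complex_of_real r ^ n)"
  proof (rule summable_comparison_test')
    show "summable (\<lambda>n. of_int c * r ^ n)" using r by (intro summable_mult summable_geometric) auto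
    show "norm (of_int (F $ n) * complex_of_real r ^ n) \<le> of_int c * r ^ n" for n
    proof -
      have "\<bar>real_of_int (F $ n)\<bar> \<le> of_int c"
        using assms[of n] by linarith
      then show ?thesis using r by (simp add: norm_mult norm_power mult_right_mono)
    qed
  qed
qed

lemma cvg_compose:
  assumes "cvg F" "d > 0"
  shows "cvg (F oo fps_X ^ d)" and "norm z < 1 \<Longrightarrow> ev (F oo fps_X ^ d) z = ev F (z ^ d)"
proof -
  have s: "(\<lambda>n. of_int ((F oo fps_X ^ d) $ n) * z ^ n) sums ev F (z ^ d)" if z: "norm z < 1" for z
  proof -
    have "norm (z ^ d) < 1" using z assms(2) by (simp add: norm_power power_less_one_iff)
    from summable_norm_cancel[OF cvg_summable[OF assms(1) this]]
    have "(\<lambda>n. of_int (F $ n) * (z ^ d) ^ n) sums ev F (z ^ d)"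
      by (simp add: ev_def eval_fps_def summable_sums)
    moreover have "(\<lambda>n. of_int ((F oo fps_X ^ d) $ (d * n)) * z ^ (d * n)) = (\<lambda>n. of_int (F $ n) * (z ^ d) ^ n)"
      using assms(2) by (auto simp: fps_compose_X_power_nth power_mult)
    moreover have "strict_mono (\<lambda>n. d * n)" using assms(2) by (auto simp: strict_mono_def)
    moreover have "of_int ((F oo fps_X ^ d) $ n) * z ^ n = 0" if "n \<notin> range (\<lambda>n. d * n)" for n
      using that assms(2) by (auto simp: fps_compose_X_power_nth)
    ultimately show ?thesis using sums_mono_reindex[of "\<lambda>n. d * n" "\<lambda>n. of_int ((F oo fps_X ^ d) $ n) * z ^ n"]
      by simp
  qed
  show "cvg (F oo fps_X ^ d)"
    by (rule cvgI, rule sums_summable[OF s]) auto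
  show "norm z < 1 \<Longrightarrow> ev (F oo fps_X ^ d) z = ev F (z ^ d)"
    using sums_unique[OF s[of z]] by (simp add: ev_def eval_fps_def)
qed

lemma cvg_compose_neg:
  assumes "cvg F"
  shows "cvg (F oo - fps_X)" and "norm z < 1 \<Longrightarrow> ev (F oo - fps_X) z = ev F (- z)"
proof -
  have e: "of_int ((F oo - fps_X) $ n) * z ^ n = of_int (F $ n) * (- z) ^ n" for n and z :: complex
    by (simp add: fps_compose_neg_X_nth) (metis power_minus mult.commute mult.left_commute)
  show "cvg (F oo - fps_X)"
    by (rule cvgI, unfold e, rule summable_norm_cancel[OF cvg_summable[OF assms]]) auto
  show "norm z < 1 \<Longrightarrow> ev (F oo - fps_X) z = ev F (- z)"
    unfolding ev_def eval_fps_def using e[of _ z] by simp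
qed

lemma cvg_radius:
  "cvg F \<Longrightarrow> norm (z::complex) < 1 \<Longrightarrow> ereal (norm z) < fps_conv_radius (of_int_fps F :: complex fps)"
  by (simp add: cvg_def) (metis ereal_less(3) order_less_le_trans)

lemma ev_add: "cvg F \<Longrightarrow> cvg G \<Longrightarrow> norm z < 1 \<Longrightarrow> ev (F + G) z = ev F z + ev G z"
  and ev_diff: "cvg F \<Longrightarrow> cvg G \<Longrightarrow> norm z < 1 \<Longrightarrow> ev (F - G) z = ev F z - ev G z"
  and ev_mult: "cvg F \<Longrightarrow> cvg G \<Longrightarrow> norm z < 1 \<Longrightarrow> ev (F * G) z = ev F z * ev G z"
  and ev_power: "cvg F \<Longrightarrow> norm z < 1 \<Longrightarrow> ev (F ^ n) z = ev F z ^ n"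
  unfolding ev_def of_int_fps_add of_int_fps_diff of_int_fps_mult of_int_fps_power
  by (rule eval_fps_add eval_fps_diff eval_fps_mult eval_fps_power; (rule cvg_radius)?; assumption)+

lemma ev_const: "ev (fps_const c) z = of_int c" "ev (numeral k) z = numeral k"
  by (simp_all add: ev_def of_int_fps_const)

lemma ev_0: "ev 0 z = 0"
  by (simp add: ev_def)

lemma ev_at_0: "ev F 0 = of_int (F $ 0)"
  by (simp add: ev_def eval_fps_at_0)

lemma ev_holomorphic: "cvg F \<Longrightarrow> ev F holomorphic_on ball 0 1"
  unfolding ev_def by (rule holomorphic_on_eval_fps) (auto simp: cvg_radius)

section \<open>The theta series\<close>

definition sq :: "int \<Rightarrow> nat" where "sq a = nat (a\<^sup>2)"

lemma int_sq [simp]: "int (sq a) = a\<^sup>2"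
  by (simp add: sq_def)

lemma finite_sq [simp]: "finite {a\<in>A. sq a = n}"
proof (rule finite_subset)
  show "{a\<in>A. sq a = n} \<subseteq> {- int n..int n}"
  proof
    fix a assume "a \<in> {a\<in>A. sq a = n}"
    then have "a\<^sup>2 = int n"
      using int_sq[of a] by auto
    moreover have "\<bar>a\<bar> \<le> \<bar>a\<bar> * \<bar>a\<bar>"
      using mult_left_mono[of 1 "\<bar>a\<bar>" "\<bar>a\<bar>"] by (cases "a = 0") auto
    ultimately have "\<bar>a\<bar> \<le> int n"
      by (simp add: power2_eq_square)
    then show "a \<in> {- int n..int n}" by auto
  qed
qed simp

lemma even_sq [simp]: "even (sq a) \<longleftrightarrow> even a"
  by (metis even_of_nat even_power int_sq zero_less_numeral)

definition theta_fps :: "int fps" where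
  "theta_fps = gen_series UNIV sq (\<lambda>_. 1)"

lemma finite_sq2: "finite {p\<in>A. (\<lambda>(a, b). sq a + sq b) p = n}"
proof (rule finite_subset)
  show "{p\<in>A. (\<lambda>(a, b). sq a + sq b) p = n} \<subseteq> (\<Union>k\<le>n. {a. sq a = k}) \<times> (\<Union>k\<le>n. {a. sq a = k})"
    by auto
  have "finite {a. sq a = k}" for k using finite_sq[of UNIV] by simp
  then show "finite ((\<Union>k\<le>n. {a. sq a = k}) \<times> (\<Union>k\<le>n. {a. sq a = k}))" by blast
qed

lemma gen_series_sq_mult:
  "gen_series UNIV sq f * gen_series UNIV sq g = gen_series UNIV (\<lambda>(a, b). sq a + sq b) (\<lambda>(a, b). f a * g b)"
  using gen_series_mult[of UNIV sq UNIV sq f g] finite_sq[of UNIV] by simp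

text \<open>The map (u, v) -> (u + v, u - v) identifies Z^2 with the sublattice of pairs with even
  sum and doubles u^2 + v^2. This is the source of both doubling formulas for theta.\<close>

lemma bij_sum_diff: "bij_betw (\<lambda>(u, v). (u + v, u - v)) (UNIV \<times> UNIV) {(a, b::int). even (a + b)}"
proof (rule bij_betwI[of _ _ _ "\<lambda>(a, b). ((a + b) div 2, (a - b) div 2)"])
  show "(\<lambda>(u, v). (u + v, u - v)) ((\<lambda>(a, b). ((a + b) div 2, (a - b) div 2)) p) = p"
    if "p \<in> {(a, b::int). even (a + b)}" for p
  proof -
    obtain a b where p: "p = (a, b)" by (cases p)
    then have "even (a + b)" using that by simp
    then have "(a + b) div 2 + (a - b) div 2 = a" "(a + b) div 2 - (a - b) div 2 = b"
      by presburger+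
    then show ?thesis by (simp add: p)
  qed
qed auto

lemma sq_sum_diff: "sq (u + v) + sq (u - v) = 2 * (sq u + sq v)"
proof -
  have "int (sq (u + v) + sq (u - v)) = int (2 * (sq u + sq v))"
    by (simp add: power2_eq_square algebra_simps)
  then show ?thesis by linarith
qed

text \<open>Adding the two squares weights a pair (a, b) by 1 + (-1)^(a + b), which leaves the pairs
  with even sum, each counted twice.\<close>

lemma theta_fps_sq_add:
  "theta_fps\<^sup>2 + (theta_fps oo - fps_X)\<^sup>2 = 2 * (theta_fps oo fps_X ^ 2)\<^sup>2"
proof -
  let ?w = "\<lambda>(a, b). sq a + sq b"
  have "theta_fps\<^sup>2 = gen_series (UNIV \<times> UNIV) ?w (\<lambda>_. 1)"
    by (simp add: theta_fps_def power2_eq_square gen_series_sq_mult case_prod_unfold)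
  moreover have "(theta_fps oo - fps_X)\<^sup>2 = gen_series (UNIV \<times> UNIV) ?w (\<lambda>(a, b). (-1) ^ (sq a + sq b))"
    by (simp add: theta_fps_def power2_eq_square gen_series_compose_neg_X gen_series_sq_mult
        case_prod_unfold power_add)
  ultimately have "theta_fps\<^sup>2 + (theta_fps oo - fps_X)\<^sup>2 =
      gen_series (UNIV \<times> UNIV) ?w (\<lambda>(a, b). 1 + (-1) ^ (sq a + sq b))"
    by (simp add: gen_series_add case_prod_unfold)
  also have "\<dots> = gen_series {(a, b). even (a + b)} ?w (\<lambda>_. 2)"
  proof (rule fps_ext)
    fix n
    show "gen_series (UNIV \<times> UNIV) ?w (\<lambda>(a, b). 1 + (-1) ^ (sq a + sq b)) $ n =
      gen_series {(a, b). even (a + b)} ?w (\<lambda>_. 2::int) $ n"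
      unfolding gen_series_nth
      by (rule sum.mono_neutral_cong_right)
        (use finite_sq2[of UNIV n] in \<open>auto simp: minus_one_power_iff split: if_splits\<close>)
  qed
  also have "\<dots> = gen_series (UNIV \<times> UNIV) (\<lambda>(u, v). 2 * sq u + 2 * sq v) (\<lambda>_. 2)"
    by (rule gen_series_reindex[OF bij_sum_diff, symmetric]) (auto simp: sq_sum_diff distrib_left)
  also have "\<dots> = 2 * gen_series UNIV (\<lambda>(u, v). 2 * sq u + 2 * sq v) (\<lambda>_. 1)"
    by (simp add: gen_series_add mult_2)
  also have "gen_series UNIV (\<lambda>(u, v). 2 * sq u + 2 * sq v) (\<lambda>_. 1) = theta_fps\<^sup>2 oo fps_X ^ 2"
    by (simp only: theta_fps_def power2_eq_square[of "gen_series _ _ _"] gen_series_sq_mult)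
      (simp add: gen_series_compose_X_power case_prod_unfold distrib_left)
  also have "\<dots> = (theta_fps oo fps_X ^ 2)\<^sup>2"
    by (simp add: fps_compose_power)
  finally show ?thesis .
qed

text \<open>When a + b is odd, the sign (-1)^b changes under exchange of a and b, so these pairs
  cancel. On the others b = u - v, and the sign factors as (-1)^u (-1)^v.\<close>

lemma theta_fps_mult_neg:
  "theta_fps * (theta_fps oo - fps_X) = ((theta_fps oo - fps_X) oo fps_X ^ 2)\<^sup>2"
proof -
  let ?w = "\<lambda>(a, b). sq a + sq b"
  let ?s = "\<lambda>(a, b). (-1::int) ^ sq b"
  let ?E = "{(a, b::int). even (a + b)}" and ?O = "{(a, b::int). odd (a + b)}"
  have "theta_fps * (theta_fps oo - fps_X) = gen_series (UNIV \<times> UNIV) ?w ?s"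
    by (simp add: theta_fps_def gen_series_compose_neg_X gen_series_sq_mult case_prod_unfold)
  also have "(UNIV \<times> UNIV :: (int \<times> int) set) = ?E \<union> ?O" by auto
  also have "gen_series (?E \<union> ?O) ?w ?s = gen_series ?E ?w ?s + gen_series ?O ?w ?s"
    by (rule gen_series_Un[OF _ finite_sq2 finite_sq2]) auto
  also have "gen_series ?O ?w ?s = 0"
  proof -
    have "gen_series ?O ?w ?s = gen_series ?O ?w (\<lambda>p. - ?s p)"
      by (rule gen_series_reindex[of "\<lambda>(a, b). (b, a)"])
        (auto simp: bij_betw_def inj_on_def image_iff uminus_power_if)
    then have "gen_series ?O ?w ?s = - gen_series ?O ?w ?s"
      by (simp add: gen_series_uminus)
    then have "2 * gen_series ?O ?w ?s = 0"
      by (simp only: mult_2) (simp add: add_eq_0_iff)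
    then show ?thesis by (simp only: mult_eq_0_iff) simp
  qed
  also have "gen_series ?E ?w ?s = gen_series (UNIV \<times> UNIV) (\<lambda>(u, v). 2 * sq u + 2 * sq v)
      (\<lambda>(u, v). (-1) ^ sq u * (-1) ^ sq v)"
    by (rule gen_series_reindex[OF bij_sum_diff, symmetric])
      (auto simp: sq_sum_diff distrib_left minus_one_power_iff)
  also have "\<dots> = (theta_fps oo - fps_X)\<^sup>2 oo fps_X ^ 2"
    by (simp only: theta_fps_def gen_series_compose_neg_X power2_eq_square[of "gen_series _ _ _"]
        gen_series_sq_mult mult_1_right) (simp add: gen_series_compose_X_power case_prod_unfold distrib_left)
  also have "\<dots> = ((theta_fps oo - fps_X) oo fps_X ^ 2)\<^sup>2"
    by (simp add: fps_compose_power)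
  finally show ?thesis by simp
qed

definition sq_fps :: "int fps" where
  "sq_fps = gen_series {0<..} sq (\<lambda>_. 1)"

lemma theta_fps_eq: "theta_fps = 1 + 2 * sq_fps"
proof -
  have "theta_fps = gen_series ({0} \<union> ({0<..} \<union> {..<0})) sq (\<lambda>_. 1)"
    unfolding theta_fps_def by (rule gen_series_cong) auto
  also have "\<dots> = gen_series {0} sq (\<lambda>_. 1) + (sq_fps + gen_series {..<0} sq (\<lambda>_. 1))"
    unfolding sq_fps_def by (subst gen_series_Un[OF _ finite_sq finite_sq], auto)+
  also have "gen_series {..<0} sq (\<lambda>_. 1) = sq_fps"
    unfolding sq_fps_def
    by (rule gen_series_reindex[of uminus]) (auto simp: sq_def intro: bij_betwI[where g = uminus])
  also have "gen_series {0} sq (\<lambda>_. 1::int) = 1"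
  proof (rule fps_ext)
    fix n
    have "{i \<in> {0}. sq i = n} = (if n = 0 then {0} else {})" by (auto simp: sq_def)
    then show "gen_series {0} sq (\<lambda>_. 1::int) $ n = 1 $ n" by (simp add: gen_series_nth)
  qed
  finally show ?thesis by (simp only: mult_2)
qed

lemma sq_inj: "0 < a \<Longrightarrow> 0 < b \<Longrightarrow> sq a = sq b \<Longrightarrow> a = b"
  by (rule power2_eq_imp_eq) (simp_all only: int_sq[symmetric] less_imp_le)

lemma sq_fps_nth: "sq_fps $ n = (if \<exists>a>0. sq a = n then 1 else 0)"
proof (cases "\<exists>a>0. sq a = n")
  case True
  then obtain a where "a > 0" "sq a = n" by blast
  moreover from this have "i = a" if "i > 0" "sq i = n" for i using sq_inj[of i a] that by blast
  ultimately have "{i \<in> {0<..}. sq i = n} = {a}" by blast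
  then show ?thesis using True by (simp add: sq_fps_def gen_series_nth)
next
  case False
  then have "{i \<in> {0<..}. sq i = n} = {}" by blast
  then show ?thesis using False by (simp add: sq_fps_def gen_series_nth del: Collect_empty_eq)
qed

lemma cvg_sq_fps: "cvg sq_fps"
proof (rule cvg_bounded)
  show "\<bar>sq_fps $ n\<bar> \<le> 1" for n unfolding sq_fps_nth by (rule if_split[THEN iffD2]) simp
qed

lemma cvg_theta_fps: "cvg theta_fps"
proof -
  have "cvg 1" using cvg_const(1)[of 1] by simp
  then show ?thesis unfolding theta_fps_eq by (rule cvg_add[OF _ cvg_mult[OF cvg_const(2) cvg_sq_fps]])
qed

section \<open>Theta as a holomorphic function on the unit disc\<close>

definition theta :: "complex \<Rightarrow> complex" where
  "theta = ev theta_fps"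

lemma theta_sq_add: "norm w < 1 \<Longrightarrow> theta w ^ 2 + theta (- w) ^ 2 = 2 * theta (w\<^sup>2) ^ 2"
proof -
  assume w: "norm w < 1"
  have c: "cvg (theta_fps oo - fps_X)" "cvg (theta_fps oo fps_X ^ 2)"
    by (simp_all only: cvg_compose_neg cvg_compose cvg_theta_fps zero_less_numeral)
  have "ev (theta_fps\<^sup>2 + (theta_fps oo - fps_X)\<^sup>2) w = ev (2 * (theta_fps oo fps_X ^ 2)\<^sup>2) w"
    by (simp only: theta_fps_sq_add)
  then show ?thesis
    by (simp only: ev_add ev_mult ev_power ev_const cvg_power cvg_const cvg_theta_fps c w theta_def
        cvg_compose cvg_compose_neg zero_less_numeral)
qed

lemma theta_mult_neg: "norm w < 1 \<Longrightarrow> theta w * theta (- w) = theta (- (w\<^sup>2)) ^ 2"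
proof -
  assume w: "norm w < 1"
  have w2: "norm (w\<^sup>2) < 1" using w by (simp add: norm_power power_less_one_iff)
  have c: "cvg (theta_fps oo - fps_X)" "cvg ((theta_fps oo - fps_X) oo fps_X ^ 2)"
    by (simp_all only: cvg_compose_neg cvg_compose cvg_theta_fps zero_less_numeral)
  have "ev (theta_fps * (theta_fps oo - fps_X)) w = ev (((theta_fps oo - fps_X) oo fps_X ^ 2)\<^sup>2) w"
    by (simp only: theta_fps_mult_neg)
  then show ?thesis
    by (simp only: ev_mult ev_power cvg_theta_fps c w w2 theta_def
        cvg_compose cvg_compose_neg zero_less_numeral)
qed

lemma theta_holomorphic: "theta holomorphic_on ball 0 1"
  unfolding theta_def by (rule ev_holomorphic[OF cvg_theta_fps])

lemma theta_0 [simp]: "theta 0 = 1"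
proof -
  have "sq_fps $ 0 = 0" by (auto simp: sq_fps_nth sq_def)
  then show ?thesis by (simp add: theta_def ev_at_0 theta_fps_eq)
qed

lemma theta_tendsto: "(f \<longlongrightarrow> 0) F \<Longrightarrow> ((\<lambda>x. theta (f x)) \<longlongrightarrow> 1) F"
proof -
  assume f: "(f \<longlongrightarrow> 0) F"
  have "isCont theta 0"
    using holomorphic_on_imp_continuous_on[OF theta_holomorphic] continuous_on_eq_continuous_at[OF open_ball]
    by (metis centre_in_ball zero_less_one)
  from isCont_tendsto_compose[OF this f] show ?thesis by simp
qed

text \<open>By \<open>theta_mult_neg\<close> a zero at -w propagates to the points -(w^(2^n)). These
  tend to 0, where theta is 1.\<close>

lemma theta_nonzero:
  assumes "norm w < 1"
  shows "theta w \<noteq> 0"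
proof -
  have *: "theta (- (w ^ 2 ^ n)) = 0" if "theta (- w) = 0" "norm w < 1" for w n
  proof (induction n)
    case (Suc n)
    have "norm (w ^ 2 ^ n) < 1" using power_Suc_less_one[of "norm w" "2 ^ n - 1"] that
      by (cases "w = 0") (auto simp: norm_power power_less_one_iff power_0_left)
    from theta_mult_neg[OF this] Suc have "theta (- ((w ^ 2 ^ n)\<^sup>2)) = 0" by simp
    moreover have "(w ^ 2 ^ n)\<^sup>2 = w ^ 2 ^ Suc n" by (simp add: mult.commute flip: power_mult)
    ultimately show ?case by simp
  qed (use that in simp)
  have "filterlim (\<lambda>n. 2 ^ n :: nat) at_top sequentially"
    by (rule filterlim_subseq) (simp add: strict_mono_def)
  then have "(\<lambda>n. (- w) ^ 2 ^ n) \<longlonglongrightarrow> 0"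
    using filterlim_compose[OF LIMSEQ_power_zero[of "- w"]] assms by simp
  then have "(\<lambda>n. theta (- ((- w) ^ 2 ^ n))) \<longlonglongrightarrow> 1"
    by (intro theta_tendsto) (auto intro: tendsto_eq_intros)
  then show ?thesis
    using *[of "- w"] assms by (auto simp: LIMSEQ_const_iff)
qed

section \<open>The arithmetic-geometric mean and the inversion formula for theta\<close>

text \<open>The arithmetic mean after n steps of Gauss's iteration; its limit is the
  arithmetic-geometric mean of x and y.\<close>

fun agm :: "nat \<Rightarrow> real \<Rightarrow> real \<Rightarrow> real" where
  "agm 0 x y = x"
| "agm (Suc n) x y = agm n ((x + y) / 2) (sqrt (x * y))"

lemma agm_mono:
  "0 \<le> x \<Longrightarrow> x \<le> x' \<Longrightarrow> 0 \<le> y \<Longrightarrow> y \<le> y' \<Longrightarrow> agm n x y \<le> agm n x' y'"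
proof (induction n arbitrary: x x' y y')
  case (Suc n)
  then have "x * y \<le> x' * y'" by (intro mult_mono) auto
  with Suc show ?case by (auto intro!: Suc.IH)
qed simp

lemma agm_scale: "0 \<le> c \<Longrightarrow> 0 \<le> x \<Longrightarrow> 0 \<le> y \<Longrightarrow> agm n (c * x) (c * y) = c * agm n x y"
proof (induction n arbitrary: x y)
  case (Suc n)
  have "sqrt (c * x * (c * y)) = c * sqrt (x * y)"
    using Suc.prems by (simp add: real_sqrt_mult mult.commute mult.left_commute)
  moreover have "(c * x + c * y) / 2 = c * ((x + y) / 2)" by (simp add: algebra_simps)
  ultimately have "agm (Suc n) (c * x) (c * y) = agm n (c * ((x + y) / 2)) (c * sqrt (x * y))"
    by (simp only: agm.simps)
  also have "\<dots> = c * agm n ((x + y) / 2) (sqrt (x * y))" using Suc.prems by (intro Suc.IH) auto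
  finally show ?case by simp
qed simp

text \<open>After division by a, one step of the iteration yields (1 + x) / 2 and sqrt x, and
  raising x to x' multiplies both by at least a fixed r > 1. Homogeneity and monotonicity carry r
  through all further steps, so the inequality of the limits is strict.\<close>

lemma agm_limit_less:
  assumes pos: "0 < a" "0 < b" "0 < a'" "0 < b'" "0 < L"
    and lim: "(\<lambda>n. agm n a b) \<longlonglongrightarrow> L" "(\<lambda>n. agm n a' b') \<longlonglongrightarrow> L'"
    and less: "b / a < b' / a'"
  shows "L / a < L' / a'"
proof -
  define x x' where "x = b / a" and "x' = b' / a'"
  have x: "0 < x" "x < x'" using pos less by (simp_all add: x_def x'_def)
  define r where "r = min ((1 + x') / (1 + x)) (sqrt x' / sqrt x)"
  have r: "r > 1" using x by (simp add: r_def)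
  have rl: "r * ((1 + x) / 2) \<le> (1 + x') / 2" "r * sqrt x \<le> sqrt x'"
  proof -
    have "r \<le> (1 + x') / (1 + x)" "r \<le> sqrt x' / sqrt x" by (simp_all add: r_def)
    then show "r * ((1 + x) / 2) \<le> (1 + x') / 2" "r * sqrt x \<le> sqrt x'"
      using x by (simp_all add: field_simps)
  qed
  have l1: "(\<lambda>n. agm n ((1 + x) / 2) (sqrt x)) \<longlonglongrightarrow> L / a"
  proof -
    have "agm (Suc n) a b = a * agm n ((1 + x) / 2) (sqrt x)" for n
      using agm_scale[of a 1 x "Suc n"] pos x by (simp add: x_def)
    then have "(\<lambda>n. a * agm n ((1 + x) / 2) (sqrt x) / a) \<longlonglongrightarrow> L / a"
      using pos LIMSEQ_Suc[OF lim(1)] by (intro tendsto_divide) simp_all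
    then show ?thesis using pos by simp
  qed
  have l2: "(\<lambda>n. agm n ((1 + x') / 2) (sqrt x')) \<longlonglongrightarrow> L' / a'"
  proof -
    have "agm (Suc n) a' b' = a' * agm n ((1 + x') / 2) (sqrt x')" for n
      using agm_scale[of a' 1 x' "Suc n"] pos x by (simp add: x'_def)
    then have "(\<lambda>n. a' * agm n ((1 + x') / 2) (sqrt x') / a') \<longlonglongrightarrow> L' / a'"
      using pos LIMSEQ_Suc[OF lim(2)] by (intro tendsto_divide) simp_all
    then show ?thesis using pos by simp
  qed
  have "r * (L / a) \<le> L' / a'"
  proof (rule LIMSEQ_le[OF tendsto_mult_left[OF l1] l2], intro exI allI impI)
    fix n
    have "r * agm n ((1 + x) / 2) (sqrt x) = agm n (r * ((1 + x) / 2)) (r * sqrt x)"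
      using r x by (intro agm_scale[symmetric]) auto
    also have "\<dots> \<le> agm n ((1 + x') / 2) (sqrt x')"
      using r x rl by (intro agm_mono) auto
    finally show "r * agm n ((1 + x) / 2) (sqrt x) \<le> agm n ((1 + x') / 2) (sqrt x')" .
  qed
  moreover have "L / a > 0" using pos by simp
  then have "L / a < r * (L / a)" using r mult_strict_right_mono[of 1 r "L / a"] by simp
  ultimately show ?thesis by linarith
qed

section \<open>Theta near 1 by Riemann sums of the Gaussian\<close>

lemma gauss_tendsto:
  "((\<lambda>y. integral {0..y} (\<lambda>x::real. exp (- x\<^sup>2))) \<longlongrightarrow> sqrt pi / 2) at_top"
proof -
  let ?f = "\<lambda>x::real. indicator {0..} x *\<^sub>R exp (- x\<^sup>2)"
  have i: "integrable lborel ?f" "integral\<^sup>L lborel ?f = sqrt pi / 2"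
    using gaussian_moment_0 by (auto simp: has_bochner_integral_iff)
  have "((\<lambda>y. \<integral>x. indicator {..y} x *\<^sub>R ?f x \<partial>lborel) \<longlongrightarrow> sqrt pi / 2) at_top"
    using tendsto_integral_at_top[OF _ i(1)] unfolding i(2) by simp
  moreover have "(\<integral>x. indicator {..y} x *\<^sub>R ?f x \<partial>lborel) = integral {0..y} (\<lambda>x. exp (- x\<^sup>2))" for y
  proof -
    have "set_integrable lborel {0..y} (\<lambda>x::real. exp (- x\<^sup>2))"
      by (intro borel_integrable_atLeastAtMost' continuous_intros)
    from set_borel_integral_eq_integral(2)[OF this]
    have "(\<integral>x. indicator {0..y} x *\<^sub>R exp (- x\<^sup>2) \<partial>lborel) = integral {0..y} (\<lambda>x. exp (- x\<^sup>2))"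
      by (simp add: set_lebesgue_integral_def)
    moreover have "(\<lambda>x. indicator {..y} x *\<^sub>R ?f x) = (\<lambda>x. indicator {0..y} x *\<^sub>R exp (- x\<^sup>2))"
      by (auto simp: indicator_def)
    ultimately show ?thesis by simp
  qed
  ultimately show ?thesis by simp
qed

text \<open>Right and left endpoint sums of a function that decreases on the positive axis.\<close>

lemma gauss_riemann_sum:
  fixes h :: real
  assumes h: "h > 0"
  shows "h * (\<Sum>n<N. exp (- (real (Suc n) * h)\<^sup>2)) \<le> integral {0..real N * h} (\<lambda>x. exp (- x\<^sup>2))"
    and "integral {0..real N * h} (\<lambda>x. exp (- x\<^sup>2)) \<le> h * (\<Sum>n<N. exp (- (real n * h)\<^sup>2))"
proof (induction N)
  case (Suc N)
  let ?g = "\<lambda>x::real. exp (- x\<^sup>2)"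
  let ?J = "{real N * h..real (Suc N) * h}"
  have int: "?g integrable_on {a..b}" for a b
    by (intro integrable_continuous_real continuous_intros)
  have le: "real N * h \<le> real (Suc N) * h" "0 \<le> real N * h" using h by auto
  have split: "integral {0..real N * h} ?g + integral ?J ?g = integral {0..real (Suc N) * h} ?g"
    using le by (intro Henstock_Kurzweil_Integration.integral_combine int) auto
  have len: "real (Suc N) * h - real N * h = h" by (simp add: algebra_simps)
  have cst: "integral ?J (\<lambda>_. c) = c * h" for c :: real
    using len le by (simp add: mult.commute)
  have bnd: "?g (real (Suc N) * h) \<le> ?g x" "?g x \<le> ?g (real N * h)" if "x \<in> ?J" for x
  proof -
    have "(real N * h)\<^sup>2 \<le> x\<^sup>2" "x\<^sup>2 \<le> (real (Suc N) * h)\<^sup>2"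
      using that le by (auto intro!: power_mono)
    then show "?g (real (Suc N) * h) \<le> ?g x" "?g x \<le> ?g (real N * h)" by auto
  qed
  have "?g (real (Suc N) * h) * h \<le> integral ?J ?g"
    using integral_le[OF integrable_const_ivl int, of "real N * h" "real (Suc N) * h" "?g (real (Suc N) * h)"] bnd(1)
    unfolding cst by blast
  moreover have "integral ?J ?g \<le> ?g (real N * h) * h"
    using integral_le[OF int integrable_const_ivl, of "real N * h" "real (Suc N) * h" "?g (real N * h)"] bnd(2)
    unfolding cst by blast
  ultimately show "h * (\<Sum>n<Suc N. ?g (real (Suc n) * h)) \<le> integral {0..real (Suc N) * h} ?g"
    and "integral {0..real (Suc N) * h} ?g \<le> h * (\<Sum>n<Suc N. ?g (real n * h))"
    using Suc split by (simp_all add: algebra_simps del: of_nat_Suc)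
qed auto

definition rtheta :: "real \<Rightarrow> real" where
  "rtheta x = Re (theta (of_real x))"

lemma of_real_rtheta:
  assumes "\<bar>x\<bar> < 1"
  shows "of_real (rtheta x) = theta (of_real x)"
proof -
  have "summable (\<lambda>n. norm (of_int (theta_fps $ n) * complex_of_real x ^ n))"
    using assms by (intro cvg_summable cvg_theta_fps) simp
  then have "summable (\<lambda>n. real_of_int (theta_fps $ n) * x ^ n)"
    by (rule_tac summable_norm_cancel) (simp add: norm_mult norm_power abs_mult power_abs)
  from suminf_of_real[OF this, where ?'a = complex]
  have "theta (of_real x) = of_real (\<Sum>n. real_of_int (theta_fps $ n) * x ^ n)"
    by (simp add: theta_def ev_def eval_fps_def)
  then show ?thesis by (simp add: rtheta_def)
qed

lemma rtheta_nonzero: "\<bar>x\<bar> < 1 \<Longrightarrow> rtheta x \<noteq> 0"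
  using theta_nonzero[of "of_real x"] by (auto simp flip: of_real_rtheta)

lemma rtheta_sq_add:
  assumes "\<bar>x\<bar> < 1"
  shows "rtheta x ^ 2 + rtheta (- x) ^ 2 = 2 * rtheta (x\<^sup>2) ^ 2"
proof -
  have "\<bar>x\<^sup>2\<bar> < 1" using assms by (simp add: abs_square_less_1)
  then have "complex_of_real (rtheta x ^ 2 + rtheta (- x) ^ 2) = of_real (2 * rtheta (x\<^sup>2) ^ 2)"
    using theta_sq_add[of "of_real x"] assms by (simp add: of_real_rtheta)
  then show ?thesis by (simp only: of_real_eq_iff)
qed

lemma rtheta_mult_neg:
  assumes "\<bar>x\<bar> < 1"
  shows "rtheta x * rtheta (- x) = rtheta (- (x\<^sup>2)) ^ 2"
proof -
  have "\<bar>x\<^sup>2\<bar> < 1" using assms by (simp add: abs_square_less_1)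
  then have "complex_of_real (rtheta x * rtheta (- x)) = of_real (rtheta (- (x\<^sup>2)) ^ 2)"
    using theta_mult_neg[of "of_real x"] assms by (simp add: of_real_rtheta)
  then show ?thesis by (simp only: of_real_eq_iff)
qed

lemma rtheta_sums:
  assumes "\<bar>x\<bar> < 1"
  shows "(\<lambda>n. x ^ (Suc n)\<^sup>2) sums ((rtheta x - 1) / 2)"
proof -
  have x: "norm (complex_of_real x) < 1" using assms by simp
  have "(\<lambda>n. of_int (sq_fps $ n) * complex_of_real x ^ n) sums ev sq_fps (of_real x)"
    using summable_norm_cancel[OF cvg_summable[OF cvg_sq_fps x]]
    by (simp add: ev_def eval_fps_def summable_sums)
  moreover have "of_int (sq_fps $ n) * complex_of_real x ^ n = 0" if "n \<notin> range (\<lambda>n. (Suc n)\<^sup>2)" for n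
  proof -
    have "\<not> (\<exists>a>0. sq a = n)"
    proof
      assume "\<exists>a>0. sq a = n"
      then obtain a where a: "a > 0" "sq a = n" by blast
      then have "Suc (nat (a - 1)) = nat a" by simp
      then have "n = (Suc (nat (a - 1)))\<^sup>2"
        using a by (simp only: sq_def nat_power_eq)
      with that show False by blast
    qed
    then have "sq_fps $ n = 0" unfolding sq_fps_nth by (rule if_not_P)
    then show ?thesis by simp
  qed
  moreover have "strict_mono (\<lambda>n. (Suc n)\<^sup>2)"
    by (auto simp: strict_mono_def power_strict_mono)
  ultimately have "(\<lambda>n. of_int (sq_fps $ (Suc n)\<^sup>2) * complex_of_real x ^ (Suc n)\<^sup>2) sums ev sq_fps (of_real x)"
    by (subst sums_mono_reindex[of "\<lambda>n. (Suc n)\<^sup>2"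
          "\<lambda>n. of_int (sq_fps $ n) * complex_of_real x ^ n"]) auto
  moreover have "sq_fps $ (Suc n)\<^sup>2 = 1" for n
  proof -
    have "sq (int (Suc n)) = (Suc n)\<^sup>2" by (simp add: sq_def nat_power_eq del: of_nat_Suc)
    then show ?thesis unfolding sq_fps_nth by (metis of_nat_0_less_iff zero_less_Suc)
  qed
  ultimately have "(\<lambda>n. complex_of_real (x ^ (Suc n)\<^sup>2)) sums ev sq_fps (of_real x)"
    by simp
  moreover have "theta (of_real x) = 1 + 2 * ev sq_fps (of_real x)"
  proof -
    have "cvg 1" using cvg_const(1)[of 1] by simp
    then show ?thesis unfolding theta_def theta_fps_eq
      using x by (simp add: ev_add ev_mult ev_const cvg_mult cvg_sq_fps cvg_const(2))
        (simp add: ev_def)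
  qed
  then have "ev sq_fps (of_real x) = of_real ((rtheta x - 1) / 2)"
    using assms by (simp flip: of_real_rtheta)
  ultimately show ?thesis by (simp only: sums_of_real_iff)
qed

text \<open>With step h = sqrt (pi s) the terms of theta are values of the Gaussian at multiples of
  h. Comparison with the integral sqrt pi / 2 shows that sqrt s times theta is 1 + O(sqrt s) for
  small s; this asymptotic takes the place of the exact transformation law until that is
  proved.\<close>

lemma rtheta_gauss_bounds:
  assumes s: "s > 0"
  shows "1 - sqrt s \<le> sqrt s * rtheta (exp (- (pi * s)))" "sqrt s * rtheta (exp (- (pi * s))) \<le> 1 + sqrt s"
proof -
  define h where "h = sqrt (pi * s)"
  have h: "h > 0" "h\<^sup>2 = pi * s" using s by (simp_all add: h_def)
  define S where "S = (rtheta (exp (- (pi * s))) - 1) / 2"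
  have g: "exp (- (pi * s)) ^ n\<^sup>2 = exp (- (real n * h)\<^sup>2)" for n
    by (simp add: power_mult_distrib h(2) mult.commute flip: exp_of_nat_mult)
  have "(\<lambda>n. exp (- (real (Suc n) * h)\<^sup>2)) sums S"
    using rtheta_sums[of "exp (- (pi * s))"] s unfolding S_def g by simp
  then have S: "(\<lambda>N. \<Sum>n<N. exp (- (real (Suc n) * h)\<^sup>2)) \<longlonglongrightarrow> S"
    by (simp add: sums_def)
  have I: "(\<lambda>N. integral {0..real N * h} (\<lambda>x. exp (- x\<^sup>2))) \<longlonglongrightarrow> sqrt pi / 2"
    by (rule filterlim_compose[OF gauss_tendsto])
      (use h in \<open>auto intro!: filterlim_at_top_mult_tendsto_pos[OF tendsto_const] filterlim_real_sequentially\<close>)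
  have up: "h * S \<le> sqrt pi / 2"
    using LIMSEQ_le[OF tendsto_mult_left[OF S, of h] I] gauss_riemann_sum(1)[OF h(1)] by blast
  have S1: "(\<lambda>N. \<Sum>n<N. exp (- (real n * h)\<^sup>2)) \<longlonglongrightarrow> S + 1"
  proof -
    have "(\<lambda>n. exp (- (real n * h)\<^sup>2)) sums (S + 1)"
      using \<open>(\<lambda>n. exp (- (real (Suc n) * h)\<^sup>2)) sums S\<close> sums_Suc_iff[of "\<lambda>n. exp (- (real n * h)\<^sup>2)" S]
      by simp
    then show ?thesis by (simp add: sums_def)
  qed
  have lo: "sqrt pi / 2 \<le> h * (S + 1)"
    using LIMSEQ_le[OF I tendsto_mult_left[OF S1, of h]] gauss_riemann_sum(2)[OF h(1)] by blast
  have hs: "h = sqrt pi * sqrt s" by (simp add: h_def real_sqrt_mult)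
  have t: "rtheta (exp (- (pi * s))) = 1 + 2 * S" by (simp add: S_def)
  have "sqrt pi * (sqrt s * S) \<le> sqrt pi * (1 / 2)" using up by (simp add: hs mult.assoc)
  then have "sqrt s * S \<le> 1 / 2" by (subst (asm) mult_le_cancel_left_pos) auto
  moreover have "sqrt pi * (1 / 2) \<le> sqrt pi * (sqrt s * (S + 1))" using lo by (simp add: hs mult.assoc)
  then have "1 / 2 \<le> sqrt s * (S + 1)" by (subst (asm) mult_le_cancel_left_pos) auto
  ultimately show "1 - sqrt s \<le> sqrt s * rtheta (exp (- (pi * s)))"
    "sqrt s * rtheta (exp (- (pi * s))) \<le> 1 + sqrt s"
    by (simp_all add: t algebra_simps)
qed

text \<open>On the imaginary axis \<open>A\<close>, \<open>B\<close>, \<open>C\<close> are the squares of the three theta constants.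
  Doubling the argument is one step of the arithmetic-geometric mean of \<open>A\<close> and \<open>B\<close>, halving it
  (up to a factor 2) one step of that of \<open>A\<close> and \<open>C\<close>.\<close>

context
begin

private definition A :: "real \<Rightarrow> real" where "A t = rtheta (exp (- (pi * t))) ^ 2"
private definition B :: "real \<Rightarrow> real" where "B t = rtheta (- exp (- (pi * t))) ^ 2"
private definition C :: "real \<Rightarrow> real" where "C t = A (t / 2) - A t"

private lemma exp2: "exp (- (pi * (2 * t))) = (exp (- (pi * t)))\<^sup>2"
  by (simp add: power2_eq_square flip: exp_add)

private lemma A_pos: "t > 0 \<Longrightarrow> A t > 0" and B_pos: "t > 0 \<Longrightarrow> B t > 0"
  using rtheta_nonzero[of "exp (- (pi * t))"] rtheta_nonzero[of "- exp (- (pi * t))"]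
  by (simp_all add: A_def B_def)

private lemma A_double: "t > 0 \<Longrightarrow> A (2 * t) = (A t + B t) / 2"
  using rtheta_sq_add[of "exp (- (pi * t))"] by (simp add: A_def B_def exp2)

private lemma B_double: "t > 0 \<Longrightarrow> B (2 * t) = sqrt (A t * B t)"
  using rtheta_mult_neg[of "exp (- (pi * t))"]
  by (intro real_sqrt_unique[symmetric]) (simp_all add: A_def B_def exp2 flip: power_mult_distrib)

text \<open>Jacobi's identity for the fourth powers of the theta constants, from the doubling
  formulas at t / 2.\<close>

private lemma C_sq:
  assumes "t > 0" shows "C t ^ 2 = A t ^ 2 - B t ^ 2"
proof -
  have "B t ^ 2 = A (t / 2) * B (t / 2)" using B_double[of "t / 2"] A_pos[of "t / 2"] B_pos[of "t / 2"] assms by simp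
  moreover have "B (t / 2) = 2 * A t - A (t / 2)" using A_double[of "t / 2"] assms by simp
  ultimately show ?thesis unfolding C_def by (simp add: power2_eq_square algebra_simps)
qed

private lemma C_half_sq:
  assumes "t > 0" shows "C (t / 2) ^ 2 = 4 * A t * C t"
proof -
  have B: "B (t / 2) = 2 * A t - A (t / 2)" using A_double[of "t / 2"] assms by simp
  show ?thesis using C_sq[of "t / 2"] assms unfolding B C_def[of t]
    by (simp add: power2_eq_square algebra_simps)
qed

text \<open>The sign of the difference \<open>C\<close> is not visible from its definition; it
  follows because 4 A(t) C(t) is a square.\<close>

private lemma C_nonneg: "t > 0 \<Longrightarrow> C t \<ge> 0"
  using C_half_sq[of t] A_pos[of t] zero_le_power2[of "C (t / 2)"] mult_pos_neg[of "4 * A t" "C t"]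
  by linarith

private lemma C_half: "t > 0 \<Longrightarrow> C (t / 2) = 2 * sqrt (A t * C t)"
proof -
  assume t: "t > 0"
  have "(2 * sqrt (A t * C t))\<^sup>2 = C (t / 2) ^ 2"
    using C_half_sq[OF t] A_pos[OF t] C_nonneg[OF t] by (simp add: power_mult_distrib)
  then show ?thesis
    using C_nonneg[of "t / 2"] C_nonneg[OF t] A_pos[OF t] t by (intro power2_eq_imp_eq[of "C (t / 2)"]) auto
qed

private lemma agm_A_B: "t > 0 \<Longrightarrow> agm n (A t) (B t) = A (2 ^ n * t)"
proof (induction n arbitrary: t)
  case (Suc n)
  have "agm (Suc n) (A t) (B t) = agm n (A (2 * t)) (B (2 * t))"
    using Suc.prems by (simp add: A_double B_double)
  then show ?case using Suc.IH[of "2 * t"] Suc.prems by (simp add: mult_ac)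
qed simp

private lemma agm_A_C: "t > 0 \<Longrightarrow> agm n (A t) (C t) = A (t / 2 ^ n) / 2 ^ n"
proof (induction n arbitrary: t)
  case (Suc n)
  have "(A t + C t) / 2 = 1 / 2 * A (t / 2)" by (simp add: C_def)
  moreover have "sqrt (A t * C t) = 1 / 2 * C (t / 2)" using C_half[of t] Suc.prems by simp
  ultimately have "agm (Suc n) (A t) (C t) = agm n (1 / 2 * A (t / 2)) (1 / 2 * C (t / 2))"
    by (simp only: agm.simps)
  also have "\<dots> = 1 / 2 * agm n (A (t / 2)) (C (t / 2))"
    using Suc.prems A_pos[of "t / 2"] C_nonneg[of "t / 2"] by (intro agm_scale) auto
  finally show ?case using Suc.IH[of "t / 2"] Suc.prems by (simp add: field_simps)
qed simp

private lemma lim_A_B: "t > 0 \<Longrightarrow> (\<lambda>n. agm n (A t) (B t)) \<longlonglongrightarrow> 1"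
proof -
  assume t: "t > 0"
  have "(\<lambda>n. exp (- (pi * (2 ^ n * t)))) \<longlonglongrightarrow> 0"
  proof -
    have "filterlim (\<lambda>n. 2 ^ n :: real) at_top sequentially"
      by (rule filterlim_at_infinity_imp_filterlim_at_top[OF filterlim_realpow_sequentially_gt1]) auto
    then have "filterlim (\<lambda>n. (pi * t) * 2 ^ n) at_top sequentially"
      using t by (intro filterlim_tendsto_pos_mult_at_top[OF tendsto_const]) auto
    then have "filterlim (\<lambda>n. - (pi * (2 ^ n * t))) at_bot sequentially"
      by (simp add: filterlim_uminus_at_bot mult_ac)
    then show ?thesis by (rule filterlim_compose[OF exp_at_bot])
  qed
  then have "(\<lambda>n. complex_of_real (exp (- (pi * (2 ^ n * t))))) \<longlonglongrightarrow> 0"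
    by (metis of_real_0 tendsto_of_real)
  then have "(\<lambda>n. Re (theta (of_real (exp (- (pi * (2 ^ n * t)))))) ^ 2) \<longlonglongrightarrow> (Re 1) ^ 2"
    by (intro tendsto_power tendsto_Re theta_tendsto)
  then have "(\<lambda>n. A (2 ^ n * t)) \<longlonglongrightarrow> 1" by (simp add: A_def rtheta_def)
  then show ?thesis by (simp add: agm_A_B[OF t])
qed

text \<open>By \<open>agm_A_C\<close> the n-th iterate is s A(s) / t with s = t / 2^n, and the
  Gaussian bounds give s A(s) -> 1 as s -> 0.\<close>

private lemma lim_A_C: "t > 0 \<Longrightarrow> (\<lambda>n. agm n (A t) (C t)) \<longlonglongrightarrow> 1 / t"
proof -
  assume t: "t > 0"
  let ?s = "\<lambda>n. t / 2 ^ n"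
  have s0: "(\<lambda>n. sqrt (?s n)) \<longlonglongrightarrow> 0"
  proof -
    have "(\<lambda>n. t * (1 / 2) ^ n) \<longlonglongrightarrow> t * 0" by (intro tendsto_mult_left LIMSEQ_power_zero) auto
    then have "(\<lambda>n. sqrt (?s n)) \<longlonglongrightarrow> sqrt 0" by (intro tendsto_real_sqrt) (simp add: power_divide)
    then show ?thesis by simp
  qed
  have "(\<lambda>n. sqrt (?s n) * rtheta (exp (- (pi * ?s n)))) \<longlonglongrightarrow> 1"
  proof (rule tendsto_sandwich)
    show "(\<lambda>n. 1 - sqrt (?s n)) \<longlonglongrightarrow> 1" "(\<lambda>n. 1 + sqrt (?s n)) \<longlonglongrightarrow> 1"
      using tendsto_diff[OF tendsto_const s0, of 1] tendsto_add[OF tendsto_const s0, of 1] by simp_all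
  qed (intro always_eventually allI rtheta_gauss_bounds; use t in simp)+
  then have "(\<lambda>n. (sqrt (?s n) * rtheta (exp (- (pi * ?s n))))\<^sup>2 / t) \<longlonglongrightarrow> 1\<^sup>2 / t"
    using t by (intro tendsto_intros) auto
  moreover have "(sqrt (?s n) * rtheta (exp (- (pi * ?s n))))\<^sup>2 / t = agm n (A t) (C t)" for n
    unfolding agm_A_C[OF t] using t by (simp add: A_def power_mult_distrib del: real_sqrt_divide)
  ultimately show ?thesis by simp
qed

text \<open>If C vanished at t, then A would be constant along all halvings of t, and the iterates
  A(t) / 2^n would tend to 0 instead of 1 / t. Strict positivity is needed for
  \<open>agm_limit_less\<close>.\<close>

private lemma C_pos:
  assumes t: "t > 0" shows "C t > 0"
proof (rule ccontr)
  assume "\<not> C t > 0"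
  then have C: "C t = 0" using C_nonneg[OF t] by simp
  have "C (t / 2 ^ n) = 0 \<and> A (t / 2 ^ n) = A t" for n
  proof (induction n)
    case (Suc n)
    have "A (t / 2 ^ n / 2) = A t" using Suc C_def[of "t / 2 ^ n"] by simp
    moreover have "C (t / 2 ^ n / 2) = 0" using Suc C_half[of "t / 2 ^ n"] t by simp
    ultimately show ?case by (simp add: mult.commute)
  qed (use C in simp)
  then have "agm n (A t) (C t) = A t * (1 / 2) ^ n" for n
    by (simp add: agm_A_C[OF t] power_divide)
  moreover have "(\<lambda>n. A t * (1 / 2) ^ n) \<longlonglongrightarrow> A t * 0"
    by (intro tendsto_mult_left LIMSEQ_power_zero) auto
  ultimately have "(\<lambda>n. agm n (A t) (C t)) \<longlonglongrightarrow> 0" by simp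
  with lim_A_C[OF t] have "1 / t = 0" using LIMSEQ_unique by blast
  then show False using t by simp
qed

text \<open>Put u = 1 / t. The pairs (A u, B u) and (t A t, t C t) both have agm 1, the pairs (A u,
  C u) and (t A t, t B t) both have agm t. If B u / A u and C t / A t differed, the first two pairs
  would order A u and t A t one way; Jacobi's identity reverses the complementary ratios, so the
  last two would order them the other way. Equal ratios then give A u = t A t by
  homogeneity.\<close>

private lemma A_inversion:
  assumes t: "t > 0" shows "A (1 / t) = t * A t"
proof -
  define u where "u = 1 / t"
  have u: "u > 0" using t by (simp add: u_def)
  note pos = A_pos[OF t] B_pos[OF t] C_pos[OF t] A_pos[OF u] B_pos[OF u] C_pos[OF u] t u
  have l1: "(\<lambda>n. agm n (A u) (B u)) \<longlonglongrightarrow> 1" by (rule lim_A_B[OF u])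
  have l2: "(\<lambda>n. agm n (A u) (C u)) \<longlonglongrightarrow> t" using lim_A_C[OF u] by (simp add: u_def)
  have l3: "(\<lambda>n. agm n (t * A t) (t * C t)) \<longlonglongrightarrow> 1"
    using tendsto_mult_left[OF lim_A_C[OF t], of t] pos by (simp add: agm_scale)
  have l4: "(\<lambda>n. agm n (t * A t) (t * B t)) \<longlonglongrightarrow> t"
    using tendsto_mult_left[OF lim_A_B[OF t], of t] pos by (simp add: agm_scale)
  have sqs: "(B s / A s)\<^sup>2 + (C s / A s)\<^sup>2 = 1" if "s > 0" for s
    using C_sq[OF that] A_pos[OF that] by (simp add: power_divide field_simps)
  have *: "B u / A u = C t / A t"
  proof (cases "B u / A u" "C t / A t" rule: linorder_cases)
    case less
    then have "B u / A u < t * C t / (t * A t)" using t by simp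
    from agm_limit_less[OF _ _ _ _ _ l1 l3 this] have a: "1 / A u < 1 / (t * A t)" using pos by simp
    have "(B u / A u)\<^sup>2 < (C t / A t)\<^sup>2" using less pos by (intro power_strict_mono) auto
    then have "(B t / A t)\<^sup>2 < (C u / A u)\<^sup>2" using sqs[OF t] sqs[OF u] by linarith
    then have "B t / A t < C u / A u" using pos by (intro power2_less_imp_less[of "B t / A t"]) auto
    then have "t * B t / (t * A t) < C u / A u" using t by simp
    from agm_limit_less[OF _ _ _ _ _ l4 l2 this] have "t / (t * A t) < t / A u" using pos by simp
    with a pos show ?thesis by (simp add: field_simps)
  next
    case greater
    then have "t * C t / (t * A t) < B u / A u" using t by simp
    from agm_limit_less[OF _ _ _ _ _ l3 l1 this] have a: "1 / (t * A t) < 1 / A u" using pos by simp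
    have "(C t / A t)\<^sup>2 < (B u / A u)\<^sup>2" using greater pos by (intro power_strict_mono) auto
    then have "(C u / A u)\<^sup>2 < (B t / A t)\<^sup>2" using sqs[OF t] sqs[OF u] by linarith
    then have "C u / A u < B t / A t" using pos by (intro power2_less_imp_less[of "C u / A u"]) auto
    then have "C u / A u < t * B t / (t * A t)" using t by simp
    from agm_limit_less[OF _ _ _ _ _ l2 l4 this] have "t / A u < t / (t * A t)" using pos by simp
    with a pos show ?thesis by (simp add: field_simps)
  qed simp
  define x where "x = C t / A t"
  have x: "x > 0" "B u = A u * x" "C t = A t * x" using * pos by (simp_all add: x_def field_simps)
  have "agm n (A u) (B u) = A u * agm n 1 x" "agm n (t * A t) (t * C t) = t * A t * agm n 1 x" for n
    using agm_scale[of "A u" 1 x n] agm_scale[of "t * A t" 1 x n] pos x by (simp_all add: mult.assoc)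
  then have "(\<lambda>n. agm n 1 x) \<longlonglongrightarrow> 1 / A u" "(\<lambda>n. agm n 1 x) \<longlonglongrightarrow> 1 / (t * A t)"
    using tendsto_divide[OF l1 tendsto_const, of "A u"] tendsto_divide[OF l3 tendsto_const, of "t * A t"] pos
    by simp_all
  then have "1 / A u = 1 / (t * A t)" by (rule LIMSEQ_unique)
  then show ?thesis using pos by (simp add: u_def field_simps)
qed

lemma rtheta_inversion:
  "t > 0 \<Longrightarrow> rtheta (exp (- (pi * (1 / t)))) ^ 2 = t * rtheta (exp (- (pi * t))) ^ 2"
  using A_inversion unfolding A_def .

end

section \<open>Inversion of theta on the upper half plane\<close>

definition nome :: "complex \<Rightarrow> complex" where
  "nome \<tau> = exp (\<i> * pi * \<tau>)"

lemma norm_nome: "norm (nome \<tau>) = exp (- (pi * Im \<tau>))"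
  by (simp add: nome_def)

lemma norm_nome_less_1: "Im \<tau> > 0 \<Longrightarrow> norm (nome \<tau>) < 1"
  by (simp add: norm_nome)

lemma Im_inverse_pos: "Im \<tau> > 0 \<Longrightarrow> Im (- 1 / \<tau>) > 0"
  by (cases "\<tau> = 0") (simp_all add: Im_divide power2_eq_square add_nonneg_pos divide_neg_pos)

text \<open>Stated for squares, which avoids a branch of the square root of \<tau> / \<i>. Both
  sides are holomorphic and agree on the positive imaginary axis by
  \<open>rtheta_inversion\<close>.\<close>

lemma theta_inversion:
  assumes "Im \<tau> > 0"
  shows "theta (nome (- 1 / \<tau>)) ^ 2 = \<tau> / \<i> * theta (nome \<tau>) ^ 2"
proof -
  let ?H = "{z. Im z > 0}"
  define f where "f = (\<lambda>z. theta (nome (- 1 / z)) ^ 2 - z / \<i> * theta (nome z) ^ 2)"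
  have hol: "(\<lambda>z. theta (nome (g z))) holomorphic_on ?H" if "g holomorphic_on ?H" "\<And>z. z \<in> ?H \<Longrightarrow> Im (g z) > 0" for g
  proof -
    have "(theta \<circ> (\<lambda>z. nome (g z))) holomorphic_on ?H"
      by (rule holomorphic_on_compose_gen[OF _ theta_holomorphic])
        (use that norm_nome_less_1 in \<open>auto simp: nome_def intro!: holomorphic_intros\<close>)
    then show ?thesis by (simp add: o_def)
  qed
  have "f holomorphic_on ?H"
    unfolding f_def by (intro holomorphic_intros hol) (use Im_inverse_pos in auto)
  moreover have "\<i> islimpt ((\<lambda>t. \<i> * of_real t) ` {0<..})"
  proof -
    have "\<i> \<in> closure ((\<lambda>t. \<i> * of_real t) ` {1<..})"
      unfolding closure_sequential
    proof (intro exI conjI allI)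
      show "(\<lambda>n. \<i> * complex_of_real (1 + 1 / Suc n)) \<longlonglongrightarrow> \<i>"
        using tendsto_mult_left[OF tendsto_of_real[OF tendsto_add[OF tendsto_const LIMSEQ_Suc[OF lim_inverse_n']], of 1], of \<i>]
        by simp
      show "\<i> * complex_of_real (1 + 1 / Suc n) \<in> (\<lambda>t. \<i> * of_real t) ` {1<..}" for n
        by (rule imageI) simp
    qed
    moreover have "\<i> \<notin> (\<lambda>t. \<i> * of_real t) ` {1<..}"
      by (auto dest: arg_cong[of _ _ Im])
    ultimately have "\<i> islimpt (\<lambda>t. \<i> * of_real t) ` {1<..}"
      by (simp add: closure_def)
    then show ?thesis by (rule islimpt_subset) auto
  qed
  moreover have "f z = 0" if "z \<in> (\<lambda>t. \<i> * of_real t) ` {0<..}" for z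
  proof -
    obtain t :: real where t: "t > 0" "z = \<i> * of_real t" using \<open>z \<in> _\<close> by auto
    have "nome z = of_real (exp (- (pi * t)))" "nome (- 1 / z) = of_real (exp (- (pi * (1 / t))))"
      using t by (simp_all add: nome_def field_simps flip: exp_of_real)
    moreover have "complex_of_real (rtheta (exp (- (pi * (1 / t)))) ^ 2) = of_real (t * rtheta (exp (- (pi * t))) ^ 2)"
      by (simp only: rtheta_inversion[OF t(1)])
    ultimately show ?thesis
      using t by (simp add: f_def of_real_rtheta)
  qed
  ultimately have "f \<tau> = 0"
    by (rule_tac analytic_continuation[where f = f and S = ?H and U = "(\<lambda>t. \<i> * of_real t) ` {0<..}" and \<xi> = \<i>])
      (use assms in \<open>auto simp: open_halfspace_Im_gt convex_connected convex_halfspace_Im_gt\<close>)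
  then show ?thesis by (simp only: f_def right_minus_eq)
qed

section \<open>Modular forms of level one with integral coefficients\<close>

definition qexp :: "complex \<Rightarrow> complex" where
  "qexp \<tau> = exp (2 * \<i> * pi * \<tau>)"

lemma qexp_nome: "qexp \<tau> = (nome \<tau>)\<^sup>2"
  by (simp add: qexp_def nome_def mult.assoc flip: exp_double)

lemma norm_qexp: "norm (qexp \<tau>) = exp (- (2 * pi * Im \<tau>))"
  by (simp add: qexp_def)

lemma norm_qexp_less_1: "Im \<tau> > 0 \<Longrightarrow> norm (qexp \<tau>) < 1"
  by (simp add: norm_qexp)

lemma qexp_add_int: "qexp (\<tau> + of_int n) = qexp \<tau>"
proof -
  have "exp (2 * \<i> * pi * of_int n) = (1::complex)"
    by (rule exp_eq_1[THEN iffD2]) auto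
  then show ?thesis by (simp add: qexp_def distrib_left exp_add)
qed

lemma qexp_surj:
  assumes "z \<noteq> 0" "norm z < 1"
  obtains \<tau> where "Im \<tau> > 0" "qexp \<tau> = z"
proof
  let ?\<tau> = "Ln z / (2 * \<i> * pi)"
  show q: "qexp ?\<tau> = z" using assms by (simp add: qexp_def)
  have "exp (- (2 * pi * Im ?\<tau>)) < exp 0"
    using norm_qexp[of ?\<tau>] assms unfolding q by simp
  then have "0 < 2 * pi * Im ?\<tau>" by (subst (asm) exp_less_cancel_iff) linarith
  then show "Im ?\<tau> > 0" by (simp only: zero_less_mult_iff) auto
qed

text \<open>A form given by its q-expansion is automatically invariant under \<tau> -> \<tau> + 1
  and holomorphic at the cusp, so only the inversion is demanded.\<close>

definition modular :: "nat \<Rightarrow> int fps \<Rightarrow> bool" where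
  "modular k F \<longleftrightarrow> cvg F \<and> (\<forall>\<tau>. Im \<tau> > 0 \<longrightarrow> ev F (qexp (- 1 / \<tau>)) = \<tau> ^ k * ev F (qexp \<tau>))"

lemma modular_cvg: "modular k F \<Longrightarrow> cvg F"
  by (simp add: modular_def)

lemma modular_inversion:
  "modular k F \<Longrightarrow> Im \<tau> > 0 \<Longrightarrow> ev F (qexp (- 1 / \<tau>)) = \<tau> ^ k * ev F (qexp \<tau>)"
  by (simp add: modular_def)

lemma qexp_norms: "Im \<tau> > 0 \<Longrightarrow> norm (qexp (- 1 / \<tau>)) < 1" "Im \<tau> > 0 \<Longrightarrow> norm (qexp \<tau>) < 1"
  by (rule norm_qexp_less_1, rule Im_inverse_pos) (simp_all add: norm_qexp_less_1)

lemma modularI: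
  "cvg F \<Longrightarrow> (\<And>\<tau>. Im \<tau> > 0 \<Longrightarrow> ev F (qexp (- 1 / \<tau>)) = \<tau> ^ k * ev F (qexp \<tau>)) \<Longrightarrow> modular k F"
  unfolding modular_def by blast

lemma modular_mult:
  assumes "modular k F" "modular l G"
  shows "modular (k + l) (F * G)"
proof (rule modularI)
  show "cvg (F * G)" using assms by (simp only: cvg_mult modular_cvg)
  show "ev (F * G) (qexp (- 1 / \<tau>)) = \<tau> ^ (k + l) * ev (F * G) (qexp \<tau>)" if "Im \<tau> > 0" for \<tau>
    by (simp only: ev_mult[OF assms[THEN modular_cvg]] qexp_norms[OF that] modular_inversion[OF assms(1) that]
        modular_inversion[OF assms(2) that] power_add mult_ac)
qed

lemma modular_diff:
  assumes "modular k F" "modular k G"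
  shows "modular k (F - G)"
proof (rule modularI)
  show "cvg (F - G)" using assms by (simp only: cvg_diff modular_cvg)
  show "ev (F - G) (qexp (- 1 / \<tau>)) = \<tau> ^ k * ev (F - G) (qexp \<tau>)" if "Im \<tau> > 0" for \<tau>
    by (simp only: ev_diff[OF assms[THEN modular_cvg]] qexp_norms[OF that] modular_inversion[OF assms(1) that]
        modular_inversion[OF assms(2) that] right_diff_distrib)
qed

lemma modular_one: "modular 0 1"
  using cvg_const(1)[of 1] by (simp add: modular_def ev_def)

lemma modular_power: "modular k F \<Longrightarrow> modular (k * n) (F ^ n)"
proof (induction n)
  case (Suc n)
  then show ?case using modular_mult[of k F "k * n" "F ^ n"] by simp
qed (simp add: modular_one)

lemma modular_const_mult:
  assumes "modular k F"
  shows "modular k (fps_const c * F)"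
proof (rule modularI)
  show "cvg (fps_const c * F)" using assms by (simp only: cvg_mult cvg_const modular_cvg)
  show "ev (fps_const c * F) (qexp (- 1 / \<tau>)) = \<tau> ^ k * ev (fps_const c * F) (qexp \<tau>)" if "Im \<tau> > 0" for \<tau>
    by (simp only: ev_mult[OF cvg_const(1) assms[THEN modular_cvg]] qexp_norms[OF that]
        modular_inversion[OF assms that] ev_const mult.left_commute)
qed

lemma modular_0: "modular k 0"
  by (simp add: modular_def cvg_0 ev_0)

lemma modular_sum: "(\<And>i. i \<in> I \<Longrightarrow> modular k (f i)) \<Longrightarrow> modular k (\<Sum>i\<in>I. f i)"
proof (induction I rule: infinite_finite_induct)
  case (insert i I)
  have "modular k (f i - (0 - (\<Sum>i\<in>I. f i)))"
    using insert by (intro modular_diff modular_0) auto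
  then show ?case using insert by simp
qed (auto simp: modular_0)

subsection \<open>The forms of weight 4 and 12\<close>

definition alpha :: "complex \<Rightarrow> complex" where "alpha \<tau> = theta (nome \<tau>) ^ 4"
definition beta :: "complex \<Rightarrow> complex" where "beta \<tau> = theta (- nome \<tau>) ^ 4"

lemma pow4: "(x::'a::comm_ring_1) ^ 4 = (x\<^sup>2)\<^sup>2"
  by (simp flip: power_mult)

lemma alpha_inversion:
  assumes "Im \<tau> > 0"
  shows "alpha (- 1 / \<tau>) = - \<tau>\<^sup>2 * alpha \<tau>"
  unfolding alpha_def pow4 theta_inversion[OF assms]
  by (simp only: power_mult_distrib power_divide power2_i) simp

text \<open>The value at -q is not covered by \<open>theta_inversion\<close>. Applying that law at
  \<tau> / 2 and expanding by the doubling formula gives the squares of theta at w and at -w, where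
  w is the nome of -1 / \<tau>; subtracting the inversion at \<tau> isolates the term at -w.\<close>

lemma beta_inversion:
  assumes \<tau>: "Im \<tau> > 0"
  shows "beta (- 1 / \<tau>) = - \<tau>\<^sup>2 * (alpha \<tau> - beta \<tau>)"
proof -
  have 0: "\<tau> \<noteq> 0" using \<tau> by auto
  define v where "v = nome (\<tau> / 2)"
  have v: "v\<^sup>2 = nome \<tau>" by (simp add: v_def nome_def flip: exp_double)
  have nv: "norm v < 1" using \<tau> by (simp add: v_def norm_nome_less_1)
  define a b where "a = theta v ^ 2" and "b = theta (- v) ^ 2"
  have ab: "a + b = 2 * theta (nome \<tau>) ^ 2" "a * b = theta (- nome \<tau>) ^ 4"
    using theta_sq_add[OF nv] theta_mult_neg[OF nv]
    by (simp_all add: a_def b_def v flip: power_mult_distrib)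
  define w where "w = nome (- 1 / \<tau>)"
  have nw: "norm w < 1" using \<tau> by (simp add: w_def norm_nome_less_1 Im_inverse_pos del: divide_minus_left)
  have im: "Im (- 2 / \<tau>) > 0" using Im_inverse_pos[of "\<tau> / 2"] \<tau> by simp
  have "nome (- 2 / \<tau>) = w\<^sup>2" by (simp add: w_def nome_def mult_ac flip: exp_double)
  with theta_inversion[OF im] 0 have "a = (- 2 / \<tau>) / \<i> * theta (w\<^sup>2) ^ 2"
    by (simp add: a_def v_def)
  then have "a = \<i> / \<tau> * (theta w ^ 2 + theta (- w) ^ 2)"
    using 0 by (simp add: theta_sq_add[OF nw] field_simps)
  moreover have "theta (nome \<tau>) ^ 2 = \<i> / \<tau> * theta w ^ 2"
    using theta_inversion[OF \<tau>] 0 by (simp add: w_def field_simps)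
  ultimately have "a - theta (nome \<tau>) ^ 2 = \<i> / \<tau> * theta (- w) ^ 2"
    by (simp add: algebra_simps)
  moreover have "(a - theta (nome \<tau>) ^ 2)\<^sup>2 = alpha \<tau> - beta \<tau>"
  proof -
    have b: "b = 2 * theta (nome \<tau>) ^ 2 - a" using ab(1) by (simp add: algebra_simps)
    show ?thesis using ab(2) unfolding alpha_def beta_def b pow4[of "theta (nome \<tau>)"]
      by (simp add: power2_eq_square algebra_simps)
  qed
  ultimately have "alpha \<tau> - beta \<tau> = (\<i> / \<tau> * theta (- w) ^ 2)\<^sup>2" by simp
  then have "alpha \<tau> - beta \<tau> = - 1 / \<tau>\<^sup>2 * beta (- 1 / \<tau>)"
    by (simp add: beta_def w_def power_mult_distrib power_divide)
  then show ?thesis using 0 by (simp add: field_simps)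
qed

lemma alpha_nonzero: "Im \<tau> > 0 \<Longrightarrow> alpha \<tau> \<noteq> 0"
  and beta_nonzero: "Im \<tau> > 0 \<Longrightarrow> beta \<tau> \<noteq> 0"
  by (simp_all add: alpha_def beta_def theta_nonzero norm_nome_less_1)

lemma alpha_beta_distinct: "Im \<tau> > 0 \<Longrightarrow> alpha \<tau> - beta \<tau> \<noteq> 0"
  using beta_inversion[of \<tau>] beta_nonzero[of "- 1 / \<tau>"] Im_inverse_pos[of \<tau>] by auto

abbreviation theta_neg_fps :: "int fps" where "theta_neg_fps \<equiv> theta_fps oo - fps_X"
abbreviation theta_sq_fps :: "int fps" where "theta_sq_fps \<equiv> theta_fps oo fps_X ^ 2"

text \<open>In terms of the fourth powers \<open>\<alpha>\<close> and \<open>\<beta>\<close> of the theta constants at the nome, the forms are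
  \<open>E\<^sub>4 = \<alpha>\<^sup>2 - \<alpha> \<beta> + \<beta>\<^sup>2\<close> and \<open>\<Delta> = (\<alpha> \<beta> (\<alpha> - \<beta>))\<^sup>2 / 256\<close>. The series below are these
  expressions with the square root of \<open>q\<close> eliminated by the doubling formulas.\<close>

definition E4_fps :: "int fps" where
  "E4_fps = 16 * theta_fps ^ 8 - 16 * (theta_fps ^ 4 * theta_neg_fps ^ 4) + theta_neg_fps ^ 8"

definition Dl_cofactor :: "int fps" where
  "Dl_cofactor = theta_neg_fps ^ 16 * theta_fps ^ 4 * theta_sq_fps ^ 2"

definition Dl_fps :: "int fps" where
  "Dl_fps = Dl_cofactor *
    (sq_fps + sq_fps ^ 2 - (sq_fps oo fps_X ^ 2) - (sq_fps oo fps_X ^ 2) ^ 2)"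

lemma cvg_theta_neg: "cvg theta_neg_fps" and cvg_theta_sq: "cvg theta_sq_fps"
  by (simp_all add: cvg_compose cvg_compose_neg cvg_theta_fps)

lemmas cvg_rules = cvg_add cvg_diff cvg_mult cvg_power cvg_const cvg_theta_fps cvg_theta_neg
  cvg_theta_sq cvg_sq_fps cvg_compose(1)[OF cvg_sq_fps zero_less_numeral]

lemma cvg_E4: "cvg E4_fps" and cvg_Dl: "cvg Dl_fps" and cvg_Dl_cofactor: "cvg Dl_cofactor"
  unfolding E4_fps_def Dl_fps_def Dl_cofactor_def by (intro cvg_rules)+

lemma theta_qexp:
  assumes \<tau>: "Im \<tau> > 0"
  shows "theta (qexp \<tau>) ^ 2 = (theta (nome \<tau>) ^ 2 + theta (- nome \<tau>) ^ 2) / 2"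
    and "theta (- qexp \<tau>) ^ 2 = theta (nome \<tau>) * theta (- nome \<tau>)"
  using theta_sq_add[OF norm_nome_less_1[OF \<tau>]] theta_mult_neg[OF norm_nome_less_1[OF \<tau>]]
  by (simp_all add: qexp_nome)

lemma ev_E4:
  assumes \<tau>: "Im \<tau> > 0"
  shows "ev E4_fps (qexp \<tau>) = alpha \<tau> ^ 2 - alpha \<tau> * beta \<tau> + beta \<tau> ^ 2"
proof -
  let ?q = "qexp \<tau>"
  have q: "norm ?q < 1" using \<tau> by (rule norm_qexp_less_1)
  define a b where "a = theta (nome \<tau>) ^ 2" and "b = theta (- nome \<tau>) ^ 2"
  have "ev E4_fps ?q = 16 * theta ?q ^ 8 - 16 * (theta ?q ^ 4 * theta (- ?q) ^ 4) + theta (- ?q) ^ 8"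
    unfolding E4_fps_def
    by (simp only: ev_add ev_diff ev_mult ev_power ev_const cvg_rules q theta_def cvg_compose_neg(2))
  also have "\<dots> = 16 * ((theta ?q ^ 2) ^ 2) ^ 2 - 16 * ((theta ?q ^ 2) ^ 2 * (theta (- ?q) ^ 2) ^ 2)
      + ((theta (- ?q) ^ 2) ^ 2) ^ 2"
    by (simp flip: power_mult)
  also have "\<dots> = 16 * (((a + b) / 2) ^ 2) ^ 2 - 16 * (((a + b) / 2) ^ 2 * (a * b)) + (a * b) ^ 2"
    unfolding theta_qexp[OF \<tau>] by (simp only: a_def b_def power_mult_distrib)
  also have "\<dots> = (a ^ 2) ^ 2 - a ^ 2 * b ^ 2 + (b ^ 2) ^ 2"
    by (simp add: power_divide) (simp add: power2_eq_square power4_eq_xxxx algebra_simps)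
  finally show ?thesis by (simp add: alpha_def beta_def a_def b_def flip: power_mult)
qed

text \<open>The substitution of 1 + 2 s for theta makes the difference of squares divisible by 4
  over the integers. Hence \<open>Dl_fps\<close> is integral although the expression by theta
  constants has the denominator 256.\<close>

lemma theta_fps_sq_diff:
  "4 * (sq_fps + sq_fps ^ 2 - (sq_fps oo fps_X ^ 2) - (sq_fps oo fps_X ^ 2) ^ 2) =
    theta_fps ^ 2 - theta_sq_fps ^ 2"
proof -
  have "theta_sq_fps = 1 + 2 * (sq_fps oo fps_X ^ 2)"
    by (simp add: theta_fps_eq fps_compose_add_distrib fps_compose_mult_distrib)
  then show ?thesis by (simp add: theta_fps_eq power2_eq_square algebra_simps)
qed

lemma ev_Dl:
  assumes \<tau>: "Im \<tau> > 0"
  shows "256 * ev Dl_fps (qexp \<tau>) = alpha \<tau> ^ 2 * beta \<tau> ^ 2 * (alpha \<tau> - beta \<tau>) ^ 2"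
proof -
  let ?q = "qexp \<tau>"
  have q: "norm ?q < 1" using \<tau> by (rule norm_qexp_less_1)
  define a b where "a = theta (nome \<tau>) ^ 2" and "b = theta (- nome \<tau>) ^ 2"
  define c d e where "c = theta ?q ^ 2" and "d = theta (?q\<^sup>2) ^ 2" and "e = theta (- ?q) ^ 2"
  have "4 * Dl_fps = theta_neg_fps ^ 16 * theta_fps ^ 4 * theta_sq_fps ^ 2 * (theta_fps ^ 2 - theta_sq_fps ^ 2)"
    unfolding theta_fps_sq_diff[symmetric] Dl_fps_def Dl_cofactor_def by (simp only: mult_ac)
  then have "ev (4 * Dl_fps) ?q = ev (theta_neg_fps ^ 16 * theta_fps ^ 4 * theta_sq_fps ^ 2 * (theta_fps ^ 2 - theta_sq_fps ^ 2)) ?q"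
    by simp
  then have "4 * ev Dl_fps ?q = theta (- ?q) ^ 16 * theta ?q ^ 4 * d * (c - d)"
    by (simp only: ev_diff ev_mult ev_power ev_const cvg_rules cvg_Dl q theta_def
        cvg_compose_neg(2) cvg_compose(2) zero_less_numeral c_def d_def)
  also have "\<dots> = e ^ 8 * c ^ 2 * (d * (c - d))"
    by (simp add: c_def e_def mult.assoc flip: power_mult)
  also have "d = (c + e) / 2"
    using theta_sq_add[OF q] by (simp add: c_def d_def e_def)
  also have "e ^ 8 * c ^ 2 * ((c + e) / 2 * (c - (c + e) / 2)) = (e ^ 2) ^ 4 * c ^ 2 * ((c ^ 2 - e ^ 2) / 4)"
    by (simp add: power2_eq_square field_simps flip: power_mult)
  also have "e ^ 2 = a * b"
    by (simp add: e_def theta_qexp[OF \<tau>] a_def b_def power_mult_distrib)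
  also have "c = (a + b) / 2"
    by (simp add: c_def theta_qexp[OF \<tau>] a_def b_def)
  finally have "256 * ev Dl_fps ?q = 64 * ((a * b) ^ 4 * ((a + b) / 2) ^ 2 * ((((a + b) / 2) ^ 2 - a * b) / 4))"
    by simp
  also have "\<dots> = (a ^ 2) ^ 2 * (b ^ 2) ^ 2 * (a ^ 2 - b ^ 2) ^ 2"
    by (simp add: power_divide power_mult_distrib)
      (simp add: power2_eq_square power4_eq_xxxx algebra_simps)
  finally show ?thesis by (simp add: alpha_def beta_def a_def b_def flip: power_mult)
qed

lemma modular_E4: "modular 4 E4_fps"
  unfolding modular_def
proof (intro conjI cvg_E4 allI impI)
  fix \<tau> assume \<tau>: "Im \<tau> > 0"
  show "ev E4_fps (qexp (- 1 / \<tau>)) = \<tau> ^ 4 * ev E4_fps (qexp \<tau>)"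
    unfolding ev_E4[OF \<tau>] ev_E4[OF Im_inverse_pos[OF \<tau>]] alpha_inversion[OF \<tau>] beta_inversion[OF \<tau>]
    by (simp add: power2_eq_square power4_eq_xxxx algebra_simps)
qed

lemma modular_Dl: "modular 12 Dl_fps"
  unfolding modular_def
proof (intro conjI cvg_Dl allI impI)
  fix \<tau> assume \<tau>: "Im \<tau> > 0"
  have "256 * ev Dl_fps (qexp (- 1 / \<tau>)) = \<tau> ^ 12 * (256 * ev Dl_fps (qexp \<tau>))"
    unfolding ev_Dl[OF \<tau>] ev_Dl[OF Im_inverse_pos[OF \<tau>]] alpha_inversion[OF \<tau>] beta_inversion[OF \<tau>]
  proof -
    have "(\<tau>\<^sup>2) ^ 6 = \<tau> ^ 12" by (simp flip: power_mult)
    moreover have "(- t * x) ^ 2 * (- t * (x - y)) ^ 2 * (- t * x - - t * (x - y)) ^ 2 = t ^ 6 * (x ^ 2 * y ^ 2 * (x - y) ^ 2)"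
      for t x y :: complex
    proof -
      have "- t * x - - t * (x - y) = - t * y" by (simp add: algebra_simps)
      moreover have "t ^ 6 = t\<^sup>2 * (t\<^sup>2 * t\<^sup>2)" by (simp flip: power_add)
      ultimately show ?thesis by (simp only: power_mult_distrib power2_minus mult_ac)
    qed
    ultimately show "(- \<tau>\<^sup>2 * alpha \<tau>) ^ 2 * (- \<tau>\<^sup>2 * (alpha \<tau> - beta \<tau>)) ^ 2 * (- \<tau>\<^sup>2 * alpha \<tau> - - \<tau>\<^sup>2 * (alpha \<tau> - beta \<tau>)) ^ 2
      = \<tau> ^ 12 * (alpha \<tau> ^ 2 * beta \<tau> ^ 2 * (alpha \<tau> - beta \<tau>) ^ 2)"
      by metis
  qed
  then show "ev Dl_fps (qexp (- 1 / \<tau>)) = \<tau> ^ 12 * ev Dl_fps (qexp \<tau>)" by simp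
qed

lemma ev_Dl_nonzero: "Im \<tau> > 0 \<Longrightarrow> ev Dl_fps (qexp \<tau>) \<noteq> 0"
  using ev_Dl[of \<tau>] alpha_nonzero[of \<tau>] beta_nonzero[of \<tau>] alpha_beta_distinct[of \<tau>] by auto

lemma fps_power_nth_0: "((F::'a::comm_ring_1 fps) ^ n) $ 0 = (F $ 0) ^ n"
  by (induction n) auto

lemma fps_compose_neg_X_nth_0: "((F::int fps) oo - fps_X) $ 0 = F $ 0"
  by (simp add: fps_compose_neg_X_nth)

lemma fps_compose_X_power_nth_0: "d > 0 \<Longrightarrow> ((F::int fps) oo fps_X ^ d) $ 0 = F $ 0"
  by (simp add: fps_compose_X_power_nth)

lemma sq_fps_nth_0: "sq_fps $ 0 = 0" and sq_fps_nth_1: "sq_fps $ Suc 0 = 1"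
  and theta_fps_nth_0: "theta_fps $ 0 = 1"
proof -
  show z: "sq_fps $ 0 = 0" by (auto simp: sq_fps_nth sq_def)
  show "sq_fps $ Suc 0 = 1" by (auto simp: sq_fps_nth sq_def intro: exI[of _ 1])
  show "theta_fps $ 0 = 1" by (simp add: theta_fps_eq z)
qed

lemma E4_fps_nth_0: "E4_fps $ 0 = 1"
  by (simp add: E4_fps_def fps_power_nth_0 fps_compose_neg_X_nth_0 theta_fps_nth_0)

section \<open>Vanishing criterion and integral structure in weights divisible by 12\<close>

definition Dl_unit :: "int fps" where "Dl_unit = fps_shift 1 Dl_fps"

lemma Dl_fps_eq: "Dl_fps = fps_X * Dl_unit" and Dl_unit_nth_0: "Dl_unit $ 0 = 1"
proof -
  define V where "V = sq_fps + sq_fps ^ 2 - (sq_fps oo fps_X ^ 2) - (sq_fps oo fps_X ^ 2) ^ 2"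
  have V: "V $ 0 = 0" "V $ 1 = 1"
    by (simp_all add: V_def fps_mult_nth power2_eq_square sq_fps_nth_0 sq_fps_nth_1
        fps_compose_X_power_nth[of 2, unfolded power2_eq_square])
  have C: "Dl_cofactor $ 0 = 1"
    by (simp add: Dl_cofactor_def fps_power_nth_0 fps_compose_neg_X_nth_0 fps_compose_X_power_nth_0 theta_fps_nth_0)
  have D: "Dl_fps $ 0 = 0" "Dl_fps $ 1 = 1"
    using V C by (simp_all add: Dl_fps_def fps_mult_nth flip: V_def)
  show "Dl_unit $ 0 = 1" by (simp add: Dl_unit_def D(2)[simplified])
  show "Dl_fps = fps_X * Dl_unit"
    by (rule fps_ext) (use D in \<open>auto simp: Dl_unit_def\<close>)
qed

lemma cvg_shift:
  assumes "cvg F"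
  shows "cvg (fps_shift n F)"
proof -
  have "of_int_fps (fps_shift n F) = (fps_shift n (of_int_fps F) :: complex fps)"
    by (rule fps_ext) simp
  then show ?thesis using assms by (simp add: cvg_def)
qed

lemma cvg_X: "cvg fps_X"
  by (rule cvg_bounded[of _ 1]) (simp add: fps_X_nth)

lemma ev_X: "ev fps_X z = z"
proof -
  have "of_int_fps fps_X = (fps_X :: complex fps)" by (rule fps_ext) (simp add: fps_X_nth)
  then show ?thesis by (simp add: ev_def)
qed

lemma cvg_Dl_unit: "cvg Dl_unit"
  unfolding Dl_unit_def by (rule cvg_shift[OF cvg_Dl])

text \<open>This includes the cusp q = 0, so that dividing by \<Delta>^m only costs the factor
  q^m.\<close>

lemma ev_Dl_unit_nonzero:
  assumes "norm z < 1"
  shows "ev Dl_unit z \<noteq> 0"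
proof (cases "z = 0")
  case True
  then show ?thesis by (simp add: ev_at_0 Dl_unit_nth_0)
next
  case False
  then obtain \<tau> where "Im \<tau> > 0" "qexp \<tau> = z" using qexp_surj assms by blast
  then have "ev Dl_fps z \<noteq> 0" using ev_Dl_nonzero by blast
  then show ?thesis using assms by (simp add: Dl_fps_eq ev_mult cvg_X cvg_Dl_unit)
qed

text \<open>An inversion doubles the imaginary part of a point of the strip below height one half,
  so that finitely many steps suffice to rise above that height.\<close>

lemma upper_half_plane_reduction:
  assumes "Im \<tau> > 0"
    and T: "\<And>\<tau> n. f (\<tau> + of_int n) = f \<tau>"
    and S: "\<And>\<tau>. Im \<tau> > 0 \<Longrightarrow> f (- 1 / \<tau>) = f \<tau>"
  shows "\<exists>\<tau>'. Im \<tau>' \<ge> 1 / 2 \<and> f \<tau>' = f \<tau>"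
proof -
  have "Im \<tau> \<ge> (1 / 2) ^ Suc n \<Longrightarrow> \<exists>\<tau>'. Im \<tau>' \<ge> 1 / 2 \<and> f \<tau>' = f \<tau>" for n
  proof (induction n arbitrary: \<tau>)
    case (Suc n)
    show ?case
    proof (cases "Im \<tau> \<ge> 1 / 2")
      case False
      define \<sigma> where "\<sigma> = \<tau> + of_int (- round (Re \<tau>))"
      have \<sigma>: "Im \<sigma> = Im \<tau>" "\<bar>Re \<sigma>\<bar> \<le> 1 / 2" "f \<sigma> = f \<tau>"
        using of_int_round_abs_le[of "Re \<tau>"] T[of \<tau> "- round (Re \<tau>)"] by (auto simp: \<sigma>_def abs_minus_commute)
      have pos: "Im \<sigma> > 0" using Suc.prems \<sigma>(1) zero_less_power[of "1/2::real" "Suc (Suc n)"] by linarith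
      have "(Re \<sigma>)\<^sup>2 \<le> (1 / 2)\<^sup>2" "(Im \<sigma>)\<^sup>2 \<le> (1 / 2)\<^sup>2"
        using \<sigma>(2) power_mono[of "\<bar>Re \<sigma>\<bar>" "1 / 2" 2] power_mono[of "Im \<sigma>" "1 / 2" 2] False \<sigma>(1) pos by auto
      then have n: "(Re \<sigma>)\<^sup>2 + (Im \<sigma>)\<^sup>2 \<le> 1 / 2" by (simp add: power_divide)
      have n0: "(Re \<sigma>)\<^sup>2 + (Im \<sigma>)\<^sup>2 > 0" using pos by (simp add: add_nonneg_pos)
      have "Im (- 1 / \<sigma>) = Im \<sigma> / ((Re \<sigma>)\<^sup>2 + (Im \<sigma>)\<^sup>2)"
        by (simp add: Im_divide)
      moreover have "2 * Im \<sigma> \<le> Im \<sigma> / ((Re \<sigma>)\<^sup>2 + (Im \<sigma>)\<^sup>2)"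
        using n n0 pos mult_left_mono[OF n, of "Im \<sigma> * 2"] by (simp add: pos_le_divide_eq)
      moreover have "(1 / 2) ^ Suc n \<le> 2 * Im \<sigma>" using Suc.prems \<sigma>(1) by simp
      ultimately have "(1 / 2) ^ Suc n \<le> Im (- 1 / \<sigma>)" by linarith
      from Suc.IH[OF this] S[OF pos] \<sigma>(3) show ?thesis by simp
    qed auto
  qed auto
  moreover obtain n where "(1 / 2) ^ n < Im \<tau>"
    using real_arch_pow_inv[OF assms(1), of "1 / 2"] by auto
  then have "(1 / 2) ^ Suc n \<le> Im \<tau>"
    using zero_less_power[of "1/2::real" n] unfolding power_Suc by linarith
  ultimately show ?thesis by blast
qed

lemma ev_eq_0_imp:
  assumes "cvg F" "\<And>z. norm z < 1 \<Longrightarrow> ev F z = 0"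
  shows "F = 0"
proof -
  have "(of_int_fps F :: complex fps) = 0"
  proof (rule eval_fps_eqD)
    show "fps_conv_radius (of_int_fps F :: complex fps) > 0"
      using cvg_radius[OF assms(1), of 0] by (simp add: zero_ereal_def)
    have "eventually (\<lambda>z::complex. z \<in> ball 0 1) (nhds 0)"
      by (intro eventually_nhds_in_open) auto
    then show "eventually (\<lambda>z. eval_fps (of_int_fps F) z = eval_fps 0 (z::complex)) (nhds 0)"
      by eventually_elim (use assms(2) in \<open>auto simp: ev_def\<close>)
  qed simp
  then show ?thesis by (metis fps_ext fps_zero_nth of_int_eq_0_iff of_int_fps_nth)
qed

text \<open>G / \<Delta>^m is holomorphic on the disc, invariant under the inversion and zero at q =
  0. Every value is already taken on a compact disc, at the cusp or at height at least 1/2, so the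
  modulus has an interior maximum and the function is constant. This replaces the valence
  formula.\<close>

lemma modular_high_order_eq_0:
  assumes G: "modular (12 * m) G" and ord: "\<And>j. j \<le> m \<Longrightarrow> G $ j = 0"
  shows "G = 0"
proof -
  define H where "H = fps_shift (Suc m) G"
  have GH: "G = fps_X ^ Suc m * H"
    by (rule fps_ext) (use ord in \<open>auto simp: H_def fps_X_power_mult_nth simp del: power_Suc\<close>)
  have cH: "cvg H" unfolding H_def by (intro cvg_shift modular_cvg[OF G])
  define h where "h = (\<lambda>z. z * ev H z / ev Dl_unit z ^ m)"
  have h_eq: "h z = ev G z / ev Dl_fps z ^ m" if "norm z < 1" "z \<noteq> 0" for z
  proof -
    have "ev G z = z ^ Suc m * ev H z"
      unfolding GH using that(1) by (simp only: ev_mult ev_power cvg_power cvg_X cH ev_X)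
    moreover have "ev Dl_fps z = z * ev Dl_unit z"
      unfolding Dl_fps_eq using that(1) by (simp only: ev_mult cvg_X cvg_Dl_unit ev_X)
    ultimately show ?thesis using that(2) by (simp add: h_def power_mult_distrib)
  qed
  have hol: "h holomorphic_on ball 0 1"
    unfolding h_def by (intro holomorphic_intros ev_holomorphic cH cvg_Dl_unit) (auto simp: ev_Dl_unit_nonzero)
  have inv: "h (qexp (- 1 / \<tau>)) = h (qexp \<tau>)" if \<tau>: "Im \<tau> > 0" for \<tau>
  proof -
    have 0: "\<tau> \<noteq> 0" using \<tau> by auto
    have q: "qexp \<tau> \<noteq> 0" "qexp (- 1 / \<tau>) \<noteq> 0" by (simp_all add: qexp_def)
    show ?thesis
      unfolding h_eq[OF qexp_norms(1)[OF \<tau>] q(2)] h_eq[OF qexp_norms(2)[OF \<tau>] q(1)]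
        modular_inversion[OF G \<tau>] modular_inversion[OF modular_Dl \<tau>] power_mult_distrib power_mult
      using 0 by simp
  qed
  \<comment> \<open>The modulus of q at height 1/2, the bound in
    \<open>upper_half_plane_reduction\<close>.\<close>
  define r where "r = exp (- pi)"
  have r: "0 < r" "r < 1" by (simp_all add: r_def)
  have red: "\<exists>w\<in>cball 0 r. h w = h z" if z: "z \<in> ball 0 1" for z
  proof (cases "z = 0")
    case False
    obtain \<tau> where \<tau>: "Im \<tau> > 0" "qexp \<tau> = z"
      by (rule qexp_surj[OF False]) (use z in auto)
    have "\<exists>\<tau>'. Im \<tau>' \<ge> 1 / 2 \<and> h (qexp \<tau>') = h (qexp \<tau>)"
      by (rule upper_half_plane_reduction[of \<tau> "\<lambda>\<tau>. h (qexp \<tau>)", OF \<tau>(1)])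
        (subst qexp_add_int, rule refl, rule inv, assumption)
    then obtain \<tau>' where \<tau>': "Im \<tau>' \<ge> 1 / 2" "h (qexp \<tau>') = h (qexp \<tau>)" by blast
    have "norm (qexp \<tau>') \<le> r"
      unfolding norm_qexp r_def using \<tau>'(1) mult_left_mono[of "1/2" "Im \<tau>'" "2 * pi"] by simp
    then have "qexp \<tau>' \<in> cball 0 r" by simp
    moreover have "h (qexp \<tau>') = h z" using \<tau> \<tau>' by (simp only:)
    ultimately show ?thesis by (rule bexI[rotated])
  qed (use r in auto)
  have sub: "cball (0::complex) r \<subseteq> ball 0 1" using r(2) by (simp add: subset_eq)
  have "continuous_on (cball 0 r) (\<lambda>z. norm (h z))"
    by (rule continuous_on_norm[OF continuous_on_subset[OF holomorphic_on_imp_continuous_on[OF hol] sub]])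
  moreover have "cball (0::complex) r \<noteq> {}" using r(1) by simp
  ultimately obtain \<xi> where \<xi>: "\<xi> \<in> cball 0 r" "\<forall>z\<in>cball 0 r. norm (h z) \<le> norm (h \<xi>)"
    using continuous_attains_sup[OF compact_cball] by blast
  have "h constant_on ball 0 1"
  proof (rule maximum_modulus_principle[OF hol _ _ _ _ _])
    show "\<xi> \<in> ball 0 1" using \<xi>(1) sub by blast
    show "norm (h z) \<le> norm (h \<xi>)" if z: "z \<in> ball 0 1" for z
    proof -
      obtain w where "w \<in> cball 0 r" "h w = h z" using red[OF z] by blast
      then show ?thesis using \<xi>(2) by (metis (no_types))
    qed
  qed (simp_all only: open_ball connected_ball subset_refl)
  then obtain c where c: "\<And>z. z \<in> ball 0 1 \<Longrightarrow> h z = c"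
    unfolding constant_on_def by blast
  have "h 0 = 0" by (simp add: h_def)
  then have "c = 0" using c[of 0] by simp
  then have h0: "h z = 0" if "norm z < 1" for z
    using c[of z] that by simp
  have "ev G z = 0" if "norm z < 1" for z
  proof -
    have "z * ev H z = 0" using h0[OF that] ev_Dl_unit_nonzero[OF that] by (simp add: h_def)
    then have "z ^ Suc m * ev H z = 0" by auto
    then show ?thesis unfolding GH using that by (simp only: ev_mult ev_power cvg_power cvg_X cH ev_X)
  qed
  then show ?thesis using ev_eq_0_imp modular_cvg[OF G] by blast
qed

text \<open>Leading coefficients equal to 1 allow the elimination without division, so the
  coefficients stay integral.\<close>

lemma triangular_elimination:
  fixes F :: "int fps" and g :: "nat \<Rightarrow> int fps"
  assumes "\<And>i. g i $ i = 1" "\<And>i j. j < i \<Longrightarrow> g i $ j = 0"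
  shows "\<exists>c. \<forall>j<n. (F - (\<Sum>i<n. fps_const (c i) * g i)) $ j = 0"
proof (induction n)
  case (Suc n)
  then obtain c where c: "\<And>j. j < n \<Longrightarrow> (F - (\<Sum>i<n. fps_const (c i) * g i)) $ j = 0" by blast
  define G where "G = F - (\<Sum>i<n. fps_const (c i) * g i)"
  define c' where "c' = c(n := G $ n)"
  have "F - (\<Sum>i<Suc n. fps_const (c' i) * g i) = G - fps_const (G $ n) * g n"
    by (simp add: G_def c'_def)
  moreover have "(G - fps_const (G $ n) * g n) $ j = 0" if "j < Suc n" for j
    using that c[of j] assms(1)[of n] assms(2)[of j n] by (cases "j = n") (auto simp: G_def)
  ultimately show ?case by metis
qed auto

text \<open>The i-th form begins with q^i, so m + 1 of them can match the first m + 1 coefficients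
  of F. The difference has order above m and vanishes by
  \<open>modular_high_order_eq_0\<close>.\<close>

theorem modular_structure:
  assumes F: "modular (12 * m) F"
  shows "\<exists>c. F = (\<Sum>i\<le>m. fps_const (c i) * (Dl_fps ^ i * E4_fps ^ (3 * (m - i))))"
proof -
  define g where "g i = Dl_fps ^ i * E4_fps ^ (3 * (m - i))" for i
  have g: "g i = fps_X ^ i * (Dl_unit ^ i * E4_fps ^ (3 * (m - i)))" for i
    by (simp add: g_def Dl_fps_eq power_mult_distrib mult.assoc)
  have "g i $ i = 1" "j < i \<Longrightarrow> g i $ j = 0" for i j
    by (simp_all add: g fps_X_power_mult_nth fps_power_nth_0 Dl_unit_nth_0 E4_fps_nth_0)
  then obtain c where c: "\<And>j. j < Suc m \<Longrightarrow> (F - (\<Sum>i<Suc m. fps_const (c i) * g i)) $ j = 0"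
    using triangular_elimination[of g "Suc m" F] by blast
  have mg: "modular (12 * m) (g i)" if "i \<le> m" for i
  proof -
    have "modular (12 * i + 4 * (3 * (m - i))) (g i)"
      unfolding g_def by (intro modular_mult modular_power modular_Dl modular_E4)
    moreover have "12 * i + 4 * (3 * (m - i)) = 12 * m" using that by simp
    ultimately show ?thesis by simp
  qed
  have "modular (12 * m) (F - (\<Sum>i<Suc m. fps_const (c i) * g i))"
    by (intro modular_diff F modular_sum modular_const_mult mg) auto
  then have "F - (\<Sum>i<Suc m. fps_const (c i) * g i) = 0"
    by (rule modular_high_order_eq_0) (use c in auto)
  then have "F = (\<Sum>i\<le>m. fps_const (c i) * g i)" by (simp add: lessThan_Suc_atMost)
  then show ?thesis unfolding g_def by blast
qed

subsection \<open>Hecke operators in level one\<close>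

lemma det_row_nonzero:
  fixes a b c d :: int
  assumes "a * d - b * c = 1" "Im \<tau> > 0"
  shows "of_int c * \<tau> + of_int d \<noteq> 0"
proof
  assume "of_int c * \<tau> + of_int d = 0"
  then have "Im (of_int c * \<tau> + of_int d) = 0" "Re (of_int c * \<tau> + of_int d) = 0" by simp_all
  then have "c = 0" "d = 0" using assms(2) by auto
  with assms(1) show False by simp
qed

lemma Im_moebius:
  fixes a b c d :: int
  assumes "a * d - b * c = 1" "Im \<tau> > 0"
  shows "Im ((of_int a * \<tau> + of_int b) / (of_int c * \<tau> + of_int d)) > 0"
proof -
  let ?w = "of_int c * \<tau> + of_int d"
  have n: "(Re ?w)\<^sup>2 + (Im ?w)\<^sup>2 > 0"
    using det_row_nonzero[OF assms] by (metis complex_eq_0 not_sum_power2_lt_zero linorder_neqE_linordered_idom)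
  have "real_of_int a * of_int d - of_int b * of_int c = 1"
    using arg_cong[OF assms(1), of real_of_int] by simp
  moreover have "Im (of_int a * \<tau> + of_int b) * Re ?w - Re (of_int a * \<tau> + of_int b) * Im ?w
      = (real_of_int a * of_int d - of_int b * of_int c) * Im \<tau>"
    by (simp add: algebra_simps)
  ultimately have "Im ((of_int a * \<tau> + of_int b) / ?w) = Im \<tau> / ((Re ?w)\<^sup>2 + (Im ?w)\<^sup>2)"
    by (simp only: Im_divide)
  then show ?thesis using n assms(2) by simp
qed

text \<open>Translations and the inversion generate SL_2(Z): dividing a by c with remainder r splits
  off a translation and an inversion, and the induction on |c| ends at c = 0. Even weight absorbs
  the signs.\<close>

lemma modular_moebius:
  fixes a b c d :: int
  assumes F: "modular k F" "even k" and \<tau>: "Im \<tau> > 0" and det: "a * d - b * c = 1"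
  shows "ev F (qexp ((of_int a * \<tau> + of_int b) / (of_int c * \<tau> + of_int d))) =
    (of_int c * \<tau> + of_int d) ^ k * ev F (qexp \<tau>)"
  using det
proof (induction "nat \<bar>c\<bar>" arbitrary: a b c d rule: less_induct)
  case less
  show ?case
  proof (cases "c = 0")
    case True
    then have "a * d = 1" using less.prems by simp
    then consider "a = 1" "d = 1" | "a = - 1" "d = - 1" using zmult_eq_1_iff by auto
    then show ?thesis
    proof cases
      case 1
      then show ?thesis using True qexp_add_int[of \<tau> b] by simp
    next
      case 2
      then show ?thesis using True qexp_add_int[of \<tau> "- b"] F(2) by simp
    qed
  next
    case False
    define t r where "t = a div c" and "r = a mod c"
    have a: "a = c * t + r" by (simp add: t_def r_def)
    define b' where "b' = b - t * d"
    have det': "(- c) * b' - (- d) * r = 1"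
      using less.prems by (simp add: a b'_def algebra_simps)
    have det'': "r * d - b' * c = 1" using det' by (simp add: algebra_simps)
    have rc: "nat \<bar>r\<bar> < nat \<bar>c\<bar>"
      using False abs_mod_less[of c a] by (simp add: r_def)
    let ?u = "of_int c * \<tau> + of_int d" and ?v = "of_int r * \<tau> + of_int b'"
    have u: "?u \<noteq> 0" by (rule det_row_nonzero[OF less.prems \<tau>])
    have v: "?v \<noteq> 0" by (rule det_row_nonzero[OF det' \<tau>])
    have "(of_int a * \<tau> + of_int b) / ?u = ?v / ?u + of_int t"
      using u by (simp add: a b'_def field_simps)
    then have "ev F (qexp ((of_int a * \<tau> + of_int b) / ?u)) = ev F (qexp (?v / ?u))"
      by (simp only: qexp_add_int)
    also have "?v / ?u = - 1 / ((of_int (- c) * \<tau> + of_int (- d)) / ?v)"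
    proof -
      have "of_int (- c) * \<tau> + of_int (- d) = - ?u" by simp
      moreover have "x / y = - 1 / (- y / x)" if "x \<noteq> 0" "y \<noteq> 0" for x y :: complex
        using that by simp
      ultimately show ?thesis using u v by (simp only:)
    qed
    also have "ev F (qexp \<dots>) = ((of_int (- c) * \<tau> + of_int (- d)) / ?v) ^ k *
        ev F (qexp ((of_int (- c) * \<tau> + of_int (- d)) / ?v))"
      by (rule modular_inversion[OF F(1) Im_moebius[OF det' \<tau>]])
    also have "ev F (qexp ((of_int (- c) * \<tau> + of_int (- d)) / ?v)) = ?v ^ k * ev F (qexp \<tau>)"
      by (rule less.hyps[OF rc det'])
    also have "(of_int (- c) * \<tau> + of_int (- d)) / ?v = - (?u / ?v)"
    proof -
      have "of_int (- c) * \<tau> + of_int (- d) = - ?u" by simp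
      then show ?thesis by (simp only: minus_divide_left)
    qed
    also have "(- (?u / ?v)) ^ k = ?u ^ k / ?v ^ k"
      using F(2) by (simp add: power_divide)
    finally show ?thesis using v by simp
  qed
qed

definition U_fps :: "nat \<Rightarrow> int fps \<Rightarrow> int fps" where
  "U_fps p F = Abs_fps (\<lambda>n. F $ (p * n))"

lemma cvg_U:
  assumes "cvg F" "p > 0"
  shows "cvg (U_fps p F)"
proof (rule cvgI)
  fix r :: real assume r: "0 < r" "r < 1"
  \<comment> \<open>The terms of the new series at r are the terms of F at the p-th root of r whose
    index is divisible by p.\<close>
  define s where "s = root p r"
  have s: "0 < s" "s < 1" "s ^ p = r" using r assms(2) by (simp_all add: s_def)
  have "summable (\<lambda>n. norm (of_int (F $ n) * complex_of_real s ^ n))"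
    using s by (intro cvg_summable assms(1)) simp
  then have "summable ((\<lambda>n. norm (of_int (F $ n) * complex_of_real s ^ n)) \<circ> (\<lambda>n. p * n))"
    by (rule summable_reindex) (use assms(2) in \<open>auto simp: inj_on_def\<close>)
  then have "summable (\<lambda>n. norm (of_int (U_fps p F $ n) * complex_of_real r ^ n))"
    using s by (simp add: o_def U_fps_def power_mult flip: s(3))
  then show "summable (\<lambda>n. of_int (U_fps p F $ n) * complex_of_real r ^ n)"
    by (rule summable_norm_cancel)
qed

lemma qexp_add: "qexp (x + y) = qexp x * qexp y"
  by (simp add: qexp_def distrib_left exp_add)

lemma qexp_of_nat_mult: "qexp (of_nat n * x) = qexp x ^ n"
  by (simp add: qexp_def mult_ac flip: exp_of_nat_mult)

lemma qexp_eq_1_imp: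
  assumes "p > 0" "qexp (of_nat n / of_nat p) = 1"
  shows "p dvd n"
proof -
  obtain m :: int where "2 * pi * (real n / real p) = of_int (2 * m) * pi"
    using assms(2) unfolding qexp_def exp_eq_1 by (auto simp: Im_divide_of_nat)
  then have "(2 * pi) * (real n / real p) = (2 * pi) * of_int m" by (simp add: mult_ac)
  then have "real n / real p = of_int m" by (subst (asm) mult_left_cancel) auto
  then have "real_of_int (int n) = of_int (m * int p)" using assms(1) by (simp add: field_simps)
  then have "int n = m * int p" by (simp only: of_int_eq_iff)
  then have "int p dvd int n" by simp
  then show ?thesis by simp
qed

text \<open>The points (\<tau> + j) / p correspond to the p-th roots of q. The sum of their n-th
  powers is p q^(n/p) if p divides n, and 0 otherwise.\<close>

lemma ev_U:
  assumes F: "cvg F" and p: "p > 0" and \<tau>: "Im \<tau> > 0"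
  shows "of_nat p * ev (U_fps p F) (qexp \<tau>) = (\<Sum>j<p. ev F (qexp ((\<tau> + of_nat j) / of_nat p)))"
proof -
  define z where "z = qexp (\<tau> / of_nat p)"
  define \<zeta> where "\<zeta> = qexp (1 / of_nat p)"
  have q: "qexp ((\<tau> + of_nat j) / of_nat p) = z * \<zeta> ^ j" for j
    using qexp_of_nat_mult[of j "1 / of_nat p"] by (simp add: z_def \<zeta>_def add_divide_distrib qexp_add)
  have zp: "z ^ p = qexp \<tau>" using p qexp_of_nat_mult[of p "\<tau> / of_nat p"] by (simp add: z_def)
  have \<zeta>n: "\<zeta> ^ n = qexp (of_nat n / of_nat p)" for n
    using qexp_of_nat_mult[of n "1 / of_nat p"] by (simp add: \<zeta>_def)
  have \<zeta>p: "\<zeta> ^ p = 1" using p qexp_add_int[of 0 1] by (simp add: \<zeta>n) (simp add: qexp_def)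
  have root_sum: "(\<Sum>j<p. (z * \<zeta> ^ j) ^ n) = (if p dvd n then of_nat p * z ^ n else 0)" for n
  proof -
    have "(\<Sum>j<p. (z * \<zeta> ^ j) ^ n) = z ^ n * (\<Sum>j<p. (\<zeta> ^ n) ^ j)"
      by (simp add: power_mult_distrib sum_distrib_left mult.commute flip: power_mult)
    also have "\<dots> = (if p dvd n then of_nat p * z ^ n else 0)"
    proof (cases "p dvd n")
      case True
      then obtain m where "n = p * m" by auto
      then have "\<zeta> ^ n = 1" by (simp add: power_mult \<zeta>p)
      then show ?thesis using True by simp
    next
      case False
      then have "\<zeta> ^ n \<noteq> 1" using qexp_eq_1_imp[OF p] by (auto simp: \<zeta>n)
      moreover have "(\<zeta> ^ n) ^ p = 1" by (metis \<zeta>p power_mult mult.commute power_one)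
      ultimately show ?thesis using False by (simp add: geometric_sum)
    qed
    finally show ?thesis .
  qed
  have nz: "norm (z * \<zeta> ^ j) < 1" for j
    using \<tau> p by (simp flip: q) (rule norm_qexp_less_1, simp add: Im_divide_of_nat)
  have "(\<lambda>n. of_int (F $ n) * (z * \<zeta> ^ j) ^ n) sums ev F (z * \<zeta> ^ j)" for j
    using summable_sums[OF summable_norm_cancel[OF cvg_summable[OF F nz]], of j]
    by (simp add: ev_def eval_fps_def)
  then have "(\<lambda>n. \<Sum>j<p. of_int (F $ n) * (z * \<zeta> ^ j) ^ n) sums (\<Sum>j<p. ev F (z * \<zeta> ^ j))"
    by (intro sums_sum)
  then have S: "(\<lambda>n. of_int (F $ n) * (if p dvd n then of_nat p * z ^ n else 0)) sums (\<Sum>j<p. ev F (z * \<zeta> ^ j))"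
    by (simp only: root_sum sum_distrib_left[symmetric])
  have "(\<lambda>n. of_int (F $ (p * n)) * (if p dvd p * n then of_nat p * z ^ (p * n) else 0)) sums (\<Sum>j<p. ev F (z * \<zeta> ^ j))"
  proof -
    have m: "strict_mono (\<lambda>n. p * n)" using p by (simp add: strict_mono_def)
    have z: "of_int (F $ n) * (if p dvd n then of_nat p * z ^ n else 0) = 0" if "n \<notin> range (\<lambda>n. p * n)" for n
      using that by (auto elim!: dvdE)
    show ?thesis using S by (subst sums_mono_reindex[OF m z])
  qed
  moreover have "(\<lambda>n. of_int (F $ (p * n)) * (if p dvd p * n then of_nat p * z ^ (p * n) else 0))
      = (\<lambda>n. of_nat p * (of_int (U_fps p F $ n) * qexp \<tau> ^ n))"
  proof -
    have "z ^ (p * n) = qexp \<tau> ^ n" for n by (simp only: power_mult zp)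
    then show ?thesis by (simp add: U_fps_def mult.left_commute)
  qed
  ultimately have "(\<lambda>n. of_nat p * (of_int (U_fps p F $ n) * qexp \<tau> ^ n)) sums (\<Sum>j<p. ev F (z * \<zeta> ^ j))"
    by (simp only:)
  note S' = this
  have "(\<lambda>n. of_int (U_fps p F $ n) * qexp \<tau> ^ n) sums ev (U_fps p F) (qexp \<tau>)"
    using summable_sums[OF summable_norm_cancel[OF cvg_summable[OF cvg_U[OF F p] norm_qexp_less_1[OF \<tau>]]]]
    by (simp add: ev_def eval_fps_def)
  then have "(\<lambda>n. of_nat p * (of_int (U_fps p F $ n) * qexp \<tau> ^ n)) sums (of_nat p * ev (U_fps p F) (qexp \<tau>))"
    by (rule sums_mult)
  from sums_unique2[OF this S']
  show ?thesis by (simp only: q)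
qed

text \<open>The involution j -> -1/j of the nonzero residues, with representatives below p, as the
  reindexing in \<open>modular_Hecke\<close> needs it.\<close>

lemma neg_inverse_mod_prime:
  assumes "prime p" "0 < j" "j < p"
  shows "\<exists>!i. 0 < i \<and> i < p \<and> int p dvd int j * int i + 1"
proof -
  have cop: "coprime (int j) (int p)"
    using assms by (metis coprime_commute coprime_int_iff nat_dvd_not_less prime_imp_coprime)
  obtain x where x: "[int j * x = - 1] (mod int p)"
  proof -
    obtain y where "[int j * y = 1] (mod int p)" using cong_solve_coprime_int[OF cop] by blast
    from cong_mult[OF this cong_refl[of "- 1"]] have "[int j * (- y) = - 1] (mod int p)" by simp
    then show ?thesis using that by blast
  qed
  define i where "i = nat (x mod int p)"
  have ip: "p > 1" using assms(1) prime_gt_1_nat by blast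
  have ii: "int i = x mod int p" using ip by (simp add: i_def)
  have "[int j * int i = - 1] (mod int p)"
    using x unfolding ii by (metis cong_mod_right cong_mult cong_refl cong_sym cong_trans)
  then have dvd: "int p dvd int j * int i + 1" by (simp add: cong_iff_dvd_diff)
  have "i < p" using ii ip by (metis of_nat_0_less_iff of_nat_less_iff order_less_trans pos_mod_bound zero_less_one)
  moreover have "i \<noteq> 0"
  proof
    assume "i = 0"
    then have "int p dvd 1" using dvd by simp
    then show False using ip by simp
  qed
  moreover have "i = i'" if "0 < i'" "i' < p" "int p dvd int j * int i' + 1" for i'
  proof -
    have "int p dvd int j * (int i - int i')"
      using dvd_diff[OF dvd that(3)] by (simp add: right_diff_distrib)
    then have "int p dvd int i - int i'"
      using cop by (simp add: coprime_commute coprime_dvd_mult_right_iff)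
    then have "[int i = int i'] (mod int p)" by (simp add: cong_iff_dvd_diff)
    then have "[i = i'] (mod p)" by (simp add: cong_int_iff)
    then show "i = i'" using \<open>i < p\<close> that(2) by (simp add: cong_def)
  qed
  ultimately show ?thesis using dvd by blast
qed

text \<open>p times the operator sums F over the p + 1 points (\<tau> + j) / p and p \<tau>, the
  last one with the factor p^k. The inversion exchanges j = 0 with p \<tau> and permutes the other j
  by j -> -1/j modulo p.\<close>

theorem modular_Hecke:
  assumes F: "modular k F" "even k" "k > 0" and p: "prime p"
  shows "modular k (U_fps p F + fps_const (int p ^ (k - 1)) * (F oo fps_X ^ p))"
proof (rule modularI)
  have p0: "p > 0" using p prime_gt_0_nat by blast
  have cF: "cvg F" by (rule modular_cvg[OF F(1)])
  note cs = cvg_U[OF cF p0] cvg_compose(1)[OF cF p0] cvg_const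
  let ?G = "U_fps p F + fps_const (int p ^ (k - 1)) * (F oo fps_X ^ p)"
  show "cvg ?G" by (intro cvg_add cvg_mult cs)
  define f where "f \<tau> = ev F (qexp \<tau>)" for \<tau>
  have G: "of_nat p * ev ?G (qexp \<tau>) = (\<Sum>j<p. f ((\<tau> + of_nat j) / of_nat p)) + of_nat p ^ k * f (of_nat p * \<tau>)"
    if \<tau>: "Im \<tau> > 0" for \<tau>
  proof -
    note q = norm_qexp_less_1[OF \<tau>]
    have "of_nat p * ev ?G (qexp \<tau>) = of_nat p * ev (U_fps p F) (qexp \<tau>) + of_nat p * of_nat p ^ (k - 1) * ev F (qexp \<tau> ^ p)"
      using cvg_compose(2)[OF cF p0 q] by (simp add: ev_add ev_mult cs cvg_mult q ev_const algebra_simps)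
    also have "of_nat p * of_nat p ^ (k - 1) = (of_nat p ^ k :: complex)"
      using F(3) by (cases k) auto
    finally show ?thesis by (simp only: ev_U[OF cF p0 \<tau>] f_def qexp_of_nat_mult)
  qed
  define \<sigma> where "\<sigma> j = (THE i. 0 < i \<and> i < p \<and> int p dvd int j * int i + 1)" for j
  have \<sigma>: "0 < \<sigma> j \<and> \<sigma> j < p \<and> int p dvd int j * int (\<sigma> j) + 1" if "j \<in> {1..<p}" for j
    unfolding \<sigma>_def by (rule theI') (use neg_inverse_mod_prime[OF p] that in auto)
  have \<sigma>\<sigma>: "\<sigma> (\<sigma> j) = j" if "j \<in> {1..<p}" for j
    using neg_inverse_mod_prime[OF p, of "\<sigma> j"] \<sigma>[OF that] \<sigma>[of "\<sigma> j"] that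
    by (metis atLeastLessThan_iff less_eq_Suc_le One_nat_def mult.commute)
  fix \<tau> assume \<tau>: "Im \<tau> > 0"
  have \<tau>0: "\<tau> \<noteq> 0" using \<tau> by auto
  have step: "f ((- 1 / \<tau> + of_nat j) / of_nat p) = \<tau> ^ k * f ((\<tau> + of_nat (\<sigma> j)) / of_nat p)"
    if j: "j \<in> {1..<p}" for j
  proof -
    obtain m where m: "int j * int (\<sigma> j) + 1 = int p * m" using \<sigma>[OF j] by (elim conjE dvdE)
    define \<rho> where "\<rho> = (\<tau> + of_nat (\<sigma> j)) / of_nat p"
    have \<rho>: "Im \<rho> > 0" using \<tau> p0 by (simp add: \<rho>_def Im_divide_of_nat)
    have \<tau>\<rho>: "of_int (int p) * \<rho> + of_int (- int (\<sigma> j)) = \<tau>" using p0 by (simp add: \<rho>_def)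
    have det: "int j * (- int (\<sigma> j)) - (- m) * int p = 1" using m by (simp add: algebra_simps)
    have m': "of_nat j * of_nat (\<sigma> j) + 1 = (of_nat p * of_int m :: complex)"
      using arg_cong[OF m, of "of_int :: int \<Rightarrow> complex"] by simp
    have "(- 1 / \<tau> + of_nat j) / of_nat p = (of_int (int j) * \<rho> + of_int (- m)) / \<tau>"
    proof -
      have "of_nat p * (of_int (int j) * \<rho> + of_int (- m)) = of_nat j * (of_nat p * \<rho>) - of_nat p * of_int m"
        by (simp add: algebra_simps)
      also have "of_nat p * \<rho> = \<tau> + of_nat (\<sigma> j)" using p0 by (simp add: \<rho>_def)
      also have "of_nat j * (\<tau> + of_nat (\<sigma> j)) - of_nat p * of_int m = of_nat j * \<tau> - 1"
        unfolding m'[symmetric] by (simp add: algebra_simps)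
      finally have "of_int (int j) * \<rho> + of_int (- m) = (of_nat j * \<tau> - 1) / of_nat p"
        using p0 by (simp add: field_simps)
      then show ?thesis using \<tau>0 p0 by (simp only:) (simp add: field_simps)
    qed
    then show ?thesis
      using modular_moebius[OF F(1,2) \<rho> det] unfolding \<tau>\<rho> by (simp only: f_def \<rho>_def)
  qed
  have sum_eq: "(\<Sum>j\<in>{1..<p}. f ((- 1 / \<tau> + of_nat j) / of_nat p)) = \<tau> ^ k * (\<Sum>j\<in>{1..<p}. f ((\<tau> + of_nat j) / of_nat p))"
    unfolding sum_distrib_left
    by (rule sum.reindex_bij_witness[of _ \<sigma> \<sigma>]) (use \<sigma> \<sigma>\<sigma> step in \<open>auto simp: Suc_le_eq\<close>)
  have split: "(\<Sum>j<p. g j) = g 0 + (\<Sum>j\<in>{1..<p}. g j)" for g :: "nat \<Rightarrow> complex"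
    using p0 by (simp add: lessThan_atLeast0 sum.atLeast_Suc_lessThan)
  have zero: "f ((- 1 / \<tau> + of_nat 0) / of_nat p) = \<tau> ^ k * (of_nat p ^ k * f (of_nat p * \<tau>))"
  proof -
    have "Im (of_nat p * \<tau>) > 0" using \<tau> p0 by simp
    moreover have "(- 1 / \<tau> + of_nat 0) / of_nat p = - 1 / (of_nat p * \<tau>)" by (simp add: field_simps)
    ultimately show ?thesis
      using modular_inversion[OF F(1), of "of_nat p * \<tau>"] by (simp only: f_def power_mult_distrib mult_ac)
  qed
  have last: "of_nat p ^ k * f (of_nat p * (- 1 / \<tau>)) = \<tau> ^ k * f ((\<tau> + of_nat 0) / of_nat p)"
  proof -
    have "Im (\<tau> / of_nat p) > 0" using \<tau> p0 by (simp add: Im_divide_of_nat)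
    moreover have "of_nat p * (- 1 / \<tau>) = - 1 / (\<tau> / of_nat p)" by simp
    ultimately have "f (of_nat p * (- 1 / \<tau>)) = (\<tau> / of_nat p) ^ k * f (\<tau> / of_nat p)"
      using modular_inversion[OF F(1), of "\<tau> / of_nat p"] by (simp only: f_def)
    then show ?thesis using p0 by (simp add: power_divide)
  qed
  have "of_nat p * ev ?G (qexp (- 1 / \<tau>)) = \<tau> ^ k * (of_nat p * ev ?G (qexp \<tau>))"
    unfolding G[OF \<tau>] G[OF Im_inverse_pos[OF \<tau>]] split sum_eq zero last
    by (simp add: algebra_simps)
  then show "ev ?G (qexp (- 1 / \<tau>)) = \<tau> ^ k * ev ?G (qexp \<tau>)"
    using p0 by simp
qed

section \<open>Reduction modulo 2\<close>

declare add_bit_eq_xor [simp del] mult_bit_eq_and [simp del]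

lemma bit_add_self: "x + x = (0::bit)"
  by (cases x) (simp_all add: add_bit_eq_xor)

lemma bit_fps_add_self: "F + F = (0::bit fps)"
  by (rule fps_ext) (simp add: bit_add_self)

lemma bit_fps_uminus: "- F = (F::bit fps)"
  using bit_fps_add_self[of F] by (simp add: add_eq_0_iff)

lemma bit_fps_diff: "F - G = F + (G::bit fps)"
  by (simp add: diff_conv_add_uminus bit_fps_uminus del: add_uminus_conv_diff)

lemma bit_fps_eq_iff: "F = G \<longleftrightarrow> F + G = (0::bit fps)"
  by (metis bit_fps_add_self bit_fps_uminus eq_neg_iff_add_eq_0)

lemma bit_fps_add_left_self: "F + (F + G) = (G::bit fps)"
  by (simp add: bit_fps_add_self flip: add.assoc)

text \<open>The two values on an orbit of length 2 cancel over F_2. The modular equations below rest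
  on this.\<close>

lemma sum_bit_involution:
  fixes f :: "'a \<Rightarrow> bit"
  assumes "finite S" "\<And>x. x \<in> S \<Longrightarrow> \<sigma> x \<in> S" "\<And>x. x \<in> S \<Longrightarrow> \<sigma> (\<sigma> x) = x"
    and "\<And>x. x \<in> S \<Longrightarrow> f (\<sigma> x) = f x"
  shows "sum f S = sum f {x\<in>S. \<sigma> x = x}"
  using assms
proof (induction "card S" arbitrary: S rule: less_induct)
  case less
  show ?case
  proof (cases "\<exists>x\<in>S. \<sigma> x \<noteq> x")
    case True
    then obtain x where x: "x \<in> S" "\<sigma> x \<noteq> x" by blast
    define T where "T = S - {x, \<sigma> x}"
    have S: "S = insert x (insert (\<sigma> x) T)" "x \<notin> insert (\<sigma> x) T" "\<sigma> x \<notin> T"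
      using x less.prems(2)[OF x(1)] by (auto simp: T_def)
    have fT: "finite T" using less.prems(1) by (simp add: T_def)
    have st: "\<sigma> y \<in> T" if "y \<in> T" for y
    proof -
      have y: "y \<in> S" "y \<noteq> x" "y \<noteq> \<sigma> x" using that by (auto simp: T_def)
      have "\<sigma> y \<noteq> x" "\<sigma> y \<noteq> \<sigma> x"
        using less.prems(3)[OF y(1)] less.prems(3)[OF x(1)] y by metis+
      then show ?thesis using less.prems(2)[OF y(1)] by (simp add: T_def)
    qed
    have TS: "T \<subseteq> S" by (auto simp: T_def)
    have "card T < card S" using fT S(2,3) by (subst S(1)) simp
    from less.hyps[OF this fT st] less.prems(3,4) TS
    have IH: "sum f T = sum f {x\<in>T. \<sigma> x = x}" by blast
    have "sum f S = f x + (f (\<sigma> x) + sum f T)" using fT S(2,3) by (subst S(1)) simp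
    also have "\<dots> = sum f T" using less.prems(4)[OF x(1)] by (simp add: bit_add_self flip: add.assoc)
    finally have "sum f S = sum f {x\<in>T. \<sigma> x = x}" using IH by simp
    moreover have "{y\<in>T. \<sigma> y = y} = {y\<in>S. \<sigma> y = y}"
      using x less.prems(3)[OF x(1)] by (auto simp: T_def)
    ultimately show ?thesis by simp
  next
    case False
    then have "{x\<in>S. \<sigma> x = x} = S" by blast
    then show ?thesis by simp
  qed
qed

lemma gen_series_bit_involution:
  fixes f :: "'i \<Rightarrow> bit"
  assumes "\<And>n. finite {x\<in>A. u x = n}" "\<And>x. x \<in> A \<Longrightarrow> \<sigma> x \<in> A" "\<And>x. x \<in> A \<Longrightarrow> \<sigma> (\<sigma> x) = x"
    and "\<And>x. x \<in> A \<Longrightarrow> u (\<sigma> x) = u x" "\<And>x. x \<in> A \<Longrightarrow> f (\<sigma> x) = f x"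
  shows "gen_series A u f = gen_series {x\<in>A. \<sigma> x = x} u f"
proof (rule fps_ext)
  fix n
  have "sum f {x\<in>A. u x = n} = sum f {x\<in>{x\<in>A. u x = n}. \<sigma> x = x}"
    by (rule sum_bit_involution) (use assms in auto)
  also have "{x\<in>{x\<in>A. u x = n}. \<sigma> x = x} = {x\<in>{x\<in>A. \<sigma> x = x}. u x = n}" by auto
  finally show "gen_series A u f $ n = gen_series {x\<in>A. \<sigma> x = x} u f $ n"
    by (simp only: gen_series_nth)
qed

text \<open>The involution i -> n - i of the convolution sum fixes at most the middle index.\<close>

lemma bit_fps_square: "F\<^sup>2 = F oo fps_X ^ 2" for F :: "bit fps"
proof (rule fps_ext)
  fix n
  have "(F\<^sup>2) $ n = (\<Sum>i\<in>{0..n}. F $ i * F $ (n - i))"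
    by (simp add: power2_eq_square fps_mult_nth)
  also have "\<dots> = (\<Sum>i\<in>{i\<in>{0..n}. n - i = i}. F $ i * F $ (n - i))"
    by (rule sum_bit_involution) (auto simp: mult.commute)
  also have "\<dots> = (F oo fps_X ^ 2) $ n"
  proof (cases "even n")
    case True
    then obtain m where "n = 2 * m" by auto
    then have "{i\<in>{0..n}. n - i = i} = {m}" by auto
    moreover have "x * x = x" for x :: bit by (cases x) auto
    ultimately show ?thesis using \<open>n = 2 * m\<close> by (simp add: fps_compose_X_power_nth)
  next
    case False
    then have "{i\<in>{0..n}. n - i = i} = {}" by (auto, presburger)
    then show ?thesis using False by (simp only: sum.empty fps_compose_X_power_nth[OF zero_less_numeral] if_False)
  qed
  finally show "(F\<^sup>2) $ n = (F oo fps_X ^ 2) $ n" .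
qed

lemma bit_fps_frobenius: "F ^ (2 ^ t) = F oo fps_X ^ (2 ^ t)" for F :: "bit fps"
proof (induction t)
  case (Suc t)
  have "F ^ (2 ^ Suc t) = (F ^ 2 ^ t)\<^sup>2" by (simp add: mult.commute flip: power_mult)
  also have "\<dots> = (F oo fps_X ^ 2 ^ t)\<^sup>2" by (simp only: Suc)
  also have "\<dots> = F\<^sup>2 oo fps_X ^ 2 ^ t" by (simp add: fps_compose_power)
  also have "\<dots> = F oo (fps_X ^ 2 oo fps_X ^ 2 ^ t)"
    unfolding bit_fps_square[of F] by (rule fps_compose_assoc[symmetric]) auto
  also have "fps_X ^ 2 oo fps_X ^ 2 ^ t = (fps_X ^ 2 ^ Suc t :: bit fps)"
    by (subst fps_X_power_compose) (auto simp: mult.commute simp flip: power_mult)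
  finally show ?case .
qed simp

lemma bit_fps_add_power2: "(F + G) ^ (2 ^ t) = F ^ (2 ^ t) + G ^ (2 ^ t)" for F G :: "bit fps"
  by (simp only: bit_fps_frobenius[of F] bit_fps_frobenius[of G] bit_fps_frobenius[of "F + G"]
      fps_compose_add_distrib)

subsection \<open>The series Delta\<close>

lemma odd_square_inj: "(2 * m + 1)\<^sup>2 = (2 * n + 1)\<^sup>2 \<Longrightarrow> m = (n::nat)"
  using power2_eq_imp_eq[of "2 * m + 1" "2 * n + 1"] by linarith

lemma Delta_gen_series: "Delta = gen_series UNIV (\<lambda>m::nat. (2 * m + 1)\<^sup>2) (\<lambda>_. 1)"
proof (rule fps_ext)
  fix n
  show "Delta $ n = gen_series UNIV (\<lambda>m::nat. (2 * m + 1)\<^sup>2) (\<lambda>_. 1) $ n"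
  proof (cases "\<exists>m. n = (2 * m + 1)\<^sup>2")
    case True
    then obtain m where m: "n = (2 * m + 1)\<^sup>2" by blast
    have "{i\<in>UNIV. (2 * i + 1)\<^sup>2 = n} = {m}"
      unfolding m using odd_square_inj by blast
    then show ?thesis using True by (simp only: Delta_def gen_series_nth fps_nth_Abs_fps if_True sum.insert_if) simp
  next
    case False
    then have "{i\<in>UNIV. (2 * i + 1)\<^sup>2 = n} = {}" by blast
    then show ?thesis using False by (simp only: Delta_def gen_series_nth fps_nth_Abs_fps if_False sum.empty)
  qed
qed

abbreviation (input) one_bit :: "'i \<Rightarrow> bit" where "one_bit \<equiv> \<lambda>_. 1"

abbreviation pos_odd :: "int set" where "pos_odd \<equiv> {a. 0 < a \<and> odd a}"

lemma Delta_int: "Delta = gen_series pos_odd sq one_bit"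
  unfolding Delta_gen_series
proof (rule gen_series_reindex)
  show "bij_betw (\<lambda>m::nat. 2 * int m + 1) UNIV pos_odd"
    by (rule bij_betwI[of _ _ _ "\<lambda>a. nat (a div 2)"]) auto
  show "sq (2 * int m + 1) = (2 * m + 1)\<^sup>2" for m :: nat
  proof -
    have "2 * int m + 1 = int (2 * m + 1)" by simp
    then show ?thesis by (simp only: sq_def nat_power_eq nat_int of_nat_0_le_iff)
  qed
qed simp

lemma of_int_gen_series: "of_int_fps (gen_series A u f) = gen_series A u (\<lambda>i. of_int (f i))"
  by (rule fps_ext) (simp add: gen_series_nth)

lemma of_int_compose_X_power: "d > 0 \<Longrightarrow> of_int_fps (F oo fps_X ^ d) = of_int_fps F oo fps_X ^ d"
  by (rule fps_ext) (simp add: fps_compose_X_power_nth)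

lemma bit_fps_2: "(2::bit fps) = 0"
  using bit_fps_add_self[of 1] by (simp add: one_add_one)

lemma bit_fps_16: "(16::bit fps) = 0"
proof -
  have "(16::bit fps) = 2 * 8" by simp
  then show ?thesis by (simp only: bit_fps_2 mult_zero_left)
qed

lemma Delta_sq_fps:
  "of_int_fps sq_fps = Delta + (of_int_fps sq_fps oo fps_X ^ 4)"
proof -
  let ?o = "{a::int. 0 < a \<and> odd a}" and ?e = "{a::int. 0 < a \<and> even a}"
  let ?one = "\<lambda>_. 1 :: bit"
  have s: "of_int_fps sq_fps = gen_series {0<..} sq ?one"
    by (simp add: sq_fps_def of_int_gen_series)
  have "{0::int<..} = ?o \<union> ?e" by auto
  then have "gen_series {0<..} sq ?one = gen_series ?o sq ?one + gen_series ?e sq ?one"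
    by (simp only:) (rule gen_series_Un[OF _ finite_sq finite_sq], auto)
  also have "gen_series ?o sq ?one = Delta"
    by (rule Delta_int[symmetric])
  also have "gen_series ?e sq ?one = gen_series {0<..} (\<lambda>a. 4 * sq a) ?one"
  proof (rule gen_series_reindex[symmetric])
    show "bij_betw (\<lambda>a. 2 * a) {0<..} ?e"
      by (rule bij_betwI[of _ _ _ "\<lambda>a. a div 2"]) auto
    show "sq (2 * a) = 4 * sq a" for a
      by (simp add: sq_def nat_mult_distrib power_mult_distrib)
  qed simp
  also have "gen_series {0<..} (\<lambda>a. 4 * sq a) ?one = gen_series {0<..} sq ?one oo fps_X ^ 4"
    by (simp only: gen_series_compose_X_power zero_less_numeral)
  finally show ?thesis unfolding s .
qed

lemma of_int_theta: "of_int_fps theta_fps = (1::bit fps)" "of_int_fps theta_neg_fps = (1::bit fps)"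
  "of_int_fps theta_sq_fps = (1::bit fps)"
proof -
  have "theta_neg_fps = 1 + 2 * (sq_fps oo - fps_X)"
    by (simp add: theta_fps_eq fps_compose_add_distrib fps_compose_mult_distrib)
  then show "of_int_fps theta_neg_fps = (1::bit fps)"
    by (simp only: of_int_fps_add of_int_fps_mult of_int_fps_1 of_int_fps_numeral bit_fps_2) simp
  show t: "of_int_fps theta_fps = (1::bit fps)"
    unfolding theta_fps_eq
    by (simp only: of_int_fps_add of_int_fps_mult of_int_fps_1 of_int_fps_numeral bit_fps_2) simp
  show "of_int_fps theta_sq_fps = (1::bit fps)"
    by (simp only: of_int_compose_X_power zero_less_numeral t) simp
qed

lemma of_int_E4: "of_int_fps E4_fps = (1::bit fps)"
  unfolding E4_fps_def
  by (simp only: of_int_fps_add of_int_fps_diff of_int_fps_mult of_int_fps_power of_int_fps_numeral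
      of_int_theta bit_fps_16) simp

text \<open>All theta factors are 1 modulo 2. With s the reduction of \<open>sq_fps\<close>,
  Frobenius identifies s(q^2) with s^2, so the remaining factor collapses to s + s^4; here s^4 =
  s(q^4) is the series of the even squares and removes them from s.\<close>

lemma of_int_Dl: "of_int_fps Dl_fps = Delta"
proof -
  let ?s = "of_int_fps sq_fps :: bit fps"
  have "of_int_fps Dl_cofactor = (1::bit fps)"
    unfolding Dl_cofactor_def by (simp only: of_int_fps_mult of_int_fps_power of_int_theta) simp
  then have "of_int_fps Dl_fps = ?s + ?s\<^sup>2 - (?s oo fps_X ^ 2) - (?s oo fps_X ^ 2)\<^sup>2"
    unfolding Dl_fps_def
    by (simp only: of_int_fps_mult of_int_fps_add of_int_fps_diff of_int_fps_power
        of_int_compose_X_power zero_less_numeral) simp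
  also have "\<dots> = ?s + (?s\<^sup>2)\<^sup>2"
    by (simp only: bit_fps_square[symmetric]) (simp add: bit_fps_diff)
  also have "(?s\<^sup>2)\<^sup>2 = ?s oo fps_X ^ 4"
    using bit_fps_frobenius[of ?s 2] by (simp flip: power_mult)
  also have "?s + (?s oo fps_X ^ 4) = Delta"
    by (subst (1) Delta_sq_fps) (simp add: add.assoc bit_fps_add_self)
  finally show ?thesis .
qed

lemma Delta_nth_mod_8: "Delta $ n \<noteq> 0 \<Longrightarrow> n mod 8 = 1"
proof -
  assume "Delta $ n \<noteq> 0"
  then obtain m where m: "n = (2 * m + 1)\<^sup>2" by (auto simp: Delta_def split: if_splits)
  have "n = 4 * (m * (m + 1)) + 1" by (simp add: m power2_eq_square algebra_simps)
  moreover obtain l where "m * (m + 1) = 2 * l" by (metis even_mult_iff even_plus_one_iff evenE)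
  ultimately have "n = 8 * l + 1" by (simp only:)
  then show ?thesis by simp
qed

lemma Delta_power_nth_mod_8: "(Delta ^ i) $ n \<noteq> 0 \<Longrightarrow> n mod 8 = i mod 8"
proof (induction i arbitrary: n)
  case (Suc i)
  have "(\<Sum>j=0..n. Delta $ j * (Delta ^ i) $ (n - j)) \<noteq> 0"
    using Suc.prems by (simp only: power_Suc fps_mult_nth) simp
  then obtain j where "j \<in> {0..n}" "Delta $ j * (Delta ^ i) $ (n - j) \<noteq> 0"
    by (rule sum.not_neutral_contains_not_neutral)
  then have j: "j \<le> n" "Delta $ j * (Delta ^ i) $ (n - j) \<noteq> 0" by auto
  then have "j mod 8 = 1" "(n - j) mod 8 = i mod 8"
    using Delta_nth_mod_8[of j] Suc.IH[of "n - j"] by auto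
  moreover have "n mod 8 = (j mod 8 + (n - j) mod 8) mod 8"
    using j(1) by (simp add: mod_add_eq)
  ultimately show ?case by (simp add: mod_simps)
next
  case 0
  then show ?case by (simp add: fps_one_nth split: if_splits)
qed

lemma Delta_power_nth_parity: "(Delta ^ i) $ n \<noteq> 0 \<Longrightarrow> even n = even i"
  using Delta_power_nth_mod_8[of i n] by presburger

section \<open>Hecke operators modulo 2 preserve the filtration\<close>

lemma Hecke_nth: "Hecke p f $ n = f $ (p * n) + (if p dvd n then f $ (n div p) else 0)"
  by (simp add: Hecke_def)

lemma Hecke_add: "Hecke p (f + g) = Hecke p f + Hecke p g"
  by (rule fps_ext) (simp add: Hecke_nth algebra_simps)

lemma scaleF2_nth: "scaleF2 c f $ n = c * f $ n"
  by (simp add: scaleF2_def)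

lemma Hecke_scale: "Hecke p (scaleF2 c f) = scaleF2 c (Hecke p f)"
  by (rule fps_ext) (simp add: Hecke_nth scaleF2_nth algebra_simps)

lemma Hecke_0: "Hecke p 0 = 0"
  by (rule fps_ext) (simp add: Hecke_nth)

lemma of_int_bit_odd: "odd a \<Longrightarrow> of_int a = (1::bit)"
  by (auto elim!: oddE)

text \<open>The reduction of \<open>modular_Hecke\<close> and \<open>modular_structure\<close> for
  the lift \<open>Dl_fps ^ m\<close>. Even i drop out because \<Delta>^i is supported on exponents
  of the parity of i and T_p respects parity for odd p.\<close>

theorem Hecke_Delta_power:
  assumes p: "prime p" "odd p" and m: "odd m"
  shows "\<exists>c. Hecke p (Delta ^ m) = (\<Sum>i | i \<le> m \<and> odd i. scaleF2 (c i) (Delta ^ i))"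
proof -
  have m0: "m > 0" using m by (cases m) auto
  let ?k = "12 * m"
  let ?G = "U_fps p (Dl_fps ^ m) + fps_const (int p ^ (?k - 1)) * (Dl_fps ^ m oo fps_X ^ p)"
  have "modular ?k ?G"
    by (rule modular_Hecke[OF modular_power[OF modular_Dl]]) (use m0 p in auto)
  then obtain c where c: "?G = (\<Sum>i\<le>m. fps_const (c i) * (Dl_fps ^ i * E4_fps ^ (3 * (m - i))))"
    using modular_structure by blast
  define e where "e i = (of_int (c i) :: bit)" for i
  have DN: "of_int_fps (Dl_fps ^ m) = Delta ^ m" by (simp only: of_int_fps_power of_int_Dl)
  have Dn: "of_int ((Dl_fps ^ m) $ n) = (Delta ^ m) $ n" for n
    using arg_cong[OF DN, of "\<lambda>F. F $ n"] by simp
  have pp: "of_int (int p ^ (?k - 1)) = (1::bit)" using p(2) by (intro of_int_bit_odd) simp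
  have p0: "p > 0" using p(1) prime_gt_0_nat by blast
  have "of_int_fps ?G = Hecke p (Delta ^ m)"
  proof (rule fps_ext)
    fix n
    have "of_int (int p ^ (?k - 1)) * (x::bit) = x" for x by (simp only: pp) simp
    then show "of_int_fps ?G $ n = Hecke p (Delta ^ m) $ n"
      using p0 by (simp add: Hecke_nth U_fps_def fps_compose_X_power_nth Dn del: of_int_power)
  qed
  moreover have "of_int_fps ?G = (\<Sum>i\<le>m. scaleF2 (e i) (Delta ^ i))"
    unfolding c scaleF2_def
    by (simp only: of_int_fps_sum of_int_fps_mult of_int_fps_power of_int_fps_const of_int_Dl of_int_E4
        e_def power_one mult_1_right)
  ultimately have H: "Hecke p (Delta ^ m) = (\<Sum>i\<le>m. scaleF2 (e i) (Delta ^ i))" by simp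
  let ?ev = "\<Sum>i | i \<le> m \<and> even i. scaleF2 (e i) (Delta ^ i)"
  let ?od = "\<Sum>i | i \<le> m \<and> odd i. scaleF2 (e i) (Delta ^ i)"
  have "{..m} = {i. i \<le> m \<and> even i} \<union> {i. i \<le> m \<and> odd i}" by auto
  then have split: "Hecke p (Delta ^ m) = ?ev + ?od"
    unfolding H by (simp only:) (rule sum.union_disjoint, auto)
  have nth: "?ev $ n = (if even n then ?ev $ n else 0)" "?od $ n = (if odd n then ?od $ n else 0)" for n
    using Delta_power_nth_parity
    by (auto simp: fps_sum_nth scaleF2_nth intro!: sum.neutral)
  have "?ev $ n = 0" for n
  proof (cases "even n")
    case True
    have "Hecke p (Delta ^ m) $ n = 0"
    proof -
      have "(Delta ^ m) $ (p * n) = 0" using Delta_power_nth_parity[of m "p * n"] True m by (metis even_mult_iff)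
      moreover have "(Delta ^ m) $ (n div p) = 0" if "p dvd n"
      proof -
        have "even (n div p)" using True that p(2) by (metis dvd_mult_div_cancel even_mult_iff)
        then show ?thesis using Delta_power_nth_parity[of m "n div p"] m by metis
      qed
      ultimately show ?thesis by (simp add: Hecke_nth)
    qed
    then show ?thesis using split nth(2)[of n] True by simp
  next
    case False
    then show ?thesis by (subst nth(1)) simp
  qed
  then have "?ev = 0" by (intro fps_ext) simp
  then show ?thesis using split by auto
qed

theorem Hecke_cuspF_upto:
  assumes p: "prime p" "odd p" and f: "f \<in> cuspF_upto n"
  shows "Hecke p f \<in> cuspF_upto n"
  using f unfolding cuspF_upto_def
proof (induction rule: scaleF2.span_induct_alt)
  case base
  show ?case by (simp add: Hecke_0 scaleF2.span_zero)
next
  case (step c x y)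
  then obtain k where k: "x = Delta ^ (2 * k - 1)" "1 \<le> k" "k \<le> n" by auto
  obtain e where e: "Hecke p x = (\<Sum>i | i \<le> 2 * k - 1 \<and> odd i. scaleF2 (e i) (Delta ^ i))"
    using Hecke_Delta_power[OF p, of "2 * k - 1"] k by auto
  have "Hecke p x \<in> scaleF2.span {Delta ^ (2 * k - 1) | k. 1 \<le> k \<and> k \<le> n}"
    unfolding e
  proof (intro scaleF2.span_sum scaleF2.span_scale scaleF2.span_base)
    fix i assume "i \<in> {i. i \<le> 2 * k - 1 \<and> odd i}"
    then obtain l where "i = 2 * l + 1" "2 * l + 1 \<le> 2 * k - 1" by (auto elim!: oddE)
    then show "Delta ^ i \<in> {Delta ^ (2 * k - 1) | k. 1 \<le> k \<and> k \<le> n}"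
      using k by (intro CollectI exI[of _ "Suc l"]) auto
  qed
  then show ?case
    using step(2) by (simp add: Hecke_add Hecke_scale scaleF2.span_add scaleF2.span_scale)
qed

section \<open>The modular equations of level 3 and 5\<close>

lemma finite_sq_scaled:
  assumes "c > 0" "d > 0"
  shows "finite {p\<in>A. (\<lambda>(a, b). c * sq a + d * sq b) p = n}"
proof (rule finite_subset)
  show "{p\<in>A. (\<lambda>(a, b). c * sq a + d * sq b) p = n} \<subseteq> (\<Union>k\<le>n. {a. sq a = k}) \<times> (\<Union>k\<le>n. {a. sq a = k})"
  proof clarsimp
    fix a b :: int
    have "sq a \<le> c * sq a" "sq b \<le> d * sq b" using assms by auto
    then show "sq a \<le> c * sq a + d * sq b \<and> sq b \<le> c * sq a + d * sq b" by linarith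
  qed
  have "finite {a. sq a = k}" for k using finite_sq[of UNIV] by simp
  then show "finite ((\<Union>k\<le>n. {a. sq a = k}) \<times> (\<Union>k\<le>n. {a. sq a = k}))" by blast
qed

lemma sq_eq_iff: "c * sq a + d * sq b = c' * sq x + d' * sq y \<longleftrightarrow>
    int c * a\<^sup>2 + int d * b\<^sup>2 = int c' * x\<^sup>2 + int d' * y\<^sup>2"
  by (subst of_nat_eq_iff[symmetric, where 'a = int]) simp

lemma gen_series_sq_mult_scaled:
  assumes "c > 0"
  shows "gen_series A sq one_bit * (gen_series B sq one_bit oo fps_X ^ c) =
    gen_series (A \<times> B) (\<lambda>(a, b). 1 * sq a + c * sq b) one_bit"
proof -
  have "finite {j\<in>B. c * sq j = n}" for n
  proof (rule finite_subset)
    show "{j\<in>B. c * sq j = n} \<subseteq> {j\<in>B. sq j = n div c}" using assms by auto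
  qed simp
  then show ?thesis
    by (simp add: gen_series_compose_X_power[OF assms] gen_series_mult case_prod_unfold)
qed

lemma sq_uminus [simp]: "sq (- a) = sq a"
  by (simp add: sq_def)

text \<open>The form a^2 + 3 b^2 is the norm of a + b sqrt(-3), and \<sigma> is multiplication by
  the sixth root of unity (1 + sqrt(-3)) / 2 or its conjugate, whichever keeps both coordinates odd,
  followed by absolute values. The fixed points a = b and a = 3 b represent 4 b^2 and 12
  b^2.\<close>

theorem modular_equation_3:
  "Delta ^ 4 + (Delta oo fps_X ^ 3) ^ 4 = Delta * (Delta oo fps_X ^ 3)"
proof -
  let ?w = "\<lambda>(a, b). 1 * sq a + 3 * sq b"
  define \<sigma> where "\<sigma> = (\<lambda>(a, b::int). if 4 dvd a - b then (\<bar>a - 3 * b\<bar> div 2, (a + b) div 2)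
    else ((a + 3 * b) div 2, \<bar>a - b\<bar> div 2))"
  have \<sigma>1: "\<sigma> (b + 4 * k, b) = (\<bar>b - 2 * k\<bar>, b + 2 * k)" for b k
    unfolding \<sigma>_def by (auto simp: abs_if)
  have \<sigma>2: "\<sigma> (4 * k - b, b) = (b + 2 * k, \<bar>b - 2 * k\<bar>)" if "odd b" for b k
  proof -
    have "\<not> 4 dvd 4 * k - b - b" using that by presburger
    then show ?thesis unfolding \<sigma>_def by (auto simp: abs_if)
  qed
  have cl: "\<sigma> (a, b) \<in> pos_odd \<times> pos_odd \<and> \<sigma> (\<sigma> (a, b)) = (a, b) \<and> ?w (\<sigma> (a, b)) = ?w (a, b)
      \<and> (\<sigma> (a, b) = (a, b) \<longleftrightarrow> a = b \<or> a = 3 * b)"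
    if ab: "0 < a" "0 < b" "odd a" "odd b" for a b
  proof -
    have "4 dvd a - b \<or> 4 dvd a + b" using ab(3,4) by presburger
    then consider k where "a = b + 4 * k" | k where "a = 4 * k - b"
      by (auto simp: dvd_def) (metis add.commute diff_add_cancel, metis add_diff_cancel_right')
    then show ?thesis
    proof cases
      case (1 k)
      have 0: "\<sigma> (a, b) = (\<bar>b - 2 * k\<bar>, b + 2 * k)" by (simp add: 1 \<sigma>1)
      have ne: "b - 2 * k \<noteq> 0" using ab(4) by auto
      have "\<sigma> (\<bar>b - 2 * k\<bar>, b + 2 * k) = (a, b)"
        using \<sigma>1[of "b + 2 * k" "- k"] \<sigma>2[of "b + 2 * k" k] ab ne by (auto simp: 1 abs_if)
      moreover have "b + 2 * k > 0" using ab by (simp add: 1)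
      moreover have "odd (b - 2 * k)" using ab by simp
      moreover have "1 * sq \<bar>b - 2 * k\<bar> + 3 * sq (b + 2 * k) = 1 * sq a + 3 * sq b"
        unfolding sq_eq_iff by (simp add: 1 power2_eq_square algebra_simps)
      moreover have "(\<bar>b - 2 * k\<bar>, b + 2 * k) = (a, b) \<longleftrightarrow> a = b \<or> a = 3 * b"
        using ab by (auto simp: 1)
      ultimately show ?thesis using ne ab(4) by (simp add: 0)
    next
      case (2 k)
      have 0: "\<sigma> (a, b) = (b + 2 * k, \<bar>b - 2 * k\<bar>)" by (simp add: 2 \<sigma>2 ab)
      have ne: "b - 2 * k \<noteq> 0" using ab(4) by auto
      have "\<sigma> (b + 2 * k, \<bar>b - 2 * k\<bar>) = (a, b)"
        using \<sigma>1[of "b - 2 * k" k] \<sigma>2[of "2 * k - b" k] ab ne by (auto simp: 2 abs_if add.commute)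
      moreover have "b + 2 * k > 0" using ab by (simp add: 2)
      moreover have "1 * sq (b + 2 * k) + 3 * sq \<bar>b - 2 * k\<bar> = 1 * sq a + 3 * sq b"
        unfolding sq_eq_iff by (simp add: 2 power2_eq_square algebra_simps)
      moreover have "(b + 2 * k, \<bar>b - 2 * k\<bar>) = (a, b) \<longleftrightarrow> a = b \<or> a = 3 * b"
        using ab by (auto simp: 2)
      ultimately show ?thesis using ne ab(4) by (simp add: 0)
    qed
  qed
  have "Delta * (Delta oo fps_X ^ 3) = gen_series (pos_odd \<times> pos_odd) ?w one_bit"
    by (simp only: Delta_int gen_series_sq_mult_scaled zero_less_numeral)
  also have "\<dots> = gen_series {p \<in> pos_odd \<times> pos_odd. \<sigma> p = p} ?w one_bit"
  proof (rule gen_series_bit_involution)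
    show "finite {p \<in> pos_odd \<times> pos_odd. ?w p = n}" for n
      by (rule finite_sq_scaled) simp_all
    fix p assume "p \<in> pos_odd \<times> pos_odd"
    then obtain a b where p: "p = (a, b)" "0 < a" "0 < b" "odd a" "odd b" by (cases p) blast
    show "\<sigma> p \<in> pos_odd \<times> pos_odd" "\<sigma> (\<sigma> p) = p" "?w (\<sigma> p) = ?w p"
      using cl[OF p(2-5)] by (simp_all only: p(1))
  qed simp
  also have "{p \<in> pos_odd \<times> pos_odd. \<sigma> p = p} = (\<lambda>a. (a, a)) ` pos_odd \<union> (\<lambda>a. (3 * a, a)) ` pos_odd"
    (is "?L = ?R")
  proof (rule Set.set_eqI)
    fix p :: "int \<times> int"
    obtain a b where p: "p = (a, b)" by (cases p)
    show "p \<in> ?L \<longleftrightarrow> p \<in> ?R"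
      using cl[of a b] by (auto simp: p)
  qed
  also have "gen_series \<dots> ?w one_bit =
      gen_series ((\<lambda>a. (a, a)) ` pos_odd) ?w one_bit + gen_series ((\<lambda>a. (3 * a, a)) ` pos_odd) ?w one_bit"
    by (rule gen_series_Un[OF _ finite_sq_scaled finite_sq_scaled]) auto
  also have "gen_series ((\<lambda>a. (a, a)) ` pos_odd) ?w one_bit = gen_series pos_odd (\<lambda>a. 4 * sq a) one_bit"
    by (rule gen_series_reindex[symmetric, of "\<lambda>a. (a, a)"]) (auto simp: bij_betw_def inj_on_def)
  also have "gen_series ((\<lambda>a. (3 * a, a)) ` pos_odd) ?w one_bit = gen_series pos_odd (\<lambda>a. 12 * sq a) one_bit"
    by (rule gen_series_reindex[symmetric, of "\<lambda>a. (3 * a, a)"])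
       (auto simp: bij_betw_def inj_on_def sq_def power_mult_distrib nat_mult_distrib)
  also have "gen_series pos_odd (\<lambda>a. 4 * sq a) one_bit = Delta ^ 4"
    using bit_fps_frobenius[of Delta 2] by (simp add: Delta_int gen_series_compose_X_power)
  also have "gen_series pos_odd (\<lambda>a. 12 * sq a) one_bit = (Delta oo fps_X ^ 3) ^ 4"
    using bit_fps_frobenius[of "Delta oo fps_X ^ 3" 2] by (simp add: Delta_int gen_series_compose_X_power)
  finally show ?thesis ..
qed

text \<open>The reduction modulo 2 of \<eta>(24 \<tau>), by Euler's pentagonal number theorem. It
  serves as a cube root of \<Delta>(q^3).\<close>

definition coprime6_fps :: "bit fps" where
  "coprime6_fps = gen_series {a \<in> pos_odd. \<not> 3 dvd a} sq one_bit"

abbreviation pairs_mod_3 :: "(int \<times> int) set" where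
  "pairs_mod_3 \<equiv> {(a, b). 0 < a \<and> odd a \<and> odd b \<and> 3 dvd a - b}"

text \<open>Choosing the sign of b so that a and b agree modulo 3 puts the index pairs into the
  lattice 3 | a - b, on which the reflections below act. The missing pairs, with both entries
  divisible by 3, cancel under b -> -b.\<close>

lemma coprime6_mult:
  assumes "c > 0"
  shows "coprime6_fps * (coprime6_fps oo fps_X ^ c) =
    gen_series pairs_mod_3 (\<lambda>(a, b). 1 * sq a + c * sq b) one_bit"
proof -
  let ?w = "\<lambda>(a, b). 1 * sq a + c * sq b"
  let ?P = "{a \<in> pos_odd. \<not> 3 dvd a}"
  let ?K = "{(a::int, b::int). 0 < a \<and> odd a \<and> odd b \<and> 3 dvd a \<and> 3 dvd b}"
  let ?Q = "{(a::int, b::int). 0 < a \<and> odd a \<and> odd b \<and> 3 dvd a - b \<and> \<not> 3 dvd a}"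
  note fin = finite_sq_scaled[OF zero_less_one assms]
  have "pairs_mod_3 = ?K \<union> ?Q"
    by (auto simp: dvd_diff_right_iff dvd_diff_left_iff)
  then have "gen_series pairs_mod_3 ?w one_bit = gen_series ?K ?w one_bit + gen_series ?Q ?w one_bit"
    by (simp only:) (rule gen_series_Un[OF _ fin fin], auto)
  also have "gen_series ?K ?w one_bit = gen_series {p \<in> ?K. (\<lambda>(a, b). (a, - b)) p = p} ?w one_bit"
    by (rule gen_series_bit_involution[OF fin]) auto
  also have "{p \<in> ?K. (\<lambda>(a, b). (a, - b)) p = p} = {}"
    by auto
  also have "gen_series {} ?w one_bit = 0"
    by (rule fps_ext) (simp add: gen_series_nth)
  also have "gen_series ?Q ?w one_bit = gen_series (?P \<times> ?P) ?w one_bit"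
  proof (rule gen_series_reindex[symmetric])
    show "bij_betw (\<lambda>(a, b). (a, if 3 dvd a - b then b else - b)) (?P \<times> ?P) ?Q"
    proof (rule bij_betwI[of _ _ _ "\<lambda>(a, b). (a, \<bar>b\<bar>)"])
      have "3 dvd a + b" if "\<not> 3 dvd a - b" "\<not> 3 dvd a" "\<not> 3 dvd b" for a b :: int
        using that by presburger
      then show "(\<lambda>(a, b). (a, if 3 dvd a - b then b else - b)) \<in> ?P \<times> ?P \<rightarrow> ?Q"
        by (auto split: if_splits)
      show "(\<lambda>(a, b). (a, \<bar>b\<bar>)) \<in> ?Q \<rightarrow> ?P \<times> ?P"
      proof
        fix p assume "p \<in> ?Q"
        then obtain a b where p: "p = (a, b)" "0 < a" "odd a" "odd b" "3 dvd a - b" "\<not> 3 dvd a"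
          by (cases p) blast
        moreover have "\<not> 3 dvd b" using p(5,6) by presburger
        moreover have "b \<noteq> 0" using p(4) by auto
        ultimately show "(\<lambda>(a, b). (a, \<bar>b\<bar>)) p \<in> ?P \<times> ?P" by simp
      qed
      have "\<not> 3 dvd a + b" if "3 dvd a - b" "\<not> 3 dvd a" for a b :: int
        using that by presburger
      then show "(\<lambda>(a, b). (a, if 3 dvd a - b then b else - b)) ((\<lambda>(a, b). (a, \<bar>b\<bar>)) q) = q"
        if "q \<in> ?Q" for q
        using that by (cases q) (auto simp: abs_if)
    qed auto
  qed auto
  also have "\<dots> = coprime6_fps * (coprime6_fps oo fps_X ^ c)"
    unfolding coprime6_fps_def by (simp only: gen_series_sq_mult_scaled[OF assms])
  finally show ?thesis by simp
qed

text \<open>The reflection of the form \<open>a\<^sup>2 + c b\<^sup>2\<close> in the vector \<open>(1, 1)\<close>, for \<open>c = 2\<close> and \<open>c = 5\<close>, up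
  to sign: it pairs off the representations that are not multiples of an eigenvector.\<close>

definition sign_normal :: "int \<Rightarrow> int \<Rightarrow> int \<times> int" where
  "sign_normal a b = (if a > 0 then (a, b) else (- a, - b))"

text \<open>Jacobi's formula for the cube of \<eta>, modulo 2. Frobenius turns the cube into a
  product with form a^2 + 2 b^2. Up to sign, \<sigma> fixes the multiples of (1, 1) and of (2, -1),
  and the latter never have two odd entries.\<close>

lemma coprime6_cube: "coprime6_fps ^ 3 = Delta oo fps_X ^ 3"
proof -
  let ?w = "\<lambda>(a, b). 1 * sq a + 2 * sq b"
  define \<sigma> where "\<sigma> = (\<lambda>(a, b). sign_normal ((4 * b - a) div 3) ((2 * a + b) div 3))"
  have step: "\<sigma> (a, b) \<in> pairs_mod_3 \<and> \<sigma> (\<sigma> (a, b)) = (a, b) \<and> ?w (\<sigma> (a, b)) = ?w (a, b)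
      \<and> (\<sigma> (a, b) = (a, b) \<longleftrightarrow> b = a)" if ab: "0 < a" "odd a" "odd b" "3 dvd a - b" for a b
  proof -
    obtain k where k: "a = b + 3 * k" using ab(4) by (auto simp: dvd_def) (metis add.commute diff_add_cancel)
    then have s: "\<sigma> (a, b) = sign_normal (b - k) (b + 2 * k)"
      by (auto simp: \<sigma>_def)
    have ev: "even k" using ab k by simp
    then have ne: "b - k \<noteq> 0" using ab by auto
    have step: ?thesis if "\<sigma> (a, b) = (x, y)" "\<sigma> (x, y) = (a, b)" "x > 0" "odd x" "odd y"
      "3 dvd x - y" "1 * sq x + 2 * sq y = 1 * sq a + 2 * sq b" "x = a \<and> y = b \<longleftrightarrow> b = a" for x y
      using that by simp
    have w: "1 * sq (b - k) + 2 * sq (b + 2 * k) = 1 * sq a + 2 * sq b"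
      unfolding sq_eq_iff by (simp add: k power2_eq_square algebra_simps)
    show ?thesis
    proof (cases "b - k > 0")
      case True
      show ?thesis
      proof (rule step)
        show "\<sigma> (a, b) = (b - k, b + 2 * k)" using True by (simp add: s sign_normal_def)
        show "\<sigma> (b - k, b + 2 * k) = (a, b)"
          using ab(1) k by (auto simp: \<sigma>_def sign_normal_def)
        show "b - k = a \<and> b + 2 * k = b \<longleftrightarrow> b = a" using k ab(1) True by auto
      qed (use True ev ab w in simp_all)
    next
      case False
      show ?thesis
      proof (rule step)
        show "\<sigma> (a, b) = (k - b, - b - 2 * k)" using False by (simp add: s sign_normal_def)
        show "\<sigma> (k - b, - b - 2 * k) = (a, b)"
          using ab(1) k by (auto simp: \<sigma>_def sign_normal_def)
        show "k - b = a \<and> - b - 2 * k = b \<longleftrightarrow> b = a" using k ab(1,3) ev False by (auto simp: algebra_simps, presburger)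
        show "1 * sq (k - b) + 2 * sq (- b - 2 * k) = 1 * sq a + 2 * sq b"
          using w sq_uminus[of "b - k"] sq_uminus[of "b + 2 * k"] by simp
      qed (use False ne ev ab in simp_all)
    qed
  qed
  have "coprime6_fps ^ 3 = coprime6_fps * (coprime6_fps oo fps_X ^ 2)"
    unfolding bit_fps_square[symmetric] by (simp add: power3_eq_cube power2_eq_square mult.assoc)
  also have "\<dots> = gen_series pairs_mod_3 ?w one_bit"
    by (simp only: coprime6_mult zero_less_numeral)
  also have "\<dots> = gen_series {p \<in> pairs_mod_3. \<sigma> p = p} ?w one_bit"
  proof (rule gen_series_bit_involution[OF finite_sq_scaled])
    fix p assume "p \<in> pairs_mod_3"
    then obtain a b where p: "p = (a, b)" "0 < a" "odd a" "odd b" "3 dvd a - b" by (cases p) blast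
    show "\<sigma> p \<in> pairs_mod_3" "\<sigma> (\<sigma> p) = p" "?w (\<sigma> p) = ?w p"
      using step[OF p(2-5)] by (simp_all only: p(1))
  qed simp_all
  also have "{p \<in> pairs_mod_3. \<sigma> p = p} = (\<lambda>a. (a, a)) ` pos_odd" (is "?L = ?R")
  proof (rule Set.set_eqI)
    fix p :: "int \<times> int"
    obtain a b where p: "p = (a, b)" by (cases p)
    show "p \<in> ?L \<longleftrightarrow> p \<in> ?R"
      using step[of a b] by (auto simp: p)
  qed
  also have "gen_series \<dots> ?w one_bit = gen_series pos_odd (\<lambda>a. 3 * sq a) one_bit"
    by (rule gen_series_reindex[symmetric, of "\<lambda>a. (a, a)"]) (auto simp: bij_betw_def inj_on_def)
  also have "\<dots> = Delta oo fps_X ^ 3"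
    by (simp add: Delta_int gen_series_compose_X_power)
  finally show ?thesis .
qed

text \<open>Here both eigenvectors of the reflection, (1, 1) and (5, -1), have odd entries; their
  multiples represent 6 a^2 and 30 a^2.\<close>

lemma coprime6_mult_5:
  "coprime6_fps * (coprime6_fps oo fps_X ^ 5) = (Delta oo fps_X ^ 6) + (Delta oo fps_X ^ 30)"
proof -
  let ?w = "\<lambda>(a, b). 1 * sq a + 5 * sq b"
  define \<sigma> where "\<sigma> = (\<lambda>(a, b). sign_normal ((5 * b - 2 * a) div 3) ((a + 2 * b) div 3))"
  have step: "\<sigma> (a, b) \<in> pairs_mod_3 \<and> \<sigma> (\<sigma> (a, b)) = (a, b) \<and> ?w (\<sigma> (a, b)) = ?w (a, b)
      \<and> (\<sigma> (a, b) = (a, b) \<longleftrightarrow> a = b \<or> a = - 5 * b)" if ab: "0 < a" "odd a" "odd b" "3 dvd a - b" for a b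
  proof -
    obtain k where k: "a = b + 3 * k" using ab(4) by (auto simp: dvd_def) (metis add.commute diff_add_cancel)
    then have s: "\<sigma> (a, b) = sign_normal (b - 2 * k) (b + k)"
      by (auto simp: \<sigma>_def)
    have ev: "even k" using ab k by simp
    then have ne: "b - 2 * k \<noteq> 0" using ab by auto
    have step: ?thesis if "\<sigma> (a, b) = (x, y)" "\<sigma> (x, y) = (a, b)" "x > 0" "odd x" "odd y"
      "3 dvd x - y" "1 * sq x + 5 * sq y = 1 * sq a + 5 * sq b" "x = a \<and> y = b \<longleftrightarrow> a = b \<or> a = - 5 * b" for x y
      using that by simp
    have w: "1 * sq (b - 2 * k) + 5 * sq (b + k) = 1 * sq a + 5 * sq b"
      unfolding sq_eq_iff by (simp add: k power2_eq_square algebra_simps)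
    show ?thesis
    proof (cases "b - 2 * k > 0")
      case True
      show ?thesis
      proof (rule step)
        show "\<sigma> (a, b) = (b - 2 * k, b + k)" using True by (simp add: s sign_normal_def)
        show "\<sigma> (b - 2 * k, b + k) = (a, b)"
          using ab(1) k by (auto simp: \<sigma>_def sign_normal_def)
        show "b - 2 * k = a \<and> b + k = b \<longleftrightarrow> a = b \<or> a = - 5 * b" using k ab(1) True by auto
      qed (use True ev ab w in simp_all)
    next
      case False
      show ?thesis
      proof (rule step)
        show "\<sigma> (a, b) = (2 * k - b, - b - k)" using False by (simp add: s sign_normal_def)
        show "\<sigma> (2 * k - b, - b - k) = (a, b)"
          using ab(1) k by (auto simp: \<sigma>_def sign_normal_def)
        show "2 * k - b = a \<and> - b - k = b \<longleftrightarrow> a = b \<or> a = - 5 * b" using k ab(1,3) ev False by (auto simp: algebra_simps)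
        show "1 * sq (2 * k - b) + 5 * sq (- b - k) = 1 * sq a + 5 * sq b"
          using w sq_uminus[of "b - 2 * k"] sq_uminus[of "b + k"] by simp
      qed (use False ne ev ab in simp_all)
    qed
  qed
  have "coprime6_fps * (coprime6_fps oo fps_X ^ 5) = gen_series pairs_mod_3 ?w one_bit"
    by (simp only: coprime6_mult zero_less_numeral)
  also have "\<dots> = gen_series {p \<in> pairs_mod_3. \<sigma> p = p} ?w one_bit"
  proof (rule gen_series_bit_involution[OF finite_sq_scaled])
    fix p assume "p \<in> pairs_mod_3"
    then obtain a b where p: "p = (a, b)" "0 < a" "odd a" "odd b" "3 dvd a - b" by (cases p) blast
    show "\<sigma> p \<in> pairs_mod_3" "\<sigma> (\<sigma> p) = p" "?w (\<sigma> p) = ?w p"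
      using step[OF p(2-5)] by (simp_all only: p(1))
  qed simp_all
  also have "{p \<in> pairs_mod_3. \<sigma> p = p} = (\<lambda>a. (a, a)) ` pos_odd \<union> (\<lambda>a. (5 * a, - a)) ` pos_odd" (is "?L = ?R")
  proof (rule Set.set_eqI)
    fix p :: "int \<times> int"
    obtain a b where p: "p = (a, b)" by (cases p)
    show "p \<in> ?L \<longleftrightarrow> p \<in> ?R"
    proof
      assume "p \<in> ?L"
      then have ab: "0 < a" "odd a" "odd b" "3 dvd a - b" "\<sigma> (a, b) = (a, b)" by (simp_all add: p)
      with step[OF ab(1-4)] consider "a = b" | "a = - 5 * b" by blast
      then show "p \<in> ?R"
      proof cases
        case 2
        then have "p = (5 * (- b), - (- b))" "0 < - b" "odd (- b)" using ab by (simp_all add: p)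
        then show ?thesis by blast
      qed (use ab in \<open>auto simp: p\<close>)
    next
      assume "p \<in> ?R"
      then have "0 < a" "odd a" "odd b" "3 dvd a - b" "a = b \<or> a = - 5 * b"
        by (auto simp: p)
      then show "p \<in> ?L" using step[of a b] by (auto simp: p)
    qed
  qed
  also have "gen_series \<dots> ?w one_bit =
      gen_series ((\<lambda>a. (a, a)) ` pos_odd) ?w one_bit + gen_series ((\<lambda>a. (5 * a, - a)) ` pos_odd) ?w one_bit"
    by (rule gen_series_Un[OF _ finite_sq_scaled finite_sq_scaled]) auto
  also have "gen_series ((\<lambda>a. (a, a)) ` pos_odd) ?w one_bit = gen_series pos_odd (\<lambda>a. 6 * sq a) one_bit"
    by (rule gen_series_reindex[symmetric, of "\<lambda>a. (a, a)"]) (auto simp: bij_betw_def inj_on_def)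
  also have "gen_series ((\<lambda>a. (5 * a, - a)) ` pos_odd) ?w one_bit = gen_series pos_odd (\<lambda>a. 30 * sq a) one_bit"
    by (rule gen_series_reindex[symmetric, of "\<lambda>a. (5 * a, - a)"])
       (auto simp: bij_betw_def inj_on_def sq_def power_mult_distrib nat_mult_distrib)
  also have "gen_series pos_odd (\<lambda>a. 6 * sq a) one_bit = Delta oo fps_X ^ 6"
    by (simp add: Delta_int gen_series_compose_X_power)
  also have "gen_series pos_odd (\<lambda>a. 30 * sq a) one_bit = Delta oo fps_X ^ 30"
    by (simp add: Delta_int gen_series_compose_X_power)
  finally show ?thesis .
qed

lemma fps_compose_X_powers:
  fixes F :: "'a::comm_ring_1 fps"
  assumes "c > 0" "d > 0"
  shows "(F oo fps_X ^ c) oo fps_X ^ d = F oo fps_X ^ (c * d)"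
proof (rule fps_ext)
  show "((F oo fps_X ^ c) oo fps_X ^ d) $ n = (F oo fps_X ^ (c * d)) $ n" for n
    using assms by (auto simp: fps_compose_X_power_nth div_mult2_eq mult.commute)
qed

lemma fps_compose_X_power_inject:
  fixes F :: "'a::comm_ring_1 fps"
  assumes "d > 0" "F oo fps_X ^ d = G oo fps_X ^ d"
  shows "F = G"
proof (rule fps_ext)
  show "F $ n = G $ n" for n
    using arg_cong[OF assms(2), of "\<lambda>H. H $ (d * n)"] assms(1) by (simp add: fps_compose_X_power_nth)
qed

text \<open>Proved after q -> q^3, where \<Delta> becomes the cube of \<open>coprime6_fps\<close>:
  there \<open>coprime6_mult_5\<close> evaluates the square of the sum, and its cube is the
  claim.\<close>

theorem modular_equation_5:
  "(Delta + (Delta oo fps_X ^ 5)) ^ 6 = Delta * (Delta oo fps_X ^ 5)"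
proof (rule fps_compose_X_power_inject[of 3])
  let ?s = "Delta + (Delta oo fps_X ^ 5)"
  have s2: "(?s oo fps_X ^ 3)\<^sup>2 = (Delta oo fps_X ^ 6) + (Delta oo fps_X ^ 30)"
    unfolding bit_fps_square[of "?s oo fps_X ^ 3"]
    by (simp add: fps_compose_add_distrib fps_compose_X_powers)
  have "?s ^ 6 oo fps_X ^ 3 = ((?s oo fps_X ^ 3)\<^sup>2) ^ 3"
    by (simp add: fps_compose_power flip: power_mult)
  also have "\<dots> = (coprime6_fps * (coprime6_fps oo fps_X ^ 5)) ^ 3"
    by (simp only: s2 coprime6_mult_5)
  also have "\<dots> = coprime6_fps ^ 3 * (coprime6_fps ^ 3 oo fps_X ^ 5)"
    by (simp add: power_mult_distrib fps_compose_power)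
  also have "\<dots> = Delta * (Delta oo fps_X ^ 5) oo fps_X ^ 3"
    by (simp add: coprime6_cube fps_compose_mult_distrib fps_compose_X_powers)
  finally show "?s ^ 6 oo fps_X ^ 3 = Delta * (Delta oo fps_X ^ 5) oo fps_X ^ 3" .
qed simp

section \<open>The code of an exponent\<close>

text \<open>The code of Nicolas and Serre: each base 4 digit of \<open>k\<close> holds one binary digit of \<open>code3 k\<close> and
  one of \<open>code5 k\<close>. Up to terms of smaller weight, the operators at 3 and 5 lower one of the two
  numbers attached to the power \<open>\<Delta>\<^bsup>2k+1\<^esup>\<close> by 1.\<close>

fun code3 :: "nat \<Rightarrow> nat" where
  "code3 k = (if k = 0 then 0 else k mod 2 + 2 * code3 (k div 4))"

fun code5 :: "nat \<Rightarrow> nat" where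
  "code5 k = (if k = 0 then 0 else k div 2 mod 2 + 2 * code5 (k div 4))"

function enc :: "nat \<Rightarrow> nat \<Rightarrow> nat" where
  "enc a b = (if a = 0 \<and> b = 0 then 0 else a mod 2 + 2 * (b mod 2) + 4 * enc (a div 2) (b div 2))"
  by auto
termination by (relation "Wellfounded.measure (\<lambda>(a, b). a + b)") auto

declare code3.simps [simp del] code5.simps [simp del] enc.simps [simp del]

text \<open>With x and y as the weights of the two codes, the strict inequalities of
  \<open>weight_double\<close> require x < y < 2 x, and 2, 3 are the least such integers. The plain
  sum of the codes would fail there.\<close>

definition weight :: "nat \<Rightarrow> nat" where
  "weight k = 2 * code3 k + 3 * code5 k"

definition pred3 :: "nat \<Rightarrow> nat" where
  "pred3 k = enc (code3 k - 1) (code5 k)"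

definition pred5 :: "nat \<Rightarrow> nat" where
  "pred5 k = enc (code3 k) (code5 k - 1)"

lemma code_0 [simp]: "code3 0 = 0" "code5 0 = 0" "enc 0 0 = 0" "weight 0 = 0"
  by (simp_all add: code3.simps code5.simps enc.simps weight_def)

lemma code_step:
  assumes "d < 4"
  shows "code3 (4 * k + d) = d mod 2 + 2 * code3 k" "code5 (4 * k + d) = d div 2 + 2 * code5 k"
proof -
  have "(4 * k + d) mod 2 = d mod 2" "(4 * k + d) div 2 mod 2 = d div 2" "(4 * k + d) div 4 = k"
    using assms by presburger+
  then show "code3 (4 * k + d) = d mod 2 + 2 * code3 k" "code5 (4 * k + d) = d div 2 + 2 * code5 k"
    using code3.simps[of "4 * k + d"] code5.simps[of "4 * k + d"] by (cases "4 * k + d = 0"; simp)+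
qed

lemma code_digits [simp]:
  "code3 (4 * k) = 2 * code3 k" "code3 (4 * k + 1) = 2 * code3 k + 1"
  "code3 (4 * k + 2) = 2 * code3 k" "code3 (4 * k + 3) = 2 * code3 k + 1"
  "code5 (4 * k) = 2 * code5 k" "code5 (4 * k + 1) = 2 * code5 k"
  "code5 (4 * k + 2) = 2 * code5 k + 1" "code5 (4 * k + 3) = 2 * code5 k + 1"
  using code_step[of 0 k] code_step[of 1 k] code_step[of 2 k] code_step[of 3 k] by simp_all

lemma code_digits_Suc [simp]:
  "code3 (Suc (4 * k)) = 2 * code3 k + 1" "code5 (Suc (4 * k)) = 2 * code5 k"
  "code3 (Suc (Suc (4 * k))) = 2 * code3 k" "code5 (Suc (Suc (4 * k))) = 2 * code5 k + 1"
  "code3 (Suc (Suc (Suc (4 * k)))) = 2 * code3 k + 1" "code5 (Suc (Suc (Suc (4 * k)))) = 2 * code5 k + 1"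
  using code_digits(2-4,6-8)[of k] by (simp_all add: numeral_eq_Suc)

lemma weight_digits:
  "weight (4 * k) = 2 * weight k" "weight (4 * k + 1) = 2 * weight k + 2"
  "weight (4 * k + 2) = 2 * weight k + 3" "weight (4 * k + 3) = 2 * weight k + 5"
  "weight (Suc (4 * k)) = 2 * weight k + 2"  "weight (Suc (Suc (4 * k))) = 2 * weight k + 3"
  "weight (Suc (Suc (Suc (4 * k)))) = 2 * weight k + 5"
  by (simp_all add: weight_def)

declare weight_digits [simp]

lemma weight_step: "d < 4 \<Longrightarrow> weight (4 * k + d) = 2 * weight k + (2 * (d mod 2) + 3 * (d div 2))"
  by (simp add: weight_def code_step)

lemma enc_digits [simp]:
  "enc (2 * a) (2 * b) = 4 * enc a b" "enc (Suc (2 * a)) (2 * b) = 4 * enc a b + 1"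
  "enc (2 * a) (Suc (2 * b)) = 4 * enc a b + 2" "enc (Suc (2 * a)) (Suc (2 * b)) = 4 * enc a b + 3"
  by (subst enc.simps, simp)+

lemma digit_cases:
  obtains m where "n = 4 * m" | m where "n = 4 * m + 1" | m where "n = 4 * m + 2" | m where "n = 4 * m + (3::nat)"
proof -
  have "n = 4 * (n div 4) \<or> n = 4 * (n div 4) + 1 \<or> n = 4 * (n div 4) + 2 \<or> n = 4 * (n div 4) + 3"
    by presburger
  then show ?thesis using that by blast
qed

lemma code_enc [simp]: "code3 (enc a b) = a" "code5 (enc a b) = b"
proof (induction a b rule: enc.induct)
  case (1 a b)
  have "code3 (enc a b) = a \<and> code5 (enc a b) = b"
  proof (cases "a = 0 \<and> b = 0")
    case False
    note IH = 1[OF False]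
    consider "even a" "even b" | "odd a" "even b" | "even a" "odd b" | "odd a" "odd b" by blast
    then show ?thesis
      by cases (use IH in \<open>auto elim!: evenE oddE\<close>)
  qed auto
  then show "code3 (enc a b) = a" "code5 (enc a b) = b" by auto
qed

lemma enc_code [simp]: "enc (code3 k) (code5 k) = k"
proof (induction k rule: less_induct)
  case (less k)
  show ?case
  proof (cases "k = 0")
    case False
    then have "k div 4 < k" by simp
    note IH = less[OF this]
    have d: "Suc (4 * m) div 4 = m" "Suc (Suc (4 * m)) div 4 = m" "(4 * m + 3) div 4 = m" for m :: nat by presburger+
    show ?thesis
      by (cases k rule: digit_cases) (use IH in \<open>auto simp: d\<close>)
  qed auto
qed

lemma weight_enc [simp]: "weight (enc a b) = 2 * a + 3 * b"
  by (simp add: weight_def)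

lemma weight_Suc: "weight (Suc n) \<le> weight n + 2"
proof (induction n rule: less_induct)
  case (less n)
  show ?case
  proof (cases n rule: digit_cases)
    case (3 m)
    then have "Suc n = 4 * m + 3" by simp
    then show ?thesis by (simp add: 3)
  next
    case (4 m)
    then have "Suc n = 4 * Suc m" by simp
    moreover have "weight (Suc m) \<le> weight m + 2" using less[of m] 4 by simp
    ultimately show ?thesis by (simp only: weight_digits 4)
  next
    case (2 m)
    then have "Suc n = 4 * m + 2" by simp
    then show ?thesis by (simp only: weight_digits 2)
  qed auto
qed

text \<open>Digit by digit: a carry raises the contribution of the higher digits by at most 4, twice
  the bound of \<open>weight_Suc\<close>, while two digits that produce a carry lose at least
  4.\<close>

lemma weight_add: "weight (i + j) \<le> weight i + weight j"
proof (induction i arbitrary: j rule: less_induct)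
  case (less i)
  show ?case
  proof (cases "i = 0")
    case False
    obtain i' d where i: "i = 4 * i' + d" "d < 4" by (metis mod_less_divisor mult_div_mod_eq zero_less_numeral)
    obtain j' e where j: "j = 4 * j' + e" "e < 4" by (metis mod_less_divisor mult_div_mod_eq zero_less_numeral)
    have IH: "weight (i' + j') \<le> weight i' + weight j'" using less[of i'] i False by auto
    have S: "weight (Suc (i' + j')) \<le> weight i' + weight j' + 2" using IH weight_Suc[of "i' + j'"] by simp
    have D: "d = 0 \<or> d = 1 \<or> d = 2 \<or> d = 3" "e = 0 \<or> e = 1 \<or> e = 2 \<or> e = 3" using i(2) j(2) by linarith+
    let ?c = "\<lambda>d. 2 * (d mod 2) + 3 * (d div 2 :: nat)"
    show ?thesis
    proof (cases "d + e < 4")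
      case True
      then have "weight (i + j) = 2 * weight (i' + j') + ?c (d + e)"
        using weight_step[of "d + e" "i' + j'"] by (simp add: i(1) j(1) algebra_simps)
      moreover have "?c (d + e) \<le> ?c d + ?c e" using True D by (elim disjE; simp)
      ultimately show ?thesis using IH by (simp only: i(1) j(1) weight_step[OF i(2)] weight_step[OF j(2)])
    next
      case False
      then have "weight (4 * Suc (i' + j') + (d + e - 4)) = 2 * weight (Suc (i' + j')) + ?c (d + e - 4)"
        using i(2) j(2) by (intro weight_step) simp
      moreover have "i + j = 4 * Suc (i' + j') + (d + e - 4)" using False by (simp add: i(1) j(1))
      moreover have "?c (d + e - 4) + 4 \<le> ?c d + ?c e" using False D by (elim disjE; simp)
      ultimately show ?thesis using S by (simp only: i(1) j(1) weight_step[OF i(2)] weight_step[OF j(2)])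
    qed
  qed simp
qed

lemma pred3_digits [simp]:
  "pred3 (4 * k + 1) = 4 * k" "pred3 (Suc (4 * k)) = 4 * k" "pred3 (4 * k + 3) = 4 * k + 2" "pred3 (Suc (Suc (Suc (4 * k)))) = 4 * k + 2"
  "code3 k > 0 \<Longrightarrow> pred3 (4 * k) = 4 * pred3 k + 1"
  "code3 k > 0 \<Longrightarrow> pred3 (Suc (Suc (4 * k))) = 4 * pred3 k + 3"
proof -
  show "pred3 (4 * k + 1) = 4 * k" "pred3 (Suc (4 * k)) = 4 * k" "pred3 (4 * k + 3) = 4 * k + 2" "pred3 (Suc (Suc (Suc (4 * k)))) = 4 * k + 2"
    by (simp_all add: pred3_def)
  assume "code3 k > 0"
  then have "2 * code3 k - 1 = Suc (2 * (code3 k - 1))" by simp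
  then show "pred3 (4 * k) = 4 * pred3 k + 1" "pred3 (Suc (Suc (4 * k))) = 4 * pred3 k + 3"
    by (simp_all add: pred3_def)
qed

lemma pred5_digits [simp]:
  "pred5 (4 * k + 2) = 4 * k" "pred5 (Suc (Suc (4 * k))) = 4 * k" "pred5 (4 * k + 3) = 4 * k + 1"
  "code5 k > 0 \<Longrightarrow> pred5 (4 * k) = 4 * pred5 k + 2"
  "code5 k > 0 \<Longrightarrow> pred5 (Suc (4 * k)) = 4 * pred5 k + 3"
proof -
  show "pred5 (4 * k + 2) = 4 * k" "pred5 (Suc (Suc (4 * k))) = 4 * k" "pred5 (4 * k + 3) = 4 * k + 1"
    by (simp_all add: pred5_def)
  assume "code5 k > 0"
  then have "2 * code5 k - 1 = Suc (2 * (code5 k - 1))" by simp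
  then show "pred5 (4 * k) = 4 * pred5 k + 2" "pred5 (Suc (4 * k)) = 4 * pred5 k + 3"
    by (simp_all add: pred5_def)
qed

lemma weight_pred3: "code3 k > 0 \<Longrightarrow> weight (pred3 k) + 2 = weight k"
  and weight_pred5: "code5 k > 0 \<Longrightarrow> weight (pred5 k) + 3 = weight k"
  by (simp_all add: pred3_def pred5_def weight_def)

section \<open>Top digits and the comparison of weights\<close>

definition pow4 :: "nat \<Rightarrow> nat" where "pow4 s = 4 ^ s"

lemma pow4_simps: "pow4 0 = 1" "pow4 (Suc s) = 4 * pow4 s"
  by (simp_all add: pow4_def)

lemma weight_1: "code3 1 = 1" "code5 1 = 0" "code3 (Suc 0) = 1" "code5 (Suc 0) = 0" "code3 2 = 0" "code5 2 = 1"
  "code3 3 = 1" "code5 3 = 1" "weight 1 = 2" "weight (Suc 0) = 2" "weight 2 = 3" "weight 3 = 5"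
  using code_digits(2-4,6-8)[of 0] weight_digits(2-4)[of 0] by (simp_all add: numeral_2_eq_2)

lemma weight_pow4: "weight (pow4 s) = 2 * 2 ^ s" "weight (2 * pow4 s) = 3 * 2 ^ s"
proof (induction s)
  case (Suc s)
  { case 1 show ?case using Suc by (simp add: pow4_simps) }
  { case 2
    have "2 * pow4 (Suc s) = 4 * (2 * pow4 s)" by (simp add: pow4_simps)
    then show ?case using Suc by (simp only: weight_digits) simp }
qed (simp_all add: pow4_simps weight_1)

lemma code_top:
  "m < pow4 s \<Longrightarrow> code3 (pow4 s + m) = 2 ^ s + code3 m \<and> code5 (pow4 s + m) = code5 m"
  "m < 2 * pow4 s \<Longrightarrow> code5 (2 * pow4 s + m) = 2 ^ s + code5 m \<and> code3 (2 * pow4 s + m) = code3 m"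
proof (induction s arbitrary: m)
  case 0
  { case 1 then show ?case by (simp add: pow4_simps weight_1) }
  { case 2
    then have "m = 0 \<or> m = 1" by (auto simp: pow4_simps)
    then show ?case by (auto simp: pow4_simps weight_1 code_digits_Suc[of 0, simplified]) }
next
  case (Suc s)
  { case 1
    obtain l d where l: "m = 4 * l + d" "d < 4" by (metis mod_less_divisor mult_div_mod_eq zero_less_numeral)
    then have "l < pow4 s" using 1 l unfolding pow4_simps by linarith
    from Suc(1)[OF this] have IH: "code3 (pow4 s + l) = 2 ^ s + code3 l" "code5 (pow4 s + l) = code5 l" by auto
    have "pow4 (Suc s) + m = 4 * (pow4 s + l) + d" by (simp add: l pow4_simps)
    then show ?case by (simp only: code_step[OF l(2)] l(1) IH) simp }
  { case 2
    obtain l d where l: "m = 4 * l + d" "d < 4" by (metis mod_less_divisor mult_div_mod_eq zero_less_numeral)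
    then have "l < 2 * pow4 s" using 2 l unfolding pow4_simps by linarith
    from Suc(2)[OF this] have IH: "code5 (2 * pow4 s + l) = 2 ^ s + code5 l" "code3 (2 * pow4 s + l) = code3 l" by auto
    have "2 * pow4 (Suc s) + m = 4 * (2 * pow4 s + l) + d" by (simp add: l pow4_simps)
    then show ?case by (simp only: code_step[OF l(2)] l(1) IH) simp }
qed

lemma weight_top:
  "m < 4 * pow4 s \<Longrightarrow> weight (4 * pow4 s + m) = 4 * 2 ^ s + weight m"
  "m < 8 * pow4 s \<Longrightarrow> weight (8 * pow4 s + m) = 6 * 2 ^ s + weight m"
  using code_top[of m "Suc s"] by (simp_all add: weight_def pow4_simps)

text \<open>The second summand of the recurrence trades 4 u for u + u. Strictness keeps it below the
  leading weight when the lowest digit of m can be lowered.\<close>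

lemma weight_double:
  "m < 4 * pow4 s \<Longrightarrow> weight (pow4 s + (pow4 s + m)) < weight (4 * pow4 s + m)"
  "m < 8 * pow4 s \<Longrightarrow> weight (2 * pow4 s + (2 * pow4 s + m)) < weight (8 * pow4 s + m)"
proof -
  assume "m < 4 * pow4 s"
  moreover have "weight (pow4 s + (pow4 s + m)) \<le> weight (2 * pow4 s) + weight m"
    using weight_add[of "2 * pow4 s" m] by (simp add: add.assoc mult_2)
  ultimately show "weight (pow4 s + (pow4 s + m)) < weight (4 * pow4 s + m)"
    using weight_top(1)[of m s] weight_pow4(2)[of s] zero_less_power[of "2::nat" s] by linarith
next
  assume "m < 8 * pow4 s"
  moreover have "weight (2 * pow4 s + (2 * pow4 s + m)) \<le> weight (4 * pow4 s) + weight m"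
    using weight_add[of "4 * pow4 s" m] by (simp add: add.assoc)
  ultimately show "weight (2 * pow4 s + (2 * pow4 s + m)) < weight (8 * pow4 s + m)"
    using weight_top(2)[of m s] weight_pow4(1)[of "Suc s"] zero_less_power[of "2::nat" s]
    unfolding pow4_simps power_Suc by linarith
qed

lemma small_codes:
  "code3 (numeral n) = numeral n mod 2 + 2 * code3 (numeral n div 4)"
  "code5 (numeral n) = numeral n div 2 mod 2 + 2 * code5 (numeral n div 4)"
  "code3 (Suc 0) = 1" "code5 (Suc 0) = 0"
  "enc (numeral n) b = numeral n mod 2 + 2 * (b mod 2) + 4 * enc (numeral n div 2) (b div 2)"
  "enc a (numeral n) = a mod 2 + 2 * (numeral n mod 2) + 4 * enc (a div 2) (numeral n div 2)"
  "enc (Suc (Suc i)) b = i mod 2 + 2 * (b mod 2) + 4 * enc (Suc (i div 2)) (b div 2)"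
  "enc a (Suc (Suc i)) = a mod 2 + 2 * (i mod 2) + 4 * enc (a div 2) (Suc (i div 2))"
  "code3 (Suc (Suc 0)) = 0" "code5 (Suc (Suc 0)) = 1" "code3 (Suc (Suc (Suc 0))) = 1" "code5 (Suc (Suc (Suc 0))) = 1"
  "enc (Suc 0) 0 = 1" "enc 0 (Suc 0) = 2" "enc (Suc 0) (Suc 0) = 3"
  using code_digits_Suc[of 0] by (simp_all add: code3.simps[of "numeral n"] code5.simps[of "numeral n"]
    enc.simps[of "numeral n"] enc.simps[of _ "numeral n"] enc.simps[of "Suc _"] enc.simps[of _ "Suc _"])

text \<open>With \<open>x = \<Delta>\<^sup>2\<close> and \<open>T\<close> one of the two operators, \<open>T (x\<^bsup>4u+m\<^esup>\<Delta>)\<close> is the sum of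
  \<open>x\<^bsup>4u\<^esup> T (x\<^sup>m\<Delta>)\<close> and \<open>x\<^sup>u T (x\<^bsup>u+m\<^esup>\<Delta>)\<close> up to terms of smaller weight. The rule says that
  exactly one of the two summands contributes the leading term: the second one if \<open>m\<close> has nothing
  to lower and the top digit of \<open>4u\<close> is of the kind lowered by \<open>T\<close> (the case \<open>q\<close>).\<close>

definition lead_rule :: "(nat \<Rightarrow> nat) \<Rightarrow> (nat \<Rightarrow> nat) \<Rightarrow> nat \<Rightarrow> bool \<Rightarrow> nat \<Rightarrow> nat \<Rightarrow> bool" where
  "lead_rule C P c q u m \<longleftrightarrow> (C m > 0 \<longrightarrow> P (4 * u + m) = 4 * u + P m) \<and>
    ((q \<longrightarrow> C m > 0) \<longrightarrow> C (u + m) > 0 \<longrightarrow> weight (u + P (u + m)) + c < weight (4 * u + m)) \<and>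
    (q \<longrightarrow> C m = 0 \<longrightarrow> C (u + m) > 0 \<and> P (4 * u + m) = u + P (u + m))"

text \<open>The induction strips the lowest base 4 digit d of m. If d holds a bit counted by C
  (\<open>hi d\<close>), lowering only subtracts the value h of that bit from d, and
  \<open>double\<close> settles the comparison. Otherwise a borrow sets the bit in d and passes to
  the higher digits, where the induction hypothesis applies.\<close>

lemma lead_rule_induct:
  fixes C P :: "nat \<Rightarrow> nat"
  assumes hi: "\<And>k d. d < 4 \<Longrightarrow> hi d \<Longrightarrow> h \<le> d \<and> C (4 * k + d) > 0 \<and> P (4 * k + d) = 4 * k + (d - h)"
    and lo: "\<And>k d. d < 4 \<Longrightarrow> \<not> hi d \<Longrightarrow>
      d + h < 4 \<and> C (4 * k + d) = 2 * C k \<and> (C k > 0 \<longrightarrow> P (4 * k + d) = 4 * P k + (d + h))"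
    and h: "\<And>d. d + h < 4 \<Longrightarrow> \<not> hi d \<Longrightarrow> 2 * ((d + h) mod 2) + 3 * ((d + h) div 2) = 2 * (d mod 2) + 3 * (d div 2) + c"
      "\<And>d. d < 4 \<Longrightarrow> hi d \<Longrightarrow> 2 * (d mod 2) + 3 * (d div 2) = 2 * ((d - h) mod 2) + 3 * ((d - h) div 2) + c"
    and u: "\<And>s. u (Suc s) = 4 * u s"
    and double: "\<And>s m. m < 4 * u s \<Longrightarrow> weight (u s + (u s + m)) < weight (4 * u s + m)"
    and pos: "\<And>s m. m < 4 * u s \<Longrightarrow> q \<or> C m > 0 \<Longrightarrow> C (4 * u s + m) > 0"
    and base: "\<And>m. m < 4 * u 0 \<Longrightarrow> lead_rule C P c q (u 0) m"
  shows "m < 4 * u s \<Longrightarrow> lead_rule C P c q (u s) m"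
proof (induction s arbitrary: m)
  case (Suc s)
  obtain l d where l: "m = 4 * l + d" "d < 4" by (metis mod_less_divisor mult_div_mod_eq zero_less_numeral)
  let ?u = "u s" let ?v = "4 * u s"
  have lu: "l < ?v" using Suc.prems l unfolding u by linarith
  have eqs: "4 * u (Suc s) + m = 4 * (?v + l) + d" "u (Suc s) + m = 4 * (?u + l) + d"
    by (simp_all add: l u)
  note W = weight_step[OF l(2)]
  show ?case
  proof (cases "hi d")
    case True
    have p: "P (4 * k + d) = 4 * k + (d - h)" "C (4 * k + d) > 0" "h \<le> d" for k using hi[OF l(2) True] by auto
    have "d - h < 4" using l(2) by simp
    have "u (Suc s) + P (4 * (?u + l) + d) = 4 * (?u + (?u + l)) + (d - h)"
      by (simp only: p(1) u) simp
    then have "weight (u (Suc s) + P (4 * (?u + l) + d)) + c < weight (4 * (?v + l) + d)"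
      using double[OF lu] h(2)[OF l(2) True] by (simp only: W weight_step[OF \<open>d - h < 4\<close>])
    moreover have "P (4 * (?v + l) + d) = 4 * u (Suc s) + P m"
      using p(3) by (simp only: p(1) l(1) u) simp
    moreover have "C m \<noteq> 0" using p(2)[of l] by (simp add: l(1))
    ultimately show ?thesis
      unfolding lead_rule_def eqs by blast
  next
    case False
    have p: "C (4 * k + d) = 2 * C k" "d + h < 4" for k using lo[OF l(2) False] by auto
    have pd: "P (4 * k + d) = 4 * P k + (d + h)" if "C k > 0" for k using lo[OF l(2) False] that by auto
    note IH = Suc.IH[OF lu, unfolded lead_rule_def]
    have B: "weight (u (Suc s) + P (4 * (?u + l) + d)) + c < weight (4 * (?v + l) + d)"
      if "q \<longrightarrow> C l > 0" "C (?u + l) > 0"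
    proof -
      have "u (Suc s) + P (4 * (?u + l) + d) = 4 * (?u + P (?u + l)) + (d + h)"
        by (simp only: pd[OF that(2)] u) simp
      moreover have "weight (?u + P (?u + l)) + c < weight (?v + l)" using IH that by blast
      ultimately show ?thesis using h(1)[OF p(2) False] by (simp only: W weight_step[OF p(2)])
    qed
    have A: "P (4 * (?v + l) + d) = 4 * u (Suc s) + P m" if "C l > 0"
    proof -
      have "P (?v + l) = ?v + P l" using IH that by blast
      then show ?thesis
        by (simp only: pd[OF pos[OF lu disjI2[OF that]]] l(1) pd[OF that] u) simp
    qed
    have D: "P (4 * (?v + l) + d) = u (Suc s) + P (4 * (?u + l) + d)" if "q" "C l = 0"
    proof -
      have "P (?v + l) = ?u + P (?u + l)" "C (?u + l) > 0" using IH that by blast+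
      then show ?thesis
        by (simp only: pd[OF pos[OF lu disjI1[OF that(1)]]] pd u) simp
    qed
    have cz: "(0 < C m) = (0 < C l)" "(C m = 0) = (C l = 0)" "(0 < C (4 * (?u + l) + d)) = (0 < C (?u + l))"
      by (simp_all only: l(1) p(1)) simp_all
    show ?thesis
      unfolding lead_rule_def eqs cz using A B D IH by blast
  qed
qed (use base in simp)

lemma less_4: "(d::nat) < 4 \<Longrightarrow> d = 0 \<or> d = 1 \<or> d = 2 \<or> d = 3"
  by linarith

lemma lead_rule_code3:
  "m < 4 * pow4 s \<Longrightarrow> lead_rule code3 pred3 2 True (pow4 s) m"
  "m < 4 * (2 * pow4 s) \<Longrightarrow> lead_rule code3 pred3 2 False (2 * pow4 s) m"
proof -
  have digits: "d < 4 \<Longrightarrow> odd d \<Longrightarrow> 1 \<le> d \<and> code3 (4 * k + d) > 0 \<and> pred3 (4 * k + d) = 4 * k + (d - 1)"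
    "d < 4 \<Longrightarrow> \<not> odd d \<Longrightarrow> d + 1 < 4 \<and> code3 (4 * k + d) = 2 * code3 k \<and>
      (code3 k > 0 \<longrightarrow> pred3 (4 * k + d) = 4 * pred3 k + (d + 1))" for k d
    by (drule less_4, elim disjE; simp)+
  have w: "d + 1 < 4 \<Longrightarrow> \<not> odd d \<Longrightarrow> 2 * ((d + 1) mod 2) + 3 * ((d + 1) div 2) = 2 * (d mod 2) + 3 * (d div 2) + 2"
    "d < 4 \<Longrightarrow> odd d \<Longrightarrow> 2 * (d mod 2) + 3 * (d div 2) = 2 * ((d - 1) mod 2) + 3 * ((d - 1) div 2) + 2" for d :: nat
    by (drule less_4, elim disjE; simp)+
  show "m < 4 * pow4 s \<Longrightarrow> lead_rule code3 pred3 2 True (pow4 s) m"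
  proof (rule lead_rule_induct[where u = "\<lambda>s. pow4 s", OF digits w])
    fix m assume "m < 4 * pow4 0"
    then have "m = 0 \<or> m = 1 \<or> m = 2 \<or> m = 3" by (simp add: pow4_simps) linarith
    then show "lead_rule code3 pred3 2 True (pow4 0) m"
      by (elim disjE; simp add: pow4_simps weight_def pred3_def small_codes lead_rule_def)
  qed (use code_top(1)[of _ "Suc _"] weight_double(1) in \<open>auto simp: pow4_simps\<close>)
  show "m < 4 * (2 * pow4 s) \<Longrightarrow> lead_rule code3 pred3 2 False (2 * pow4 s) m"
  proof (rule lead_rule_induct[where u = "\<lambda>s. 2 * pow4 s", OF digits w])
    fix m assume "m < 4 * (2 * pow4 0)"
    then have "m = 0 \<or> m = 1 \<or> m = 2 \<or> m = 3 \<or> m = 4 \<or> m = 5 \<or> m = 6 \<or> m = 7" by (simp add: pow4_simps) linarith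
    then show "lead_rule code3 pred3 2 False (2 * pow4 0) m"
      by (elim disjE; simp add: pow4_simps weight_def pred3_def small_codes lead_rule_def)
  qed (use code_top(2)[of _ "Suc _"] weight_double(2) in \<open>auto simp: pow4_simps\<close>)
qed

lemma lead_rule_code5:
  "m < 4 * pow4 s \<Longrightarrow> lead_rule code5 pred5 3 False (pow4 s) m"
  "m < 4 * (2 * pow4 s) \<Longrightarrow> lead_rule code5 pred5 3 True (2 * pow4 s) m"
proof -
  have digits: "d < 4 \<Longrightarrow> 2 \<le> d \<Longrightarrow> 2 \<le> d \<and> code5 (4 * k + d) > 0 \<and> pred5 (4 * k + d) = 4 * k + (d - 2)"
    "d < 4 \<Longrightarrow> \<not> 2 \<le> d \<Longrightarrow> d + 2 < 4 \<and> code5 (4 * k + d) = 2 * code5 k \<and>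
      (code5 k > 0 \<longrightarrow> pred5 (4 * k + d) = 4 * pred5 k + (d + 2))" for k d
    by (drule less_4, elim disjE; simp)+
  have w: "d + 2 < 4 \<Longrightarrow> \<not> 2 \<le> d \<Longrightarrow> 2 * ((d + 2) mod 2) + 3 * ((d + 2) div 2) = 2 * (d mod 2) + 3 * (d div 2) + 3"
    "d < 4 \<Longrightarrow> 2 \<le> d \<Longrightarrow> 2 * (d mod 2) + 3 * (d div 2) = 2 * ((d - 2) mod 2) + 3 * ((d - 2) div 2) + 3" for d :: nat
    by (drule less_4, elim disjE; simp)+
  show "m < 4 * pow4 s \<Longrightarrow> lead_rule code5 pred5 3 False (pow4 s) m"
  proof (rule lead_rule_induct[where u = "\<lambda>s. pow4 s", OF digits w])
    fix m assume "m < 4 * pow4 0"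
    then have "m = 0 \<or> m = 1 \<or> m = 2 \<or> m = 3" by (simp add: pow4_simps) linarith
    then show "lead_rule code5 pred5 3 False (pow4 0) m"
      by (elim disjE; simp add: pow4_simps weight_def pred5_def small_codes lead_rule_def)
  qed (use code_top(1)[of _ "Suc _"] weight_double(1) in \<open>auto simp: pow4_simps\<close>)
  show "m < 4 * (2 * pow4 s) \<Longrightarrow> lead_rule code5 pred5 3 True (2 * pow4 s) m"
  proof (rule lead_rule_induct[where u = "\<lambda>s. 2 * pow4 s", OF digits w])
    fix m assume "m < 4 * (2 * pow4 0)"
    then have "m = 0 \<or> m = 1 \<or> m = 2 \<or> m = 3 \<or> m = 4 \<or> m = 5 \<or> m = 6 \<or> m = 7" by (simp add: pow4_simps) linarith
    then show "lead_rule code5 pred5 3 True (2 * pow4 0) m"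
      by (elim disjE; simp add: pow4_simps weight_def pred5_def small_codes lead_rule_def)
  qed (use code_top(2)[of _ "Suc _"] weight_double(2) in \<open>auto simp: pow4_simps\<close>)
qed

section \<open>Recurrences for the Hecke operators at 3 and 5\<close>

text \<open>T_p is the sum of a_n -> a_pn and f -> f(q^p). Adding the second part again cancels it
  and leaves an operator that is linear over the series in q^p.\<close>

lemma Hecke_section_nth: "p > 0 \<Longrightarrow> (Hecke p f + (f oo fps_X ^ p)) $ n = f $ (p * n)"
  by (simp add: Hecke_nth fps_compose_X_power_nth bit_add_self add.assoc)

lemma fps_mult_compose_X_power_nth:
  fixes F G :: "'a::comm_ring_1 fps"
  assumes "p > 0"
  shows "((G oo fps_X ^ p) * F) $ (p * n) = (\<Sum>j=0..n. G $ j * F $ (p * (n - j)))"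
proof -
  have "((G oo fps_X ^ p) * F) $ (p * n) = (\<Sum>i=0..p * n. if p dvd i then G $ (i div p) * F $ (p * n - i) else 0)"
    unfolding fps_mult_nth by (intro sum.cong) (auto simp: fps_compose_X_power_nth[OF assms])
  also have "\<dots> = (\<Sum>i | i \<in> {0..p * n} \<and> p dvd i. G $ (i div p) * F $ (p * n - i))"
    by (rule sum.mono_neutral_cong_right) auto
  also have "\<dots> = (\<Sum>j=0..n. G $ j * F $ (p * (n - j)))"
    by (rule sum.reindex_bij_witness[of _ "\<lambda>j. p * j" "\<lambda>i. i div p"])
      (use assms in \<open>auto simp: right_diff_distrib' elim!: dvdE\<close>)
  finally show ?thesis .
qed

lemma Hecke_section_mult:
  assumes "p > 0"
  shows "Hecke p ((G oo fps_X ^ p) * F) + (((G oo fps_X ^ p) * F) oo fps_X ^ p) =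
    G * (Hecke p F + (F oo fps_X ^ p))"
proof (rule fps_ext)
  fix n
  show "(Hecke p ((G oo fps_X ^ p) * F) + (((G oo fps_X ^ p) * F) oo fps_X ^ p)) $ n =
      (G * (Hecke p F + (F oo fps_X ^ p))) $ n"
    unfolding fps_mult_nth[of G] Hecke_section_nth[OF assms]
    by (rule fps_mult_compose_X_power_nth[OF assms])
qed

text \<open>A symmetric relation between \<open>A(q)\<close> and \<open>A(q\<^sup>p)\<close> gives a recurrence for the Hecke operator,
  since \<open>a\<^sub>n \<mapsto> a\<^sub>p\<^sub>n\<close> is linear over the series in \<open>q\<^sup>p\<close>.\<close>

lemma Hecke_mult_relation:
  fixes A g :: "bit fps"
  assumes p: "p > 0"
    and A: "A = (Q1 oo fps_X ^ p) * P1 + (Q2 oo fps_X ^ p) * P2 + (Q3 oo fps_X ^ p) * P3 + (Q4 oo fps_X ^ p) * P4"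
    and A': "A oo fps_X ^ p = Q1 * (P1 oo fps_X ^ p) + Q2 * (P2 oo fps_X ^ p) + Q3 * (P3 oo fps_X ^ p) + Q4 * (P4 oo fps_X ^ p)"
  shows "Hecke p (A * g) = Q1 * Hecke p (P1 * g) + Q2 * Hecke p (P2 * g) + Q3 * Hecke p (P3 * g) + Q4 * Hecke p (P4 * g)"
proof -
  let ?V = "\<lambda>F. F oo fps_X ^ p"
  let ?S = "\<lambda>F. Hecke p F + ?V F"
  have X0: "(fps_X ^ p :: bit fps) $ 0 = 0" using p by simp
  have Vm: "?V (F * G) = ?V F * ?V G" for F G :: "bit fps" by (rule fps_compose_mult_distrib[OF X0])
  have S: "?S (F + G) = ?S F + ?S G" for F G by (simp add: Hecke_add fps_compose_add_distrib add_ac)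
  have "A * g = ?V Q1 * (P1 * g) + ?V Q2 * (P2 * g) + ?V Q3 * (P3 * g) + ?V Q4 * (P4 * g)"
    by (subst A) (simp add: distrib_right mult.assoc)
  then have "?S (A * g) = Q1 * ?S (P1 * g) + Q2 * ?S (P2 * g) + Q3 * ?S (P3 * g) + Q4 * ?S (P4 * g)"
    by (simp only: S Hecke_section_mult[OF p])
  also have "\<dots> = (Q1 * Hecke p (P1 * g) + Q2 * Hecke p (P2 * g) + Q3 * Hecke p (P3 * g) + Q4 * Hecke p (P4 * g))
      + (Q1 * ?V P1 + Q2 * ?V P2 + Q3 * ?V P3 + Q4 * ?V P4) * ?V g"
    by (simp add: distrib_left distrib_right Vm add_ac mult_ac)
  also have "(Q1 * ?V P1 + Q2 * ?V P2 + Q3 * ?V P3 + Q4 * ?V P4) * ?V g = ?V (A * g)"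
    by (simp only: A'[symmetric] Vm)
  finally show ?thesis by simp
qed

lemma fps_compose_X_power_power: "p > 0 \<Longrightarrow> (F ^ n) oo fps_X ^ p = (F oo fps_X ^ p) ^ n" for F :: "bit fps"
  by (simp add: fps_compose_power)

text \<open>The 2^t-th power of \<open>modular_equation_3\<close>, which Frobenius leaves in the
  same shape. The equation is solved for either fourth power, as \<open>Hecke_mult_relation\<close>
  demands.\<close>

lemma Hecke_3_recurrence:
  "Hecke 3 (Delta ^ (4 * 2 ^ t) * g) =
    Delta ^ (2 ^ t) * Hecke 3 (Delta ^ (2 ^ t) * g) + Delta ^ (4 * 2 ^ t) * Hecke 3 g"
proof -
  let ?D = "Delta ^ (2 ^ t)" and ?E = "(Delta oo fps_X ^ 3) ^ (2 ^ t)"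
  have "(Delta ^ 4 + (Delta oo fps_X ^ 3) ^ 4) ^ (2 ^ t) = (Delta * (Delta oo fps_X ^ 3)) ^ (2 ^ t)"
    by (simp only: modular_equation_3)
  then have eq: "?D ^ 4 + ?E ^ 4 = ?D * ?E"
    by (simp add: bit_fps_add_power2 power_mult_distrib mult.commute flip: power_mult)
  have A: "?D ^ 4 = ?E * ?D + ?E ^ 4" "?E ^ 4 = ?D * ?E + ?D ^ 4"
    unfolding bit_fps_eq_iff[of "?D ^ 4"] bit_fps_eq_iff[of "?E ^ 4"]
    using eq by (simp_all add: ac_simps bit_fps_add_self bit_fps_add_left_self flip: eq)
  have "Hecke 3 (?D ^ 4 * g) = ?D * Hecke 3 (?D * g) + ?D ^ 4 * Hecke 3 (1 * g) + 0 * Hecke 3 (0 * g) + 0 * Hecke 3 (0 * g)"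
  proof (rule Hecke_mult_relation)
    show "?D ^ 4 = (?D oo fps_X ^ 3) * ?D + (?D ^ 4 oo fps_X ^ 3) * 1 + (0 oo fps_X ^ 3) * 0 + (0 oo fps_X ^ 3) * 0"
      by (simp only: fps_compose_X_power_power zero_less_numeral) (simp add: A(1)[symmetric])
    have "?D ^ 4 oo fps_X ^ 3 = ?E ^ 4" by (simp only: fps_compose_X_power_power zero_less_numeral)
    then show "?D ^ 4 oo fps_X ^ 3 = ?D * (?D oo fps_X ^ 3) + ?D ^ 4 * (1 oo fps_X ^ 3) + 0 * (0 oo fps_X ^ 3) + 0 * (0 oo fps_X ^ 3)"
      by (simp only: A(2)) (simp add: fps_compose_X_power_power)
  qed simp
  then show ?thesis by (simp add: mult.commute flip: power_mult)
qed

text \<open>The second relation is derived for its exponents: G^4 F^4 and G^16 are the fourth powers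
  of the terms G F and G^4 of level 3, so the same analysis of leading terms applies, while G^3 F
  and G^8 will turn out to contribute smaller weight only.\<close>

lemma bit_fps_sum_power_6:
  fixes F G :: "bit fps"
  assumes "(F + G) ^ 6 = F * G"
  shows "F ^ 6 = G * F + G ^ 2 * F ^ 4 + G ^ 4 * F ^ 2 + G ^ 6"
    and "F ^ 16 = G ^ 3 * F + G ^ 4 * F ^ 4 + G ^ 8 + G ^ 16"
proof -
  have "(F + G) ^ 6 = (F + G) ^ (2 ^ 1) * (F + G) ^ (2 ^ 2)" by (simp flip: power_add)
  also have "\<dots> = (F ^ 2 + G ^ 2) * (F ^ 4 + G ^ 4)" by (simp only: bit_fps_add_power2) simp
  also have "\<dots> = F ^ 6 + (G ^ 2 * F ^ 4 + G ^ 4 * F ^ 2 + G ^ 6)"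
    by (simp add: algebra_simps flip: power_add)
  finally have "F ^ 6 + (G ^ 2 * F ^ 4 + G ^ 4 * F ^ 2 + G ^ 6) = G * F"
    using assms by (simp add: mult.commute)
  then have "F ^ 6 = G * F + (G ^ 2 * F ^ 4 + G ^ 4 * F ^ 2 + G ^ 6)"
    by (metis bit_fps_add_self add.assoc add.right_neutral)
  then show 6: "F ^ 6 = G * F + G ^ 2 * F ^ 4 + G ^ 4 * F ^ 2 + G ^ 6" by (simp add: add.assoc)
  have "F ^ 8 = F ^ 2 * F ^ 6" by (simp flip: power_add)
  also have "\<dots> = F ^ 2 * (G * F + G ^ 2 * F ^ 4 + G ^ 4 * F ^ 2 + G ^ 6)" by (simp only: 6)
  also have "\<dots> = G * F ^ 3 + G ^ 2 * F ^ 6 + G ^ 4 * F ^ 4 + G ^ 6 * F ^ 2"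
    by (simp add: algebra_simps numeral_eq_Suc)
  also have "\<dots> = G * F ^ 3 + (G ^ 3 * F + G ^ 8)"
    unfolding 6 by (simp add: algebra_simps bit_fps_add_self bit_fps_add_left_self flip: power_add power_Suc)
  \<comment> \<open>Squaring the relation for F^8 by Frobenius brings back F^6, which is eliminated
    once more.\<close>
  finally have "(F ^ 8) ^ (2 ^ 1) = (G * F ^ 3) ^ (2 ^ 1) + ((G ^ 3 * F) ^ (2 ^ 1) + (G ^ 8) ^ (2 ^ 1))"
    by (simp only: bit_fps_add_power2)
  then have "F ^ 16 = G ^ 2 * F ^ 6 + (G ^ 6 * F ^ 2 + G ^ 16)"
    by (simp add: power_mult_distrib flip: power_mult)
  also have "\<dots> = G ^ 3 * F + G ^ 4 * F ^ 4 + G ^ 8 + G ^ 16"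
    unfolding 6 by (simp add: algebra_simps bit_fps_add_self bit_fps_add_left_self flip: power_add power_Suc)
  finally show "F ^ 16 = G ^ 3 * F + G ^ 4 * F ^ 4 + G ^ 8 + G ^ 16" .
qed

lemma Hecke_5_recurrences:
  shows "Hecke 5 (Delta ^ 6 * g) = Delta * Hecke 5 (Delta * g) + Delta ^ 2 * Hecke 5 (Delta ^ 4 * g)
      + Delta ^ 4 * Hecke 5 (Delta ^ 2 * g) + Delta ^ 6 * Hecke 5 g" (is ?six)
    and "Hecke 5 (Delta ^ (16 * 2 ^ t) * g) =
      Delta ^ (3 * 2 ^ t) * Hecke 5 (Delta ^ (2 ^ t) * g) + Delta ^ (4 * 2 ^ t) * Hecke 5 (Delta ^ (4 * 2 ^ t) * g)
      + Delta ^ (8 * 2 ^ t) * Hecke 5 g + Delta ^ (16 * 2 ^ t) * Hecke 5 g" (is ?sixteen)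
proof -
  let ?E = "Delta oo fps_X ^ 5"
  note rel = bit_fps_sum_power_6[OF modular_equation_5]
    bit_fps_sum_power_6[of ?E Delta, unfolded add.commute[of ?E], OF modular_equation_5[unfolded mult.commute[of Delta]]]
  have "Hecke 5 (Delta ^ 6 * g) = Delta * Hecke 5 (Delta * g) + Delta ^ 2 * Hecke 5 (Delta ^ 4 * g)
      + Delta ^ 4 * Hecke 5 (Delta ^ 2 * g) + Delta ^ 6 * Hecke 5 (1 * g)"
  proof (rule Hecke_mult_relation)
    show "Delta ^ 6 = ?E * Delta + (Delta ^ 2 oo fps_X ^ 5) * Delta ^ 4 + (Delta ^ 4 oo fps_X ^ 5) * Delta ^ 2 +
        (Delta ^ 6 oo fps_X ^ 5) * 1"
      by (simp only: fps_compose_X_power_power zero_less_numeral mult_1_right) (rule rel(1))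
    have "Delta ^ 6 oo fps_X ^ 5 = ?E ^ 6" by (simp only: fps_compose_X_power_power zero_less_numeral)
    then show "Delta ^ 6 oo fps_X ^ 5 = Delta * ?E + Delta ^ 2 * (Delta ^ 4 oo fps_X ^ 5) + Delta ^ 4 * (Delta ^ 2 oo fps_X ^ 5)
        + Delta ^ 6 * (1 oo fps_X ^ 5)"
      by (simp only: rel(3)) (simp add: fps_compose_X_power_power)
  qed simp
  then show ?six by simp
  let ?D = "Delta ^ (2 ^ t)" and ?F = "?E ^ (2 ^ t)"
  have pw: "(F ^ i) ^ (2 ^ t) = (F ^ (2 ^ t)) ^ i" for F :: "bit fps" and i by (simp add: mult.commute flip: power_mult)
  have rel2: "?D ^ 16 = ?F ^ 3 * ?D + ?F ^ 4 * ?D ^ 4 + ?F ^ 8 + ?F ^ 16"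
    "?F ^ 16 = ?D ^ 3 * ?F + ?D ^ 4 * ?F ^ 4 + ?D ^ 8 + ?D ^ 16"
    using arg_cong[OF rel(2), of "\<lambda>F. F ^ (2 ^ t)"] arg_cong[OF rel(4), of "\<lambda>F. F ^ (2 ^ t)"]
    by (simp_all only: bit_fps_add_power2 power_mult_distrib pw)
  have "Hecke 5 (?D ^ 16 * g) = ?D ^ 3 * Hecke 5 (?D * g) + ?D ^ 4 * Hecke 5 (?D ^ 4 * g)
      + ?D ^ 8 * Hecke 5 (1 * g) + ?D ^ 16 * Hecke 5 (1 * g)"
  proof (rule Hecke_mult_relation)
    show "?D ^ 16 = (?D ^ 3 oo fps_X ^ 5) * ?D + (?D ^ 4 oo fps_X ^ 5) * ?D ^ 4 + (?D ^ 8 oo fps_X ^ 5) * 1 +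
        (?D ^ 16 oo fps_X ^ 5) * 1"
      by (simp only: fps_compose_X_power_power zero_less_numeral mult_1_right) (rule rel2(1))
    have "?D ^ 16 oo fps_X ^ 5 = ?F ^ 16" by (simp only: fps_compose_X_power_power zero_less_numeral)
    then show "?D ^ 16 oo fps_X ^ 5 = ?D ^ 3 * (?D oo fps_X ^ 5) + ?D ^ 4 * (?D ^ 4 oo fps_X ^ 5)
        + ?D ^ 8 * (1 oo fps_X ^ 5) + ?D ^ 16 * (1 oo fps_X ^ 5)"
      by (simp only: rel2(2)) (simp add: fps_compose_X_power_power)
  qed simp
  then show ?sixteen by (simp add: mult.commute flip: power_mult)
qed

subsection \<open>Initial values\<close>

lemma Hecke_square:
  assumes "odd p"
  shows "Hecke p (F ^ 2) = (Hecke p F) ^ 2"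
proof (rule fps_ext)
  fix n
  have "even (n div p) = even n" if "p dvd n" using assms that by (metis dvd_mult_div_cancel even_mult_iff)
  moreover have "p * n div 2 = p * (n div 2)" if "even n" using that by auto
  moreover have "n div p div 2 = n div 2 div p" by (simp add: div_mult2_eq[symmetric] mult.commute)
  moreover have "p dvd n div 2 \<longleftrightarrow> p dvd n" if "even n"
  proof -
    have "coprime p 2" using assms by simp
    then show ?thesis using that by (metis coprime_dvd_mult_right_iff dvd_mult_div_cancel)
  qed
  ultimately show "Hecke p (F ^ 2) $ n = ((Hecke p F) ^ 2) $ n"
    using assms unfolding bit_fps_square[of F] bit_fps_square[of "Hecke p F"]
    by (simp add: Hecke_nth fps_compose_X_power_nth)
qed

lemma Delta_nth_0: "Delta $ 0 = 0" and Delta_nth_1: "Delta $ Suc 0 = 1"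
  using Delta_nth_mod_8[of 0] by (auto simp: Delta_def intro!: exI[of _ "0::nat"])

lemma Delta_power_nth_below: "n < i \<Longrightarrow> (Delta ^ i) $ n = 0"
  using startsby_zero_power_prefix[OF Delta_nth_0] by simp

lemma Delta_power_nth_self: "(Delta ^ i) $ i = 1"
  using startsby_zero_power_nth_same[OF Delta_nth_0, of i] by (simp add: Delta_nth_1)

text \<open>Since 3^2 and 5^2 are 1 modulo 8, multiplying and dividing an exponent by p agree modulo
  8.\<close>

lemma Hecke_Delta_power_mod_8:
  assumes "p = 3 \<or> p = 5" "Hecke p (Delta ^ i) $ n \<noteq> 0"
  shows "n mod 8 = p * i mod 8"
proof -
  have "(Delta ^ i) $ (p * n) \<noteq> 0 \<or> p dvd n \<and> (Delta ^ i) $ (n div p) \<noteq> 0"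
    using assms(2) by (auto simp: Hecke_nth split: if_splits)
  then have "p * n mod 8 = i mod 8 \<or> (\<exists>l. n = p * l \<and> l mod 8 = i mod 8)"
    using Delta_power_nth_mod_8 assms(1) by fastforce
  moreover have "p * (p * x) mod 8 = x mod 8" for x
  proof -
    have "p * p mod 8 = 1" using assms(1) by auto
    then show ?thesis by (metis mod_mult_left_eq mult.assoc mult_1)
  qed
  ultimately show ?thesis by (metis mod_mult_right_eq)
qed

lemma Hecke_1: "Hecke p 1 = 0" if "p > 0"
  by (rule fps_ext) (use that in \<open>auto simp: Hecke_nth fps_one_nth bit_add_self elim!: dvdE\<close>)

lemma Hecke_Delta_power_expand:
  assumes "p = 3 \<or> p = 5" "odd m"
  obtains c where "Hecke p (Delta ^ m) = (\<Sum>i | i \<le> m \<and> odd i. scaleF2 (c i) (Delta ^ i))"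
  using Hecke_Delta_power[of p m] assms by (auto simp: prime_nat_numeral_eq)

text \<open>Only odd powers up to the given one can occur, so the coefficients at 1, 3 and 5
  determine the result; most of them vanish by their residues modulo 8.\<close>

lemma Hecke_Delta_initial:
  "Hecke 3 Delta = 0" "Hecke 5 Delta = 0" "Hecke 3 (Delta ^ 3) = Delta" "Hecke 5 (Delta ^ 3) = 0"
  "Hecke 5 (Delta ^ 5) = Delta"
proof -
  have s: "{i::nat. i \<le> Suc 0 \<and> odd i} = {Suc 0}" "{i::nat. i \<le> 3 \<and> odd i} = {Suc 0, 3}"
    "{i::nat. i \<le> 5 \<and> odd i} = {Suc 0, 3, 5}"
    by (auto, presburger+)
  have n1: "Hecke p (Delta ^ m) $ 1 = (Delta ^ m) $ p" if "p = 3 \<or> p = 5" for p m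
    using that by (auto simp: Hecke_nth)
  have vals: "Delta $ 3 = 0" "Delta $ 5 = 0" "(Delta ^ 3) $ 5 = 0" "Delta $ 1 = 1"
    by (rule ccontr, drule Delta_nth_mod_8, simp)+
      (rule ccontr, drule Delta_power_nth_mod_8, simp, simp add: Delta_nth_1)
  have one: "Hecke p Delta = 0" if p: "p = 3 \<or> p = 5" for p
  proof -
    obtain c where c: "Hecke p (Delta ^ 1) = (\<Sum>i | i \<le> 1 \<and> odd i. scaleF2 (c i) (Delta ^ i))"
      using Hecke_Delta_power_expand[OF p, of 1] by auto
    have "c 1 = 0" using n1[OF p, of 1] c p vals by (auto simp: s scaleF2_nth)
    then show ?thesis using c by (simp add: s)
  qed
  show "Hecke 3 Delta = 0" "Hecke 5 Delta = 0" by (simp_all add: one)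
  have three: "Hecke p (Delta ^ 3) = (if p = 3 then Delta else 0)" if p: "p = 3 \<or> p = 5" for p
  proof -
    obtain c where c: "Hecke p (Delta ^ 3) = (\<Sum>i | i \<le> 3 \<and> odd i. scaleF2 (c i) (Delta ^ i))"
      using Hecke_Delta_power_expand[OF p, of 3] by auto
    have "Hecke p (Delta ^ 3) $ 3 = 0" using Hecke_Delta_power_mod_8[OF p, of 3 3] p by (intro ccontr[of "_ = 0"]) auto
    then have "c 3 = 0" using c vals Delta_power_nth_self[of 3] by (simp add: s scaleF2_nth)
    moreover have "c 1 = (Delta ^ 3) $ p" using n1[OF p, of 3] c vals Delta_power_nth_below[of 1 3] by (simp add: s scaleF2_nth)
    ultimately show ?thesis using c vals Delta_power_nth_self[of 3] p by (auto simp: s)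
  qed
  show "Hecke 3 (Delta ^ 3) = Delta" "Hecke 5 (Delta ^ 3) = 0" by (simp_all add: three)
  obtain c where c: "Hecke 5 (Delta ^ 5) = (\<Sum>i | i \<le> 5 \<and> odd i. scaleF2 (c i) (Delta ^ i))"
    using Hecke_Delta_power_expand[of 5 5] by auto
  have "Hecke 5 (Delta ^ 5) $ 3 = 0" "Hecke 5 (Delta ^ 5) $ 5 = 0"
    by (rule ccontr, drule Hecke_Delta_power_mod_8[rotated], simp, simp)+
  moreover have "c 1 = 1" using n1[of 5 5] c vals Delta_power_nth_below[of 1 5] Delta_power_nth_below[of 1 3] Delta_power_nth_self[of 5]
    by (simp add: s scaleF2_nth)
  ultimately have "c 3 = 0" "c 5 = 0" using c vals Delta_power_nth_self[of 3] Delta_power_nth_self[of 5] Delta_power_nth_below[of 3 5]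
    by (simp_all add: s scaleF2_nth)
  then show "Hecke 5 (Delta ^ 5) = Delta" using c \<open>c 1 = 1\<close> by (simp add: s)
qed

lemma Hecke_5_step:
  "Hecke 5 (Delta ^ (j + 6)) = Delta * Hecke 5 (Delta ^ (j + 1)) + Delta ^ 2 * Hecke 5 (Delta ^ (j + 4))
    + Delta ^ 4 * Hecke 5 (Delta ^ (j + 2)) + Delta ^ 6 * Hecke 5 (Delta ^ j)"
proof -
  have e: "Delta ^ (j + 6) = Delta ^ 6 * Delta ^ j" "Delta ^ (j + 4) = Delta ^ 4 * Delta ^ j"
    "Delta ^ (j + 2) = Delta ^ 2 * Delta ^ j" "Delta ^ (j + 1) = Delta * Delta ^ j"
    by (simp_all only: power_add power_one_right mult.commute)
  show ?thesis unfolding e by (rule Hecke_5_recurrences(1))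
qed

lemma Hecke_even_initial: "Hecke 3 (Delta ^ 2) = 0" "Hecke 5 (Delta ^ 2) = 0" "Hecke 3 (Delta ^ 4) = 0" "Hecke 5 (Delta ^ 4) = 0"
proof -
  show 2: "Hecke 3 (Delta ^ 2) = 0" "Hecke 5 (Delta ^ 2) = 0" by (simp_all add: Hecke_square Hecke_Delta_initial)
  have "Delta ^ 4 = (Delta ^ 2) ^ 2" by (simp flip: power_mult)
  then show "Hecke 3 (Delta ^ 4) = 0" "Hecke 5 (Delta ^ 4) = 0"
    using Hecke_square[of 3 "Delta ^ 2"] Hecke_square[of 5 "Delta ^ 2"] 2 by simp_all
qed

lemma Hecke_3_small: "Hecke 3 (Delta ^ 5) = 0" "Hecke 3 (Delta ^ 7) = Delta ^ 5"
proof -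
  have "Hecke 3 (Delta ^ 4 * Delta ^ j) = Delta * Hecke 3 (Delta * Delta ^ j) + Delta ^ 4 * Hecke 3 (Delta ^ j)" for j
    using Hecke_3_recurrence[of 0 "Delta ^ j"] by simp
  from this[of 1] this[of 3] show "Hecke 3 (Delta ^ 5) = 0" "Hecke 3 (Delta ^ 7) = Delta ^ 5"
    using Hecke_Delta_initial Hecke_even_initial
    by (simp_all flip: power_add power_Suc power_Suc2 power2_eq_square)
qed

text \<open>With \<open>Hecke_Delta_initial\<close> these are the cases k < 16 of
  \<open>Hecke_5_leads\<close>, whose recurrence starts at \<Delta>^32. The recurrence of order 6
  mixes parities, so even powers are computed along the way.\<close>

lemma Hecke_5_small:
  "Hecke 5 (Delta ^ 7) = Delta ^ 3"
  "Hecke 5 (Delta ^ 9) = 0"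
  "Hecke 5 (Delta ^ 11) = 0"
  "Hecke 5 (Delta ^ 13) = Delta ^ 9"
  "Hecke 5 (Delta ^ 15) = Delta ^ 3 + Delta ^ 11"
  "Hecke 5 (Delta ^ 17) = Delta ^ 5"
  "Hecke 5 (Delta ^ 19) = Delta ^ 7"
  "Hecke 5 (Delta ^ 21) = Delta ^ 9 + Delta ^ 17"
  "Hecke 5 (Delta ^ 23) = Delta ^ 11 + Delta ^ 19"
  "Hecke 5 (Delta ^ 25) = Delta ^ 5 + Delta ^ 13"
  "Hecke 5 (Delta ^ 27) = Delta ^ 7 + Delta ^ 15"
  "Hecke 5 (Delta ^ 29) = Delta ^ 17 + Delta ^ 25"
  "Hecke 5 (Delta ^ 31) = Delta ^ 27"
proof -
  have v0: "Hecke 5 1 = 0" and v1: "Hecke 5 Delta = 0" by (simp_all add: Hecke_1 Hecke_Delta_initial)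
  note v2 = Hecke_even_initial(2) and v3 = Hecke_Delta_initial(4) and v4 = Hecke_even_initial(4) and v5 = Hecke_Delta_initial(5)
  note norm = distrib_left power_add[symmetric] power_Suc[symmetric] power_Suc2[symmetric] power2_eq_square[symmetric]
    bit_fps_add_self bit_fps_add_left_self add.assoc
  have v6: "Hecke 5 (Delta ^ 6) = 0"
    using Hecke_5_step[of 0] by (simp add: v1 v4 v2 v0 norm add.commute add.left_commute)
  show v7: "Hecke 5 (Delta ^ 7) = Delta ^ 3"
    using Hecke_5_step[of 1] by (simp add: v2 v5 v3 v1 norm add.commute add.left_commute)
  have v8: "Hecke 5 (Delta ^ 8) = 0"
    using Hecke_5_step[of 2] by (simp add: v3 v6 v4 v2 norm add.commute add.left_commute)
  show v9: "Hecke 5 (Delta ^ 9) = 0"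
    using Hecke_5_step[of 3] by (simp add: v4 v7 v5 v3 norm add.commute add.left_commute)
  have v10: "Hecke 5 (Delta ^ 10) = Delta ^ 2"
    using Hecke_5_step[of 4] by (simp add: v5 v8 v6 v4 norm add.commute add.left_commute)
  show v11: "Hecke 5 (Delta ^ 11) = 0"
    using Hecke_5_step[of 5] by (simp add: v6 v9 v7 v5 norm add.commute add.left_commute)
  have v12: "Hecke 5 (Delta ^ 12) = 0"
    using Hecke_5_step[of 6] by (simp add: v7 v10 v8 v6 norm add.commute add.left_commute)
  show v13: "Hecke 5 (Delta ^ 13) = Delta ^ 9"
    using Hecke_5_step[of 7] by (simp add: v8 v11 v9 v7 norm add.commute add.left_commute)
  have v14: "Hecke 5 (Delta ^ 14) = Delta ^ 6"
    using Hecke_5_step[of 8] by (simp add: v9 v12 v10 v8 norm add.commute add.left_commute)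
  show v15: "Hecke 5 (Delta ^ 15) = Delta ^ 3 + Delta ^ 11"
    using Hecke_5_step[of 9] by (simp add: v10 v13 v11 v9 norm add.commute add.left_commute)
  have v16: "Hecke 5 (Delta ^ 16) = 0"
    using Hecke_5_step[of 10] by (simp add: v11 v14 v12 v10 norm add.commute add.left_commute)
  show v17: "Hecke 5 (Delta ^ 17) = Delta ^ 5"
    using Hecke_5_step[of 11] by (simp add: v12 v15 v13 v11 norm add.commute add.left_commute)
  have v18: "Hecke 5 (Delta ^ 18) = 0"
    using Hecke_5_step[of 12] by (simp add: v13 v16 v14 v12 norm add.commute add.left_commute)
  show v19: "Hecke 5 (Delta ^ 19) = Delta ^ 7"
    using Hecke_5_step[of 13] by (simp add: v14 v17 v15 v13 norm add.commute add.left_commute)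
  have v20: "Hecke 5 (Delta ^ 20) = Delta ^ 4"
    using Hecke_5_step[of 14] by (simp add: v15 v18 v16 v14 norm add.commute add.left_commute)
  show v21: "Hecke 5 (Delta ^ 21) = Delta ^ 9 + Delta ^ 17"
    using Hecke_5_step[of 15] by (simp add: v16 v19 v17 v15 norm add.commute add.left_commute)
  have v22: "Hecke 5 (Delta ^ 22) = 0"
    using Hecke_5_step[of 16] by (simp add: v17 v20 v18 v16 norm add.commute add.left_commute)
  show v23: "Hecke 5 (Delta ^ 23) = Delta ^ 11 + Delta ^ 19"
    using Hecke_5_step[of 17] by (simp add: v18 v21 v19 v17 norm add.commute add.left_commute)
  have v24: "Hecke 5 (Delta ^ 24) = 0"
    using Hecke_5_step[of 18] by (simp add: v19 v22 v20 v18 norm add.commute add.left_commute)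
  show v25: "Hecke 5 (Delta ^ 25) = Delta ^ 5 + Delta ^ 13"
    using Hecke_5_step[of 19] by (simp add: v20 v23 v21 v19 norm add.commute add.left_commute)
  have v26: "Hecke 5 (Delta ^ 26) = Delta ^ 18"
    using Hecke_5_step[of 20] by (simp add: v21 v24 v22 v20 norm add.commute add.left_commute)
  show v27: "Hecke 5 (Delta ^ 27) = Delta ^ 7 + Delta ^ 15"
    using Hecke_5_step[of 21] by (simp add: v22 v25 v23 v21 norm add.commute add.left_commute)
  show v29: "Hecke 5 (Delta ^ 29) = Delta ^ 17 + Delta ^ 25"
    using Hecke_5_step[of 23] by (simp add: v24 v27 v25 v23 norm add.commute add.left_commute)
  show v31: "Hecke 5 (Delta ^ 31) = Delta ^ 27"
    using Hecke_5_step[of 25] by (simp add: v26 v29 v27 v25 norm add.commute add.left_commute)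
qed

section \<open>Leading terms of the Hecke operators at 3 and 5\<close>

definition odd_power :: "nat \<Rightarrow> bit fps" where
  "odd_power k = Delta ^ (2 * k + 1)"

text \<open>With truncated subtraction \<open>low (n - c)\<close> is {0} once c \<ge> n, so lowering
  the weight repeatedly ends in 0.\<close>

definition low :: "nat \<Rightarrow> bit fps set" where
  "low n = scaleF2.span (odd_power ` {k. weight k < n})"

lemma low_0 [simp]: "low 0 = {0}"
  by (simp add: low_def)

lemma low_zero [simp]: "0 \<in> low n"
  by (simp add: low_def scaleF2.span_zero)

lemma low_add: "f \<in> low n \<Longrightarrow> g \<in> low n \<Longrightarrow> f + g \<in> low n"
  unfolding low_def by (rule scaleF2.span_add)

lemma low_mono: "m \<le> n \<Longrightarrow> f \<in> low m \<Longrightarrow> f \<in> low n"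
  unfolding low_def by (erule subsetD[OF scaleF2.span_mono, rotated]) auto

lemma odd_power_low: "weight k < n \<Longrightarrow> odd_power k \<in> low n"
  unfolding low_def by (rule scaleF2.span_base) auto

lemma odd_power_mult: "Delta ^ (2 * i) * odd_power k = odd_power (i + k)"
  by (simp add: odd_power_def distrib_left flip: power_add power_Suc)

lemma low_mult: "f \<in> low (n - c) \<Longrightarrow> Delta ^ (2 * i) * f \<in> low (n + weight i - c)"
  unfolding low_def[of "n - c"]
proof (induction rule: scaleF2.span_induct_alt)
  case (step a x y)
  then obtain k where k: "x = odd_power k" "weight k < n - c" by auto
  have "weight (i + k) < n + weight i - c" using k(2) weight_add[of i k] by linarith
  then have "scaleF2 a (odd_power (i + k)) \<in> low (n + weight i - c)"
    using odd_power_low unfolding low_def by (intro scaleF2.span_scale) auto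
  moreover have "Delta ^ (2 * i) * (scaleF2 a x + y) = scaleF2 a (odd_power (i + k)) + Delta ^ (2 * i) * y"
    by (simp add: k(1) odd_power_mult[symmetric] scaleF2_def algebra_simps)
  ultimately show ?case using step(2) by (simp add: low_add)
qed simp

text \<open>In characteristic 2 the sum is a difference: the transform agrees with its leading term,
  or with 0 if there is nothing to lower, modulo forms of weight below
  \<open>weight k - c\<close>.\<close>

definition leads :: "nat \<Rightarrow> (nat \<Rightarrow> nat) \<Rightarrow> (nat \<Rightarrow> nat) \<Rightarrow> nat \<Rightarrow> nat \<Rightarrow> bool" where
  "leads p C P c k \<longleftrightarrow> Hecke p (odd_power k) + (if C k > 0 then odd_power (P k) else 0) \<in> low (weight k - c)"

text \<open>The transforms at u + m and at m are split into leading term and error. The errors stay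
  low after multiplication because the weight is subadditive; the two leading terms combine to that
  of 4 u + m by \<open>lead_rule\<close>.\<close>

lemma leads_step:
  assumes rec: "Hecke p (odd_power (4 * u + m)) + Delta ^ (2 * u) * Hecke p (odd_power (u + m))
      + Delta ^ (2 * (4 * u)) * Hecke p (odd_power m) \<in> low (weight (4 * u + m) - c)"
    and rule: "lead_rule C P c q u m" and pos: "C (4 * u + m) > 0 \<longleftrightarrow> q \<or> C m > 0"
    and w: "weight (4 * u + m) = 2 * weight u + weight m"
    and m: "leads p C P c m" and um: "leads p C P c (u + m)"
  shows "leads p C P c (4 * u + m)"
proof -
  let ?k = "4 * u + m"
  let ?L = "\<lambda>k. if C k > 0 then odd_power (P k) else 0"
  let ?T = "\<lambda>k. Hecke p (odd_power k)"
  have 1: "Delta ^ (2 * (4 * u)) * (?T m + ?L m) \<in> low (weight ?k - c)"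
    by (rule low_mono[OF _ low_mult[OF m[unfolded leads_def], of "4 * u"]]) (simp add: w)
  have 2: "Delta ^ (2 * u) * (?T (u + m) + ?L (u + m)) \<in> low (weight ?k - c)"
  proof (rule low_mono[OF _ low_mult[OF um[unfolded leads_def]]])
    show "weight (u + m) + weight u - c \<le> weight (4 * u + m) - c"
      using weight_add[of u m] by (simp add: w)
  qed
  have 3: "?L ?k + (Delta ^ (2 * u) * ?L (u + m) + Delta ^ (2 * (4 * u)) * ?L m) \<in> low (weight ?k - c)"
  proof (cases "C m > 0")
    case True
    then have "P ?k = 4 * u + P m" "C ?k > 0" using rule pos by (auto simp: lead_rule_def)
    then have "?L ?k = Delta ^ (2 * (4 * u)) * ?L m" using True by (simp only: if_True odd_power_mult)
    moreover have "Delta ^ (2 * u) * ?L (u + m) \<in> low (weight ?k - c)"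
    proof (cases "C (u + m) > 0")
      case True2: True
      then have "weight (u + P (u + m)) + c < weight ?k" using rule True by (simp add: lead_rule_def)
      then show ?thesis using odd_power_low[of "u + P (u + m)"] True2 by (simp add: odd_power_mult)
    qed simp
    ultimately show ?thesis by (simp only: add.left_commute[of _ "Delta ^ (2 * u) * _"] bit_fps_add_self add_0_right)
  next
    case False
    show ?thesis
    proof (cases q)
      case True
      then have "C (u + m) > 0" "P ?k = u + P (u + m)" "C ?k > 0" using rule pos False by (auto simp: lead_rule_def)
      then show ?thesis using False by (simp only: if_True if_False odd_power_mult mult_zero_right bit_fps_add_self add_0_right low_zero)
    next
      case nq: False
      have "Delta ^ (2 * u) * ?L (u + m) \<in> low (weight ?k - c)"
      proof (cases "C (u + m) > 0")
        case True2: True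
        then have "weight (u + P (u + m)) + c < weight ?k" using rule nq by (simp add: lead_rule_def)
        then show ?thesis using odd_power_low[of "u + P (u + m)"] True2 by (simp add: odd_power_mult)
      qed simp
      then show ?thesis using pos nq False by simp
    qed
  qed
  have "?T ?k + ?L ?k = (?T ?k + Delta ^ (2 * u) * ?T (u + m) + Delta ^ (2 * (4 * u)) * ?T m)
     + (Delta ^ (2 * (4 * u)) * (?T m + ?L m)) + (Delta ^ (2 * u) * (?T (u + m) + ?L (u + m)))
     + (?L ?k + (Delta ^ (2 * u) * ?L (u + m) + Delta ^ (2 * (4 * u)) * ?L m))"
    by (simp only: distrib_left add.assoc add.commute add.left_commute bit_fps_add_self bit_fps_add_left_self add_0_right)
  then show ?thesis unfolding leads_def using low_add[OF low_add[OF low_add[OF rec 1] 2] 3] by (simp only:)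
qed

lemma leads_low:
  assumes "leads p C P c k" "C k > 0 \<Longrightarrow> weight (P k) + c = weight k"
  shows "Hecke p (odd_power k) \<in> low (weight k + 1 - c)"
proof -
  let ?L = "if C k > 0 then odd_power (P k) else 0"
  have "Hecke p (odd_power k) + ?L \<in> low (weight k + 1 - c)"
    by (rule low_mono[OF _ assms(1)[unfolded leads_def]]) simp
  moreover have "?L \<in> low (weight k + 1 - c)"
    using assms(2) by (auto intro!: odd_power_low)
  ultimately have "(Hecke p (odd_power k) + ?L) + ?L \<in> low (weight k + 1 - c)" by (rule low_add)
  then show ?thesis by (simp only: add.assoc bit_fps_add_self add_0_right)
qed

text \<open>The summand 4 * 2^r is the top binary digit of k; for k \<ge> 4 its quarter is again a
  power of 2, as the recurrences need.\<close>

lemma top_decomposition: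
  assumes "k \<ge> (4::nat)"
  obtains r m where "k = 4 * 2 ^ r + m" "m < 4 * 2 ^ r"
proof -
  obtain n where n: "2 ^ n \<le> k" "k < 2 ^ (n + 1)" using ex_power_ivl1[of 2 k] assms by auto
  then have "(2::nat) ^ 2 < 2 ^ (n + 1)" using assms by simp
  then have "2 < n + 1" by (rule power_less_imp_less_exp[rotated]) simp
  then obtain l where "n = 2 + l" by (metis less_Suc_eq_le le_Suc_ex Suc_eq_plus1)
  then have "2 ^ n = 4 * (2::nat) ^ (n - 2)" by (simp add: power_add)
  with n that[of "n - 2" "k - 2 ^ n"] show ?thesis by simp
qed

lemma pow2_cases:
  obtains s where "(2::nat) ^ r = pow4 s" "even r" | s where "(2::nat) ^ r = 2 * pow4 s" "odd r"
  by (cases "even r") (auto elim!: evenE oddE simp: pow4_def power_mult)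

lemma weight_pow2_top: "m < 4 * 2 ^ r \<Longrightarrow> weight (4 * 2 ^ r + m) = 2 * weight (2 ^ r) + weight m"
  by (rule pow2_cases[of r]) (use weight_top[of m] weight_pow4 in \<open>auto simp: mult.assoc[symmetric]\<close>)

theorem Hecke_3_leads: "leads 3 code3 pred3 2 k"
proof (induction k rule: less_induct)
  case (less k)
  show ?case
  proof (cases "k < 4")
    case True
    then have "k = 0 \<or> k = 1 \<or> k = 2 \<or> k = 3" by linarith
    then show ?thesis
      using Hecke_Delta_initial Hecke_3_small
      by (elim disjE; simp add: leads_def odd_power_def pred3_def small_codes weight_def bit_fps_add_self)
  next
    case False
    then obtain r m where k: "k = 4 * 2 ^ r + m" "m < 4 * 2 ^ r" using top_decomposition[of k] by auto
    let ?u = "2 ^ r :: nat"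
    \<comment> \<open>The index k stands for the exponent 2 k + 1, so the recurrence is taken one
      squaring higher, at \<open>Suc r\<close>.\<close>
    have e: "Delta ^ (2 ^ Suc r) = Delta ^ (2 * ?u)" "Delta ^ (4 * 2 ^ Suc r) = Delta ^ (2 * (4 * ?u))"
      by (simp_all add: mult_ac)
    have "Hecke 3 (odd_power (4 * ?u + m)) + Delta ^ (2 * ?u) * Hecke 3 (odd_power (?u + m))
        + Delta ^ (2 * (4 * ?u)) * Hecke 3 (odd_power m) = 0"
      using Hecke_3_recurrence[of "Suc r" "odd_power m"] unfolding e odd_power_mult
      by (simp only: add.assoc add.commute add.left_commute bit_fps_add_self bit_fps_add_left_self add_0_right)
    then have rec: "Hecke 3 (odd_power (4 * ?u + m)) + Delta ^ (2 * ?u) * Hecke 3 (odd_power (?u + m))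
        + Delta ^ (2 * (4 * ?u)) * Hecke 3 (odd_power m) \<in> low (weight (4 * ?u + m) - 2)"
      by (simp only: low_zero)
    have "\<exists>q. lead_rule code3 pred3 2 q ?u m \<and> (code3 (4 * ?u + m) > 0 \<longleftrightarrow> q \<or> code3 m > 0)"
    proof (rule pow2_cases[of r])
      fix s assume "?u = pow4 s"
      then show ?thesis
        using lead_rule_code3(1)[of m s] code_top(1)[of m "Suc s"] k(2) by (intro exI[of _ True]) (simp add: pow4_simps)
    next
      fix s assume "?u = 2 * pow4 s"
      then show ?thesis
        using lead_rule_code3(2)[of m s] code_top(2)[of m "Suc s"] k(2) by (intro exI[of _ False]) (simp add: pow4_simps)
    qed
    then obtain q where q: "lead_rule code3 pred3 2 q ?u m \<and> (code3 (4 * ?u + m) > 0 \<longleftrightarrow> q \<or> code3 m > 0)" ..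
    have lt: "m < k" "?u + m < k" by (simp_all add: k(1))
    show ?thesis unfolding k(1)
      by (rule leads_step[OF rec conjunct1[OF q] conjunct2[OF q] weight_pow2_top[OF k(2)] less[OF lt(1)] less[OF lt(2)]])
  qed
qed

lemma Delta_power_low: "odd n \<Longrightarrow> weight (n div 2) < l \<Longrightarrow> Delta ^ n \<in> low l"
  using odd_power_low[of "n div 2" l] by (simp add: odd_power_def)

text \<open>The induction is that of \<open>Hecke_3_leads\<close> with the relation of degree 16.
  Its middle exponent u is four times a power w of 2, which needs r \<ge> 2; hence all k < 16 are
  checked separately.\<close>

theorem Hecke_5_leads: "leads 5 code5 pred5 3 k"
proof (induction k rule: less_induct)
  case (less k)
  show ?case
  proof (cases "k < 16")
    case True
    then have "k = 0 \<or> k = 1 \<or> k = 2 \<or> k = 3 \<or> k = 4 \<or> k = 5 \<or> k = 6 \<or> k = 7 \<or>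
      k = 8 \<or> k = 9 \<or> k = 10 \<or> k = 11 \<or> k = 12 \<or> k = 13 \<or> k = 14 \<or> k = 15" by presburger
    then show ?thesis
      using Hecke_Delta_initial Hecke_5_small
      by (elim disjE; simp add: leads_def odd_power_def pred5_def small_codes weight_def
          bit_fps_add_self bit_fps_2 Delta_power_low)
  next
    case False
    then obtain r m where k: "k = 4 * 2 ^ r + m" "m < 4 * 2 ^ r" using top_decomposition[of k] by auto
    have "\<not> r < 2"
    proof
      assume "r < 2"
      then have "r = 0 \<or> r = 1" by linarith
      then show False using k False by auto
    qed
    then obtain t where t: "r = 2 + t" by (metis le_Suc_ex not_less)
    let ?u = "2 ^ r :: nat" and ?w = "2 ^ t :: nat"
    have u: "?u = 4 * ?w" by (simp add: t power_add)
    have e: "Delta ^ (2 ^ Suc t) = Delta ^ (2 * ?w)" "Delta ^ (3 * 2 ^ Suc t) = Delta ^ (2 * (3 * ?w))"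
      "Delta ^ (4 * 2 ^ Suc t) = Delta ^ (2 * ?u)" "Delta ^ (8 * 2 ^ Suc t) = Delta ^ (2 * (2 * ?u))"
      "Delta ^ (16 * 2 ^ Suc t) = Delta ^ (2 * (4 * ?u))"
      by (simp_all add: mult_ac u)
    have w2: "weight (2 * ?w) + 1 \<le> 2 * weight ?w"
    proof (rule pow2_cases[of t])
      fix s assume "?w = pow4 s"
      then show ?thesis using weight_pow4[of s] by (simp only:) simp
    next
      fix s assume w: "?w = 2 * pow4 s"
      have "2 * (2 * pow4 s) = pow4 (Suc s)" by (simp add: pow4_simps)
      then have "weight (2 * (2 * pow4 s)) = 4 * 2 ^ s" using weight_pow4(1)[of "Suc s"] by simp
      then show ?thesis unfolding w using weight_pow4(2)[of s] zero_less_power[of "2::nat" s] by linarith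
    qed
    have W: "weight (4 * ?u + m) = 4 * weight ?w + weight m"
      using weight_pow2_top[OF k(2)] by (simp add: u)
    have low: "Hecke 5 (odd_power j) \<in> low (weight j + 1 - 3)" if "j < k" for j
      by (rule leads_low[OF less[OF that] weight_pred5])
    have lt: "?w + m < k" "m < k" "?u + m < k" using u by (simp_all add: k(1))
    have 1: "Delta ^ (2 * (3 * ?w)) * Hecke 5 (odd_power (?w + m)) \<in> low (weight (4 * ?u + m) - 3)"
    proof (rule low_mono[OF _ low_mult[OF low[OF lt(1)]]])
      have "weight (3 * ?w) \<le> weight (2 * ?w) + weight ?w" using weight_add[of "2 * ?w" ?w] by simp
      then show "weight (?w + m) + 1 + weight (3 * ?w) - 3 \<le> weight (4 * ?u + m) - 3"
        using weight_add[of ?w m] w2 unfolding W by linarith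
    qed
    have 2: "Delta ^ (2 * (2 * ?u)) * Hecke 5 (odd_power m) \<in> low (weight (4 * ?u + m) - 3)"
    proof (rule low_mono[OF _ low_mult[OF low[OF lt(2)]]])
      have "weight (2 * ?u) = 2 * weight (2 * ?w)" using weight_digits(1)[of "2 * ?w"] by (simp add: u)
      then show "weight m + 1 + weight (2 * ?u) - 3 \<le> weight (4 * ?u + m) - 3"
        using w2 unfolding W by linarith
    qed
    have "Hecke 5 (odd_power (4 * ?u + m)) + Delta ^ (2 * ?u) * Hecke 5 (odd_power (?u + m))
        + Delta ^ (2 * (4 * ?u)) * Hecke 5 (odd_power m)
      = Delta ^ (2 * (3 * ?w)) * Hecke 5 (odd_power (?w + m)) + Delta ^ (2 * (2 * ?u)) * Hecke 5 (odd_power m)"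
      using Hecke_5_recurrences(2)[of "Suc t" "odd_power m"] unfolding e odd_power_mult
      by (simp only: add.assoc add.commute add.left_commute bit_fps_add_self bit_fps_add_left_self add_0_right)
    then have rec: "Hecke 5 (odd_power (4 * ?u + m)) + Delta ^ (2 * ?u) * Hecke 5 (odd_power (?u + m))
        + Delta ^ (2 * (4 * ?u)) * Hecke 5 (odd_power m) \<in> low (weight (4 * ?u + m) - 3)"
      using low_add[OF 1 2] by (simp only:)
    have "\<exists>q. lead_rule code5 pred5 3 q ?u m \<and> (code5 (4 * ?u + m) > 0 \<longleftrightarrow> q \<or> code5 m > 0)"
    proof (rule pow2_cases[of r])
      fix s assume "?u = pow4 s"
      then show ?thesis
        using lead_rule_code5(1)[of m s] code_top(1)[of m "Suc s"] k(2) by (intro exI[of _ False]) (simp add: pow4_simps)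
    next
      fix s assume "?u = 2 * pow4 s"
      then show ?thesis
        using lead_rule_code5(2)[of m s] code_top(2)[of m "Suc s"] k(2) by (intro exI[of _ True]) (simp add: pow4_simps)
    qed
    then obtain q where q: "lead_rule code5 pred5 3 q ?u m \<and> (code5 (4 * ?u + m) > 0 \<longleftrightarrow> q \<or> code5 m > 0)" ..
    show ?thesis unfolding k(1)
      by (rule leads_step[OF rec conjunct1[OF q] conjunct2[OF q] weight_pow2_top[OF k(2)] less[OF lt(2)] less[OF lt(3)]])
  qed
qed

section \<open>Power series in the Hecke operators\<close>

lemma leads_imp_low:
  assumes "\<And>k. leads p C P c k" "\<And>k. C k > 0 \<Longrightarrow> weight (P k) + c = weight k" and f: "f \<in> low n"
  shows "Hecke p f \<in> low (n - c)"
  using f unfolding low_def[of n]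
proof (induction rule: scaleF2.span_induct_alt)
  case (step a x y)
  then obtain k where k: "x = odd_power k" "weight k < n" by auto
  have "Hecke p x \<in> low (n - c)"
    unfolding k(1) by (rule low_mono[OF _ leads_low[OF assms(1,2)]]) (use k(2) in auto)
  then have "scaleF2 a (Hecke p x) \<in> low (n - c)" unfolding low_def by (rule scaleF2.span_scale)
  then show ?case using step(2) by (simp add: Hecke_add Hecke_scale low_add)
qed (simp add: Hecke_0)

lemma Hecke_3_low: "f \<in> low n \<Longrightarrow> Hecke 3 f \<in> low (n - 2)"
  by (rule leads_imp_low[OF Hecke_3_leads weight_pred3])

lemma Hecke_5_low: "f \<in> low n \<Longrightarrow> Hecke 5 f \<in> low (n - 3)"
  by (rule leads_imp_low[OF Hecke_5_leads weight_pred5])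

lemma Hecke_3_pow_low: "f \<in> low n \<Longrightarrow> (Hecke 3 ^^ i) f \<in> low (n - 2 * i)"
  by (induction i) (use Hecke_3_low in \<open>fastforce simp: diff_diff_add add.commute\<close>)+

lemma Hecke_5_pow_low: "f \<in> low n \<Longrightarrow> (Hecke 5 ^^ i) f \<in> low (n - 3 * i)"
  by (induction i) (use Hecke_5_low in \<open>fastforce simp: diff_diff_add add.commute\<close>)+

lemma Hecke_pow_add: "(Hecke p ^^ i) (f + g) = (Hecke p ^^ i) f + (Hecke p ^^ i) g"
  by (induction i) (simp_all add: Hecke_add)

lemma Hecke_pow_0: "(Hecke p ^^ i) 0 = 0"
  by (induction i) (simp_all add: Hecke_0)

lemma Hecke_pow_scale: "(Hecke p ^^ i) (scaleF2 c f) = scaleF2 c ((Hecke p ^^ i) f)"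
  by (induction i) (simp_all add: Hecke_scale)

lemma Hecke_5_pow_lead:
  "(Hecke 5 ^^ j) (odd_power (enc a b)) + (if j \<le> b then odd_power (enc a (b - j)) else 0) \<in> low (2 * a + 3 * b - 3 * j)"
proof (induction j)
  case (Suc j)
  let ?x = "(Hecke 5 ^^ j) (odd_power (enc a b))" and ?L = "if j \<le> b then odd_power (enc a (b - j)) else 0"
  let ?L' = "if Suc j \<le> b then odd_power (enc a (b - Suc j)) else 0"
  have "Hecke 5 (?x + ?L) \<in> low (2 * a + 3 * b - 3 * Suc j)"
    by (rule low_mono[OF _ Hecke_5_low[OF Suc]]) simp
  moreover have "Hecke 5 ?L + ?L' \<in> low (2 * a + 3 * b - 3 * Suc j)"
  proof (cases "j \<le> b")
    case True
    have "weight (enc a (b - j)) - 3 \<le> 2 * a + 3 * b - 3 * Suc j" using True by simp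
    moreover have "(0 < b - j) = (Suc j \<le> b)" by auto
    moreover have "Hecke 5 (odd_power (enc a (b - j))) + (if 0 < b - j then odd_power (enc a (b - j - 1)) else 0)
        \<in> low (weight (enc a (b - j)) - 3)"
      using Hecke_5_leads[of "enc a (b - j)"] by (simp only: leads_def pred5_def code_enc)
    ultimately show ?thesis
      using True by (simp only: if_True diff_Suc_eq_diff_pred diff_commute[of _ 1] diff_diff_left add_Suc_right add_0_right plus_1_eq_Suc Suc_eq_plus1) (erule (1) low_mono)
  qed (auto simp: Hecke_0)
  ultimately have "Hecke 5 (?x + ?L) + (Hecke 5 ?L + ?L') \<in> low (2 * a + 3 * b - 3 * Suc j)" by (rule low_add)
  then show ?case by (simp only: Hecke_add add.assoc bit_fps_add_left_self funpow.simps o_apply)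
qed (simp add: bit_fps_add_self)

lemma Hecke_3_5_pow_lead:
  "(Hecke 3 ^^ i) ((Hecke 5 ^^ j) (odd_power (enc a b))) + (if i \<le> a \<and> j \<le> b then odd_power (enc (a - i) (b - j)) else 0)
    \<in> low (2 * a + 3 * b - (2 * i + 3 * j))"
proof (induction i)
  case 0
  show ?case using Hecke_5_pow_lead[of j a b] by (cases "j \<le> b") simp_all
next
  case (Suc i)
  let ?x = "(Hecke 3 ^^ i) ((Hecke 5 ^^ j) (odd_power (enc a b)))"
  let ?L = "if i \<le> a \<and> j \<le> b then odd_power (enc (a - i) (b - j)) else 0"
  let ?L' = "if Suc i \<le> a \<and> j \<le> b then odd_power (enc (a - Suc i) (b - j)) else 0"
  have "Hecke 3 (?x + ?L) \<in> low (2 * a + 3 * b - (2 * Suc i + 3 * j))"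
    by (rule low_mono[OF _ Hecke_3_low[OF Suc]]) simp
  moreover have "Hecke 3 ?L + ?L' \<in> low (2 * a + 3 * b - (2 * Suc i + 3 * j))"
  proof (cases "i \<le> a \<and> j \<le> b")
    case True
    then obtain x y where "a = i + x" "b = j + y" by (auto simp: le_iff_add)
    then have "weight (enc (a - i) (b - j)) - 2 \<le> 2 * a + 3 * b - (2 * Suc i + 3 * j)" by simp
    moreover have "Hecke 3 (odd_power (enc (a - i) (b - j))) + (if 0 < a - i then odd_power (enc (a - i - 1) (b - j)) else 0)
        \<in> low (weight (enc (a - i) (b - j)) - 2)"
      using Hecke_3_leads[of "enc (a - i) (b - j)"] by (simp only: leads_def pred3_def code_enc)
    moreover have "?L = odd_power (enc (a - i) (b - j))" "?L' = (if 0 < a - i then odd_power (enc (a - i - 1) (b - j)) else 0)"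
      using True by auto
    ultimately show ?thesis by (simp only: low_mono)
  qed (auto simp: Hecke_0)
  ultimately have "Hecke 3 (?x + ?L) + (Hecke 3 ?L + ?L') \<in> low (2 * a + 3 * b - (2 * Suc i + 3 * j))" by (rule low_add)
  then show ?case by (simp only: Hecke_add add.assoc bit_fps_add_left_self funpow.simps o_apply)
qed

text \<open>The matrix of the pairing between the monomials T_3^i T_5^j and the odd powers of
  \<Delta>.\<close>

definition first_coeff :: "nat \<Rightarrow> nat \<Rightarrow> nat \<Rightarrow> bit" where
  "first_coeff i j k = ((Hecke 3 ^^ i) ((Hecke 5 ^^ j) (odd_power k))) $ 1"

text \<open>In this range the remainder of \<open>Hecke_3_5_pow_lead\<close> lies in
  \<open>low 0\<close>, so the leading term is the exact value; it is \<Delta> if (i, j) is the code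
  of k and 0 otherwise.\<close>

lemma first_coeff_triangular:
  assumes "weight k \<le> 2 * i + 3 * j"
  shows "first_coeff i j k = (if i = code3 k \<and> j = code5 k then 1 else 0)"
proof -
  let ?a = "code3 k" and ?b = "code5 k"
  have k: "k = enc ?a ?b" by simp
  have "2 * ?a + 3 * ?b - (2 * i + 3 * j) = 0" using assms by (simp add: weight_def)
  then have "(Hecke 3 ^^ i) ((Hecke 5 ^^ j) (odd_power k)) +
      (if i \<le> ?a \<and> j \<le> ?b then odd_power (enc (?a - i) (?b - j)) else 0) = 0"
    using Hecke_3_5_pow_lead[of i j ?a ?b] by simp
  then have "(Hecke 3 ^^ i) ((Hecke 5 ^^ j) (odd_power k)) =
      (if i \<le> ?a \<and> j \<le> ?b then odd_power (enc (?a - i) (?b - j)) else 0)"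
    by (rule iffD2[OF bit_fps_eq_iff])
  moreover have "i \<le> ?a \<and> j \<le> ?b \<longleftrightarrow> i = ?a \<and> j = ?b" using assms by (auto simp: weight_def)
  ultimately show ?thesis by (auto simp: first_coeff_def odd_power_def Delta_nth_1)
qed

text \<open>A power series evaluated at a nilpotent operator T, with coefficients that act through
  \<open>act\<close>. Nested series in two variables use it twice: the action at T_5 is the
  coefficient action for T_3.\<close>

definition nil_act :: "nat \<Rightarrow> ('m \<Rightarrow> 'm) \<Rightarrow> ('r \<Rightarrow> 'm \<Rightarrow> 'm) \<Rightarrow> 'r fps \<Rightarrow> 'm \<Rightarrow> 'm::comm_monoid_add" where
  "nil_act N T act f h = (\<Sum>i<N. (T ^^ i) (act (f $ i) h))"

lemma additive_sum:
  fixes T :: "'m::comm_monoid_add \<Rightarrow> 'n::comm_monoid_add"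
  assumes "\<And>g h. T (g + h) = T g + T h" "T 0 = 0"
  shows "T (\<Sum>i\<in>I. f i) = (\<Sum>i\<in>I. T (f i))"
  by (induction I rule: infinite_finite_induct) (simp_all add: assms)

text \<open>Truncation is harmless because terms of total exponent at least N vanish on S.
  Multiplicativity of \<open>act\<close> is demanded on S only, since the inner action at T_5 is
  itself truncated and relies on nilpotence there.\<close>

lemma nil_act_mult:
  fixes T :: "'m::comm_monoid_add \<Rightarrow> 'm" and act :: "'r::comm_ring_1 \<Rightarrow> 'm \<Rightarrow> 'm"
  assumes T: "\<And>g h. T (g + h) = T g + T h" "T 0 = 0"
    and act: "\<And>r g h. act r (g + h) = act r g + act r h" "\<And>r. act r 0 = 0"
      "\<And>r s h. act (r + s) h = act r h + act s h" "\<And>h. act 0 h = 0"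
    and comm: "\<And>r h. act r (T h) = T (act r h)"
    and act_mult: "\<And>r s h. h \<in> S \<Longrightarrow> act (r * s) h = act r (act s h)"
    and S: "\<And>r h. h \<in> S \<Longrightarrow> act r h \<in> S"
    and nil: "\<And>i h. h \<in> S \<Longrightarrow> i \<ge> N \<Longrightarrow> (T ^^ i) h = 0"
    and h: "h \<in> S"
  shows "nil_act N T act (f * g) h = nil_act N T act f (nil_act N T act g h)"
proof -
  have Tp: "(T ^^ i) (g + h) = (T ^^ i) g + (T ^^ i) h" "(T ^^ i) 0 = 0" for i g h
    by (induction i) (simp_all add: T)
  have commp: "act r ((T ^^ i) h) = (T ^^ i) (act r h)" for r i h
    by (induction i) (simp_all add: comm)
  let ?F = "\<lambda>a b. (T ^^ (a + b)) (act (f $ a) (act (g $ b) h))"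
  have "nil_act N T act f (nil_act N T act g h) = (\<Sum>a<N. \<Sum>b<N. ?F a b)"
    unfolding nil_act_def
    by (simp only: additive_sum[of "act _", OF act(1,2)] additive_sum[of "T ^^ _", OF Tp] commp funpow_add o_apply)
  also have "\<dots> = (\<Sum>(a, b)\<in>{..<N} \<times> {..<N}. ?F a b)"
    by (simp add: sum.cartesian_product)
  also have "\<dots> = (\<Sum>(a, b)\<in>{(a, b). a + b < N}. ?F a b)"
  proof (rule sum.mono_neutral_right)
    show "\<forall>p\<in>{..<N} \<times> {..<N} - {(a, b). a + b < N}. (case p of (a, b) \<Rightarrow> ?F a b) = 0"
    proof (rule ballI)
      fix p assume "p \<in> {..<N} \<times> {..<N} - {(a, b). a + b < N}"
      then obtain a b where "p = (a, b)" "\<not> a + b < N" by (cases p) auto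
      then show "(case p of (a, b) \<Rightarrow> ?F a b) = 0" using nil[OF S[OF S[OF h]]] by simp
    qed
  qed auto
  also have "\<dots> = (\<Sum>i<N. \<Sum>a\<le>i. ?F a (i - a))"
    by (rule sum.triangle_reindex)
  also have "\<dots> = nil_act N T act (f * g) h"
    unfolding nil_act_def
  proof (rule sum.cong)
    fix i assume "i \<in> {..<N}"
    have "act ((f * g) $ i) h = (\<Sum>a\<le>i. act (f $ a * g $ (i - a)) h)"
      by (simp only: fps_mult_nth atLeast0AtMost additive_sum[of "\<lambda>r. act r h", OF act(3,4)])
    then show "(\<Sum>a\<le>i. ?F a (i - a)) = (T ^^ i) (act ((f * g) $ i) h)"
      by (simp add: additive_sum[of "T ^^ _", OF Tp] act_mult[OF h])
  qed simp
  finally show ?thesis ..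
qed

lemma nil_act_closed:
  assumes "\<And>h. h \<in> S \<Longrightarrow> T h \<in> S" "\<And>r h. h \<in> S \<Longrightarrow> act r h \<in> S" "0 \<in> S" "\<And>g h. g \<in> S \<Longrightarrow> h \<in> S \<Longrightarrow> g + h \<in> S"
    and h: "h \<in> S"
  shows "nil_act N T act f h \<in> S"
proof -
  have "(T ^^ i) x \<in> S" if "x \<in> S" for i x using that by (induction i) (simp_all add: assms(1))
  then have "\<forall>i. (T ^^ i) (act (f $ i) h) \<in> S" using assms(2) h by blast
  then show ?thesis unfolding nil_act_def
    by (induction N) (simp_all add: assms(3,4))
qed

lemma nil_act_stable:
  assumes "\<And>i r. i \<ge> n \<Longrightarrow> (T ^^ i) (act r h) = 0" "n \<le> N"
  shows "nil_act N T act f h = nil_act n T act f h"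
  unfolding nil_act_def by (rule sum.mono_neutral_right) (use assms in auto)

section \<open>The action of power series on the spaces F(n)\<close>

lemma cuspF_upto_eq: "cuspF_upto n = scaleF2.span (odd_power ` {..<n})"
proof -
  have "{Delta ^ (2 * k - 1) | k. 1 \<le> k \<and> k \<le> n} = odd_power ` {..<n}"
  proof (intro equalityI subsetI)
    fix f assume "f \<in> {Delta ^ (2 * k - 1) | k. 1 \<le> k \<and> k \<le> n}"
    then obtain k where k: "f = Delta ^ (2 * k - 1)" "1 \<le> k" "k \<le> n" by auto
    then have "2 * k - 1 = 2 * (k - 1) + 1" "k - 1 < n" by auto
    then have "f = odd_power (k - 1)" "k - 1 < n" by (simp_all only: odd_power_def k(1))
    then show "f \<in> odd_power ` {..<n}" by blast
  next
    fix f assume "f \<in> odd_power ` {..<n}"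
    then obtain k where "k < n" "f = odd_power k" by auto
    then show "f \<in> {Delta ^ (2 * k - 1) | k. 1 \<le> k \<and> k \<le> n}"
      by (intro CollectI exI[of _ "Suc k"]) (auto simp: odd_power_def)
  qed
  then show ?thesis by (simp only: cuspF_upto_def)
qed

lemma weight_le: "weight k \<le> 2 * k"
proof (induction k)
  case (Suc k)
  then show ?case using weight_Suc[of k] by simp
qed simp

lemma cuspF_upto_closed:
  "0 \<in> cuspF_upto n" "f \<in> cuspF_upto n \<Longrightarrow> g \<in> cuspF_upto n \<Longrightarrow> f + g \<in> cuspF_upto n"
  "f \<in> cuspF_upto n \<Longrightarrow> scaleF2 c f \<in> cuspF_upto n" "k < n \<Longrightarrow> odd_power k \<in> cuspF_upto n"
  by (auto simp: cuspF_upto_eq scaleF2.span_zero scaleF2.span_add scaleF2.span_scale intro!: scaleF2.span_base)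

lemma cuspF_upto_mono: "m \<le> n \<Longrightarrow> cuspF_upto m \<subseteq> cuspF_upto n"
  unfolding cuspF_upto_eq by (rule scaleF2.span_mono) auto

lemma cuspF_upto_low: "cuspF_upto n \<subseteq> low (2 * n)"
  unfolding cuspF_upto_eq low_def
proof (rule scaleF2.span_mono)
  show "odd_power ` {..<n} \<subseteq> odd_power ` {k. weight k < 2 * n}"
  proof (rule image_mono, rule subsetI)
    fix k assume "k \<in> {..<n}"
    then show "k \<in> {k. weight k < 2 * n}" using weight_le[of k] by simp
  qed
qed

lemma Hecke_closed: "f \<in> cuspF_upto n \<Longrightarrow> Hecke 3 f \<in> cuspF_upto n" "f \<in> cuspF_upto n \<Longrightarrow> Hecke 5 f \<in> cuspF_upto n"
  by (rule Hecke_cuspF_upto; simp add: prime_nat_numeral_eq)+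

text \<open>The weights in F(n) are below 2 n, and each operator lowers the weight by at least 2, so
  n steps reach \<open>low 0\<close>.\<close>

lemma Hecke_nilpotent:
  assumes "f \<in> cuspF_upto n" "n \<le> i"
  shows "(Hecke 3 ^^ i) f = 0" "(Hecke 5 ^^ i) f = 0"
proof -
  have f: "f \<in> low (2 * n)" using assms(1) cuspF_upto_low by blast
  show "(Hecke 3 ^^ i) f = 0" using Hecke_3_pow_low[OF f, of i] assms(2) by simp
  show "(Hecke 5 ^^ i) f = 0" using Hecke_5_pow_low[OF f, of i] assms(2) by simp
qed

lemma Hecke_commute:
  assumes "prime p" "prime q"
  shows "Hecke p (Hecke q f) = Hecke q (Hecke p f)"
proof (cases "p = q")
  case False
  then have c: "coprime p q" using assms by (simp add: primes_coprime)
  have pos: "p > 0" "q > 0" using assms prime_gt_0_nat by auto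
  show ?thesis
  proof (rule fps_ext)
    fix n
    have d: "q dvd p * n \<longleftrightarrow> q dvd n" "p dvd q * n \<longleftrightarrow> p dvd n"
      using c by (simp_all add: coprime_dvd_mult_right_iff coprime_commute)
    have e: "q dvd n \<Longrightarrow> p * n div q = p * (n div q)" "p dvd n \<Longrightarrow> q * n div p = q * (n div p)"
      by (simp_all add: div_mult_swap)
    have f: "p dvd n \<Longrightarrow> q dvd n div p \<longleftrightarrow> q dvd n" "q dvd n \<Longrightarrow> p dvd n div q \<longleftrightarrow> p dvd n"
      using c by (metis coprime_commute coprime_dvd_mult_right_iff dvd_mult_div_cancel)+
    have g: "n div p div q = n div q div p" by (simp add: div_mult2_eq[symmetric] mult.commute)
    show "Hecke p (Hecke q f) $ n = Hecke q (Hecke p f) $ n"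
      by (simp add: Hecke_nth d e f g mult.left_commute add_ac)
  qed
qed simp

definition hecke_act :: "nat \<Rightarrow> bit fps fps \<Rightarrow> bit fps \<Rightarrow> bit fps" where
  "hecke_act N = nil_act N (Hecke 3) (nil_act N (Hecke 5) scaleF2)"

lemma scaleF2_simps: "scaleF2 a (g + h) = scaleF2 a g + scaleF2 a h" "scaleF2 a 0 = 0"
  "scaleF2 (a + b) h = scaleF2 a h + scaleF2 b h" "scaleF2 0 h = 0" "scaleF2 (a * b) h = scaleF2 a (scaleF2 b h)" "scaleF2 1 h = h"
  by (simp_all add: scaleF2.scale_right_distrib scaleF2.scale_left_distrib)

lemma nil_act_Hecke:
  assumes "\<And>r g h. act r (g + h) = act r g + act r h" "\<And>r. act r 0 = 0"
  shows "nil_act N (Hecke p) act f (g + h) = nil_act N (Hecke p) act f g + nil_act N (Hecke p) act f h"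
    and "nil_act N (Hecke p) act f 0 = 0"
  by (simp_all add: nil_act_def assms Hecke_pow_add Hecke_pow_0 sum.distrib)

lemma nil_act_Hecke_left:
  assumes "\<And>r s h. act (r + s) h = act r h + act s h" "\<And>h. act 0 h = 0"
  shows "nil_act N (Hecke p) act (f + g) h = nil_act N (Hecke p) act f h + nil_act N (Hecke p) act g h"
    and "nil_act N (Hecke p) act 0 h = 0"
  by (simp_all add: nil_act_def assms Hecke_pow_add Hecke_pow_0 sum.distrib)

lemma hecke_act_linear:
  "hecke_act N f (g + h) = hecke_act N f g + hecke_act N f h" "hecke_act N f 0 = 0"
  "hecke_act N (f + f') h = hecke_act N f h + hecke_act N f' h" "hecke_act N 0 h = 0"
  unfolding hecke_act_def
  by (simp_all only: nil_act_Hecke nil_act_Hecke_left scaleF2_simps)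

lemma hecke_act_closed: "h \<in> cuspF_upto n \<Longrightarrow> hecke_act N f h \<in> cuspF_upto n"
  unfolding hecke_act_def
  by (intro nil_act_closed[where S = "cuspF_upto n"]; (intro Hecke_closed cuspF_upto_closed)?; assumption?)

lemma Hecke_pow_commute:
  assumes "prime p" "prime q"
  shows "Hecke p ((Hecke q ^^ i) f) = (Hecke q ^^ i) (Hecke p f)"
  by (induction i) (simp_all add: Hecke_commute[OF assms])

lemma Hecke_nil_act_commute:
  assumes "prime p" "prime q" "\<And>r h. Hecke p (act r h) = act r (Hecke p h)"
  shows "Hecke p (nil_act N (Hecke q) act f h) = nil_act N (Hecke q) act f (Hecke p h)"
  unfolding nil_act_def
  by (simp only: additive_sum[of "Hecke p", OF Hecke_add Hecke_0] Hecke_pow_commute[OF assms(1,2)] assms(3))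

lemma Hecke_hecke_act:
  assumes "prime p"
  shows "Hecke p (hecke_act N f h) = hecke_act N f (Hecke p h)"
  unfolding hecke_act_def
  by (intro Hecke_nil_act_commute assms Hecke_scale; simp add: prime_nat_numeral_eq)

lemma hecke_act_mult:
  assumes h: "h \<in> cuspF_upto n" and n: "n \<le> N"
  shows "hecke_act N (f * g) h = hecke_act N f (hecke_act N g h)"
proof -
  have p: "prime (3::nat)" "prime (5::nat)" by (simp_all add: prime_nat_numeral_eq)
  let ?A = "nil_act N (Hecke 5) scaleF2"
  have A: "?A (r * s) x = ?A r (?A s x)" if "x \<in> cuspF_upto n" for r s x
  proof (rule nil_act_mult[where S = "cuspF_upto n"])
    show "(Hecke 5 ^^ i) y = 0" if "y \<in> cuspF_upto n" "N \<le> i" for i y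
      using Hecke_nilpotent(2)[OF that(1)] that n by simp
    show "scaleF2 r (Hecke 5 y) = Hecke 5 (scaleF2 r y)" for r y by (simp only: Hecke_scale)
  qed (fact Hecke_add Hecke_0 scaleF2_simps that | (rule cuspF_upto_closed scaleF2_simps, assumption?))+
  have cl: "?A r x \<in> cuspF_upto n" if "x \<in> cuspF_upto n" for r x
    by (rule nil_act_closed) (use that Hecke_closed cuspF_upto_closed in auto)
  show ?thesis unfolding hecke_act_def
  proof (rule nil_act_mult[where S = "cuspF_upto n"])
    show "?A r (Hecke 3 h) = Hecke 3 (?A r h)" for r h
      by (rule Hecke_nil_act_commute[symmetric]) (fact p Hecke_scale)+
    show "(Hecke 3 ^^ i) x = 0" if "x \<in> cuspF_upto n" "N \<le> i" for i x
      using Hecke_nilpotent(1)[OF that(1)] that n by simp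
    show "?A r (g + h) = ?A r g + ?A r h" "?A r 0 = 0" for r g h
      by (rule nil_act_Hecke[OF scaleF2_simps(1,2)])+
    show "?A (r + s) h = ?A r h + ?A s h" "?A 0 h = 0" for r s h
      by (rule nil_act_Hecke_left[OF scaleF2_simps(3,4)])+
  qed (fact Hecke_add Hecke_0 h | (rule A cl, assumption))+
qed

lemma hecke_act_stable:
  assumes h: "h \<in> cuspF_upto n" and n: "n \<le> N"
  shows "hecke_act N f h = hecke_act n f h"
proof -
  let ?A = "\<lambda>N. nil_act N (Hecke 5) scaleF2"
  have A: "?A N r h = ?A n r h" for r
    by (rule nil_act_stable[OF _ n]) (rule Hecke_nilpotent(2)[OF cuspF_upto_closed(3)[OF h]])
  have cl: "?A n r h \<in> cuspF_upto n" for r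
    by (rule nil_act_closed) (use h Hecke_closed cuspF_upto_closed in auto)
  have "hecke_act N f h = nil_act N (Hecke 3) (?A n) f h"
    unfolding hecke_act_def nil_act_def[of _ "Hecke 3"] A ..
  also have "\<dots> = hecke_act n f h"
    unfolding hecke_act_def by (rule nil_act_stable[OF _ n]) (rule Hecke_nilpotent(1)[OF cl])
  finally show ?thesis .
qed

lemma hecke_act_expand:
  "hecke_act N f h = (\<Sum>i<N. \<Sum>j<N. scaleF2 (f $ i $ j) ((Hecke 3 ^^ i) ((Hecke 5 ^^ j) h)))"
  unfolding hecke_act_def nil_act_def
  by (simp only: additive_sum[of "Hecke _ ^^ _", OF Hecke_pow_add Hecke_pow_0] Hecke_pow_scale)

lemma hecke_act_first_coeff:
  assumes "weight k < N"
  shows "hecke_act N f (odd_power k) $ 1 = f $ code3 k $ code5 k +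
    (\<Sum>(i, j) | 2 * i + 3 * j < weight k. f $ i $ j * first_coeff i j k)"
proof -
  let ?B = "{..<N} \<times> {..<N}" and ?L = "{(i, j). 2 * i + 3 * j < weight k}"
  let ?t = "\<lambda>(i, j). f $ i $ j * first_coeff i j k"
  let ?k = "(code3 k, code5 k)"
  have L: "?L \<subseteq> ?B" using assms by auto
  have k: "?k \<in> ?B - ?L" using assms by (auto simp: weight_def)
  have "hecke_act N f (odd_power k) $ 1 = (\<Sum>p\<in>?B. ?t p)"
    by (simp add: hecke_act_expand fps_sum_nth scaleF2_nth first_coeff_def sum.cartesian_product case_prod_unfold)
  also have "\<dots> = (\<Sum>p\<in>?B - ?L. ?t p) + (\<Sum>p\<in>?L. ?t p)"
    by (rule sum.subset_diff[OF L]) simp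
  also have "(\<Sum>p\<in>?B - ?L. ?t p) = (\<Sum>p\<in>?B - ?L. if p = ?k then f $ code3 k $ code5 k else 0)"
    by (rule sum.cong) (auto simp: first_coeff_triangular not_less split: if_splits)
  also have "\<dots> = f $ code3 k $ code5 k" using k by simp
  finally show ?thesis by (simp add: case_prod_unfold)
qed

section \<open>The algebras of Hecke operators\<close>

lemma EndF_sel:
  "\<phi> \<otimes>\<^bsub>EndF n\<^esub> \<chi> = compose (cuspF_upto n) \<phi> \<chi>" "\<one>\<^bsub>EndF n\<^esub> = (\<lambda>f\<in>cuspF_upto n. f)"
  "\<zero>\<^bsub>EndF n\<^esub> = (\<lambda>f\<in>cuspF_upto n. 0)" "\<phi> \<oplus>\<^bsub>EndF n\<^esub> \<chi> = (\<lambda>f\<in>cuspF_upto n. \<phi> f + \<chi> f)"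
  by (simp_all add: EndF_def)

lemma HeckeAlg_upto_sel:
  "\<phi> \<otimes>\<^bsub>HeckeAlg_upto n\<^esub> \<chi> = compose (cuspF_upto n) \<phi> \<chi>" "\<one>\<^bsub>HeckeAlg_upto n\<^esub> = (\<lambda>f\<in>cuspF_upto n. f)"
  "\<zero>\<^bsub>HeckeAlg_upto n\<^esub> = (\<lambda>f\<in>cuspF_upto n. 0)" "\<phi> \<oplus>\<^bsub>HeckeAlg_upto n\<^esub> \<chi> = (\<lambda>f\<in>cuspF_upto n. \<phi> f + \<chi> f)"
  by (simp_all add: HeckeAlg_upto_def EndF_sel)

lemma EndF_carrierD:
  assumes "\<phi> \<in> carrier (EndF n)"
  shows "\<phi> \<in> cuspF_upto n \<rightarrow>\<^sub>E cuspF_upto n"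
    "f \<in> cuspF_upto n \<Longrightarrow> g \<in> cuspF_upto n \<Longrightarrow> \<phi> (f + g) = \<phi> f + \<phi> g"
    "f \<in> cuspF_upto n \<Longrightarrow> \<phi> (scaleF2 c f) = scaleF2 c (\<phi> f)"
  using assms by (auto simp: EndF_def)

lemma EndF_carrier_0: "\<phi> \<in> carrier (EndF n) \<Longrightarrow> \<phi> 0 = 0"
  using EndF_carrierD(3)[of \<phi> n 0 0] cuspF_upto_closed(1)[of n] by simp

lemma HeckeEnd_carrier: "prime p \<Longrightarrow> odd p \<Longrightarrow> HeckeEnd n p \<in> carrier (EndF n)"
  unfolding EndF_def HeckeEnd_def
  by (auto simp: Hecke_cuspF_upto Hecke_add Hecke_scale cuspF_upto_closed)

lemma scalarEnd_carrier: "scalarEnd n c \<in> carrier (EndF n)"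
  unfolding EndF_def scalarEnd_def
  by (auto simp: cuspF_upto_closed scaleF2_simps mult.commute simp flip: scaleF2_simps(5))

abbreviation hecke_gens :: "nat \<Rightarrow> (bit fps \<Rightarrow> bit fps) set" where
  "hecke_gens n \<equiv> range (scalarEnd n) \<union> {HeckeEnd n p | p. prime p \<and> odd p}"

lemma hecke_gens_carrier: "hecke_gens n \<subseteq> carrier (EndF n)"
  using HeckeEnd_carrier scalarEnd_carrier by auto

lemma carrier_HeckeAlg_upto: "carrier (HeckeAlg_upto n) = generate_ring (EndF n) (hecke_gens n)"
  by (simp add: HeckeAlg_upto_def)

lemma HeckeAlg_upto_ring: "ring (HeckeAlg_upto n)"
  unfolding HeckeAlg_upto_def by (rule ring.generate_ring_is_ring[OF EndF_ring hecke_gens_carrier])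

lemma HeckeAlg_upto_subset: "carrier (HeckeAlg_upto n) \<subseteq> carrier (EndF n)"
  unfolding carrier_HeckeAlg_upto by (rule ring.generate_ring_incl[OF EndF_ring hecke_gens_carrier])

text \<open>Membership in A(n) enters \<open>psi_surj\<close> only through this and linearity on
  F(n), so no expression of an element by generators is needed there.\<close>

lemma HeckeAlg_upto_commute:
  assumes "\<phi> \<in> carrier (HeckeAlg_upto n)" "prime p" "odd p" "f \<in> cuspF_upto n"
  shows "Hecke p (\<phi> f) = \<phi> (Hecke p f)"
  using assms(1) assms(4) unfolding carrier_HeckeAlg_upto
proof (induction arbitrary: f rule: generate_ring.induct)
  case one
  then show ?case using Hecke_cuspF_upto[OF assms(2,3)] by (simp add: EndF_sel)
next
  case (incl h)
  then show ?case
    using Hecke_cuspF_upto[OF assms(2,3)] Hecke_commute[OF assms(2)]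
    by (auto simp: scalarEnd_def HeckeEnd_def Hecke_scale)
next
  case (a_inv h)
  interpret R: ring "EndF n" by (rule EndF_ring)
  have h: "h \<in> carrier (EndF n)"
    using ring.generate_ring_incl[OF EndF_ring hecke_gens_carrier] a_inv(1) by blast
  \<comment> \<open>The additive inverse of the abstract ring is known only by its defining
    equation; over F_2 it is h itself.\<close>
  have neg: "(\<ominus>\<^bsub>EndF n\<^esub> h) g = h g" if "g \<in> cuspF_upto n" for g
  proof -
    have "(h \<oplus>\<^bsub>EndF n\<^esub> (\<ominus>\<^bsub>EndF n\<^esub> h)) g = \<zero>\<^bsub>EndF n\<^esub> g" using R.r_neg[OF h] by simp
    then have "h g + (\<ominus>\<^bsub>EndF n\<^esub> h) g = 0" using that by (simp add: EndF_sel)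
    then show ?thesis by (rule iffD2[OF bit_fps_eq_iff, symmetric])
  qed
  show ?case using a_inv Hecke_cuspF_upto[OF assms(2,3)] by (simp add: neg)
next
  case (eng_add h1 h2)
  then show ?case using Hecke_cuspF_upto[OF assms(2,3)] by (simp add: EndF_sel Hecke_add)
next
  case (eng_mult h1 h2)
  have "h2 \<in> carrier (EndF n)"
    using ring.generate_ring_incl[OF EndF_ring hecke_gens_carrier] eng_mult(2) by blast
  then have "h2 f \<in> cuspF_upto n" using EndF_carrierD(1) eng_mult.prems by blast
  then show ?case using eng_mult Hecke_cuspF_upto[OF assms(2,3)] by (simp add: EndF_sel compose_eq)
qed

lemma HeckeAlg_upto_gens:
  "scalarEnd n c \<in> carrier (HeckeAlg_upto n)"
  "prime p \<Longrightarrow> odd p \<Longrightarrow> HeckeEnd n p \<in> carrier (HeckeAlg_upto n)"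
  unfolding carrier_HeckeAlg_upto by (rule generate_ring.incl; auto)+

lemma HeckeEnd_3_5: "HeckeEnd n 3 \<in> carrier (HeckeAlg_upto n)" "HeckeEnd n 5 \<in> carrier (HeckeAlg_upto n)"
  by (rule HeckeAlg_upto_gens(2); simp add: prime_nat_numeral_eq)+

lemma finsum_apply:
  assumes "finite I" "\<And>i. i \<in> I \<Longrightarrow> \<phi> i \<in> carrier (HeckeAlg_upto n)" "g \<in> cuspF_upto n"
  shows "(\<Oplus>\<^bsub>HeckeAlg_upto n\<^esub> i\<in>I. \<phi> i) g = (\<Sum>i\<in>I. \<phi> i g)"
proof -
  interpret R: ring "HeckeAlg_upto n" by (rule HeckeAlg_upto_ring)
  show ?thesis
    using assms
  proof (induction rule: finite_induct)
    case (insert i I)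
    have "(\<Oplus>\<^bsub>HeckeAlg_upto n\<^esub> i\<in>insert i I. \<phi> i) = \<phi> i \<oplus>\<^bsub>HeckeAlg_upto n\<^esub> (\<Oplus>\<^bsub>HeckeAlg_upto n\<^esub> i\<in>I. \<phi> i)"
      by (rule R.finsum_insert) (use insert in auto)
    then show ?case using insert by (simp add: HeckeAlg_upto_sel)
  qed (simp add: HeckeAlg_upto_sel)
qed

lemma pow_apply:
  assumes "prime p" "odd p" "g \<in> cuspF_upto n"
  shows "(HeckeEnd n p [^]\<^bsub>HeckeAlg_upto n\<^esub> (i::nat)) g = (Hecke p ^^ i) g"
  using assms(3)
proof (induction i arbitrary: g)
  case 0
  then show ?case by (simp add: nat_pow_def HeckeAlg_upto_sel)
next
  case (Suc i)
  then have "Hecke p g \<in> cuspF_upto n" using Hecke_cuspF_upto[OF assms(1,2)] by simp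
  then show ?case using Suc
    by (simp add: nat_pow_def HeckeAlg_upto_sel compose_eq HeckeEnd_def funpow_swap1)
qed

lemma Hecke_pow_closed:
  "g \<in> cuspF_upto n \<Longrightarrow> (Hecke 3 ^^ i) g \<in> cuspF_upto n" "g \<in> cuspF_upto n \<Longrightarrow> (Hecke 5 ^^ i) g \<in> cuspF_upto n"
  by (induction i) (simp_all add: Hecke_closed)

lemma psi_poly_term:
  fixes i j n :: nat and c :: bit
  defines "t \<equiv> scalarEnd n c \<otimes>\<^bsub>HeckeAlg_upto n\<^esub> (HeckeEnd n 3 [^]\<^bsub>HeckeAlg_upto n\<^esub> i)
    \<otimes>\<^bsub>HeckeAlg_upto n\<^esub> (HeckeEnd n 5 [^]\<^bsub>HeckeAlg_upto n\<^esub> j)"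
  shows "t \<in> carrier (HeckeAlg_upto n)"
    and "g \<in> cuspF_upto n \<Longrightarrow> t g = scaleF2 c ((Hecke 3 ^^ i) ((Hecke 5 ^^ j) g))"
proof -
  interpret R: ring "HeckeAlg_upto n" by (rule HeckeAlg_upto_ring)
  show "t \<in> carrier (HeckeAlg_upto n)"
    unfolding t_def by (intro R.m_closed R.nat_pow_closed HeckeAlg_upto_gens(1) HeckeEnd_3_5)
  have pr: "prime (3::nat)" "prime (5::nat)" by (simp_all add: prime_nat_numeral_eq)
  show "g \<in> cuspF_upto n \<Longrightarrow> t g = scaleF2 c ((Hecke 3 ^^ i) ((Hecke 5 ^^ j) g))"
    unfolding t_def
    by (simp add: HeckeAlg_upto_sel(1) compose_eq pow_apply pr Hecke_pow_closed scalarEnd_def)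
qed

lemma psi_poly_carrier: "psi_poly n P \<in> carrier (HeckeAlg_upto n)"
proof -
  interpret R: ring "HeckeAlg_upto n" by (rule HeckeAlg_upto_ring)
  show ?thesis unfolding psi_poly_def
    by (intro R.finsum_closed Pi_I psi_poly_term(1))
qed

lemma psi_poly_apply:
  assumes "g \<in> cuspF_upto n"
  shows "psi_poly n P g = (\<Sum>i\<le>Polynomial.degree P. \<Sum>j\<le>Polynomial.degree (Polynomial.coeff P i).
    scaleF2 (Polynomial.coeff (Polynomial.coeff P i) j) ((Hecke 3 ^^ i) ((Hecke 5 ^^ j) g)))"
proof -
  interpret R: ring "HeckeAlg_upto n" by (rule HeckeAlg_upto_ring)
  show ?thesis unfolding psi_poly_def
    by (subst finsum_apply[OF _ _ assms], simp, intro R.finsum_closed Pi_I psi_poly_term(1),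
        subst finsum_apply[OF _ _ assms], simp, rule psi_poly_term(1), simp add: psi_poly_term(2)[OF assms])
qed

lemma sum_degree_eq:
  fixes P :: "'a::zero poly" and h :: "'a \<Rightarrow> nat \<Rightarrow> 'b::comm_monoid_add"
  assumes "\<And>i. h 0 i = 0" "\<And>i. i \<ge> N \<Longrightarrow> Polynomial.coeff P i = 0"
  shows "(\<Sum>i\<le>Polynomial.degree P. h (Polynomial.coeff P i) i) = (\<Sum>i<N. h (Polynomial.coeff P i) i)"
proof -
  have "(\<Sum>i\<le>Polynomial.degree P. h (Polynomial.coeff P i) i) = (\<Sum>i\<in>{..Polynomial.degree P} \<union> {..<N}. h (Polynomial.coeff P i) i)"
    by (rule sum.mono_neutral_left) (auto simp: assms coeff_eq_0)
  also have "\<dots> = (\<Sum>i<N. h (Polynomial.coeff P i) i)"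
    by (rule sum.mono_neutral_right) (auto simp: assms)
  finally show ?thesis .
qed

lemma nilp_exponent:
  assumes "g \<in> cuspF_upto n" "i \<ge> nilp_exponent n"
  shows "(Hecke 3 ^^ i) g = 0" "(Hecke 5 ^^ i) g = 0" and "nilp_exponent n \<le> n"
proof -
  let ?P = "\<lambda>N::nat. HeckeEnd n 3 [^]\<^bsub>HeckeAlg_upto n\<^esub> N = \<zero>\<^bsub>HeckeAlg_upto n\<^esub> \<and>
     HeckeEnd n 5 [^]\<^bsub>HeckeAlg_upto n\<^esub> N = \<zero>\<^bsub>HeckeAlg_upto n\<^esub>"
  interpret R: ring "HeckeAlg_upto n" by (rule HeckeAlg_upto_ring)
  have pr: "prime (3::nat)" "prime (5::nat)" by (simp_all add: prime_nat_numeral_eq)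
  have eqI: "\<phi> = \<zero>\<^bsub>HeckeAlg_upto n\<^esub>" if "\<phi> \<in> carrier (HeckeAlg_upto n)" "\<And>g. g \<in> cuspF_upto n \<Longrightarrow> \<phi> g = 0" for \<phi>
  proof -
    have "\<phi> \<in> extensional (cuspF_upto n)"
      using EndF_carrierD(1)[OF subsetD[OF HeckeAlg_upto_subset that(1)]] by (simp add: PiE_iff)
    then show ?thesis using that(2) by (auto simp: HeckeAlg_upto_sel extensional_def fun_eq_iff)
  qed
  have "?P n"
    by (intro conjI eqI R.nat_pow_closed HeckeEnd_3_5) (simp_all add: pow_apply pr Hecke_nilpotent)
  then have L: "?P (nilp_exponent n)" and le: "nilp_exponent n \<le> n"
    unfolding nilp_exponent_def by (rule LeastI, rule Least_le)
  show "nilp_exponent n \<le> n" by (rule le)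
  obtain d where i: "i = nilp_exponent n + d" using assms(2) le_Suc_ex by blast
  have z: "(Hecke 3 ^^ nilp_exponent n) x = 0" "(Hecke 5 ^^ nilp_exponent n) x = 0" if "x \<in> cuspF_upto n" for x
    using L pow_apply[OF pr(1) _ that, of "nilp_exponent n"] pow_apply[OF pr(2) _ that, of "nilp_exponent n"] that
    by (simp_all add: HeckeAlg_upto_sel)
  show "(Hecke 3 ^^ i) g = 0" "(Hecke 5 ^^ i) g = 0"
    unfolding i funpow_add o_apply by (rule z, rule Hecke_pow_closed, rule assms(1))+
qed

text \<open>\<open>nilp_exponent\<close> is at most n, and all terms beyond it vanish on F(n).
  Cutting at n instead gives the same operator with an explicit bound.\<close>

lemma psi_upto_apply:
  assumes g: "g \<in> cuspF_upto n"
  shows "psi_upto n f g = hecke_act n f g"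
proof -
  let ?L = "nilp_exponent n" and ?P = "truncate_XY (nilp_exponent n) f"
  let ?t = "\<lambda>i j. (Hecke 3 ^^ i) ((Hecke 5 ^^ j) g)"
  have c: "Polynomial.coeff ?P i = (if i < ?L then truncate_fps ?L (f $ i) else 0)" for i
    by (simp add: truncate_XY_def coeff_map_poly coeff_truncate_fps)
  have "psi_upto n f g = (\<Sum>i\<le>Polynomial.degree ?P. \<Sum>j\<le>Polynomial.degree (Polynomial.coeff ?P i).
      scaleF2 (Polynomial.coeff (Polynomial.coeff ?P i) j) (?t i j))"
    unfolding psi_upto_def by (rule psi_poly_apply[OF g])
  also have "\<dots> = (\<Sum>i\<le>Polynomial.degree ?P. \<Sum>j<?L. scaleF2 (Polynomial.coeff (Polynomial.coeff ?P i) j) (?t i j))"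
    by (intro sum.cong refl sum_degree_eq[where h = "\<lambda>c j. scaleF2 c (?t _ j)"])
      (auto simp: c coeff_truncate_fps scaleF2_simps)
  also have "\<dots> = (\<Sum>i<?L. \<Sum>j<?L. scaleF2 (Polynomial.coeff (Polynomial.coeff ?P i) j) (?t i j))"
    by (rule sum_degree_eq[where h = "\<lambda>c i. \<Sum>j<?L. scaleF2 (Polynomial.coeff c j) (?t i j)"])
      (simp_all add: c scaleF2_simps)
  also have "\<dots> = (\<Sum>i<?L. \<Sum>j<?L. scaleF2 (f $ i $ j) (?t i j))"
    by (intro sum.cong) (auto simp: c coeff_truncate_fps)
  also have "\<dots> = (\<Sum>i<?L. \<Sum>j<n. scaleF2 (f $ i $ j) (?t i j))"
    by (intro sum.cong refl sum.mono_neutral_left)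
      (use nilp_exponent[OF g] in \<open>auto simp: Hecke_pow_0 scaleF2_simps not_less\<close>)
  also have "\<dots> = (\<Sum>i<n. \<Sum>j<n. scaleF2 (f $ i $ j) (?t i j))"
    by (intro sum.mono_neutral_left)
      (use nilp_exponent(1,3)[OF Hecke_pow_closed(2)[OF g]] in \<open>auto simp: scaleF2_simps not_less\<close>)
  also have "\<dots> = hecke_act n f g" by (simp only: hecke_act_expand)
  finally show ?thesis .
qed

lemma psi_apply: "n \<ge> 1 \<Longrightarrow> g \<in> cuspF_upto n \<Longrightarrow> psi f n g = hecke_act n f g"
  by (simp add: psi_def psi_upto_apply)

lemma psi_upto_eq: "psi_upto n f = (\<lambda>g\<in>cuspF_upto n. hecke_act n f g)"
proof
  fix g
  have "psi_upto n f \<in> extensional (cuspF_upto n)"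
    using EndF_carrierD(1)[OF subsetD[OF HeckeAlg_upto_subset psi_poly_carrier]]
    by (simp add: psi_upto_def PiE_iff)
  then show "psi_upto n f g = (\<lambda>g\<in>cuspF_upto n. hecke_act n f g) g"
    by (cases "g \<in> cuspF_upto n") (simp_all add: psi_upto_apply extensional_def)
qed

lemma psi_carrier: "psi f \<in> carrier HeckeAlg"
proof -
  have "psi f \<in> (\<Pi>\<^sub>E n\<in>{1..}. carrier (HeckeAlg_upto n))"
    using psi_poly_carrier by (auto simp: psi_def psi_upto_def)
  moreover have "restrict (psi f (Suc n)) (cuspF_upto n) = psi f n" if "n \<ge> 1" for n
  proof
    fix g
    have "cuspF_upto n \<subseteq> cuspF_upto (Suc n)" by (rule cuspF_upto_mono) simp
    then show "restrict (psi f (Suc n)) (cuspF_upto n) g = psi f n g"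
      using that hecke_act_stable[of g n "Suc n" f] by (auto simp: psi_def psi_upto_eq restrict_def)
  qed
  ultimately show ?thesis by (simp add: HeckeAlg_def)
qed

lemma hecke_act_one:
  assumes "n \<ge> 1"
  shows "hecke_act n 1 g = g"
proof -
  have "hecke_act n 1 g = (\<Sum>i<n. \<Sum>j<n. if i = 0 \<and> j = 0 then g else 0)"
    unfolding hecke_act_expand by (intro sum.cong refl) (auto simp: fps_one_nth scaleF2_simps)
  also have "\<dots> = (\<Sum>i<n. if i = 0 then \<Sum>j<n. if j = 0 then g else 0 else 0)"
    by (intro sum.cong refl) auto
  also have "\<dots> = g" using assms by simp
  finally show ?thesis .
qed

lemma psi_hom: "psi \<in> ring_hom power_series_ring_XY HeckeAlg"
proof (rule ring_hom_memI)
  show "psi f \<in> carrier HeckeAlg" for f by (rule psi_carrier)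
  show "psi (f \<otimes>\<^bsub>ring_of_type_algebra\<^esub> g) = psi f \<otimes>\<^bsub>HeckeAlg\<^esub> psi g" for f g
    by (auto simp: ring_of_type_algebra_def HeckeAlg_def psi_def psi_upto_eq HeckeAlg_upto_sel fun_eq_iff
        compose_def restrict_def hecke_act_closed hecke_act_mult)
  show "psi (f \<oplus>\<^bsub>ring_of_type_algebra\<^esub> g) = psi f \<oplus>\<^bsub>HeckeAlg\<^esub> psi g" for f g
    by (auto simp: ring_of_type_algebra_def HeckeAlg_def psi_def psi_upto_eq HeckeAlg_upto_sel fun_eq_iff
        restrict_def hecke_act_linear)
  show "psi \<one>\<^bsub>ring_of_type_algebra\<^esub> = \<one>\<^bsub>HeckeAlg\<^esub>"
    by (auto simp: ring_of_type_algebra_def HeckeAlg_def psi_def psi_upto_eq HeckeAlg_upto_sel fun_eq_iff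
        restrict_def hecke_act_one)
qed

section \<open>Injectivity and surjectivity of psi\<close>

lemma psi_inj: "inj psi"
proof (rule injI)
  fix f g :: "bit fps fps" assume eq: "psi f = psi g"
  \<comment> \<open>The level 2 k + 1 exceeds both k and \<open>weight k\<close>: the first puts the
    form into the space, the second is the cut-off needed by
    \<open>hecke_act_first_coeff\<close>.\<close>
  have coeff: "hecke_act (Suc (2 * k)) f (odd_power k) $ 1 = hecke_act (Suc (2 * k)) g (odd_power k) $ 1" for k
    using psi_apply[of "Suc (2 * k)" "odd_power k" f] psi_apply[of "Suc (2 * k)" "odd_power k" g] eq
    by (simp add: cuspF_upto_closed)
  have "f $ code3 k $ code5 k = g $ code3 k $ code5 k" for k
  proof (induction "weight k" arbitrary: k rule: less_induct)
    case less
    have w: "weight k < Suc (2 * k)" using weight_le[of k] by simp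
    have "(\<Sum>(i, j) | 2 * i + 3 * j < weight k. f $ i $ j * first_coeff i j k) =
        (\<Sum>(i, j) | 2 * i + 3 * j < weight k. g $ i $ j * first_coeff i j k)"
    proof (rule sum.cong)
      fix p assume "p \<in> {(i, j). 2 * i + 3 * j < weight k}"
      then obtain i j where p: "p = (i, j)" "2 * i + 3 * j < weight k" by auto
      have "f $ i $ j = g $ i $ j" using less[of "enc i j"] p(2) by simp
      then show "(case p of (i, j) \<Rightarrow> f $ i $ j * first_coeff i j k) = (case p of (i, j) \<Rightarrow> g $ i $ j * first_coeff i j k)"
        by (simp add: p(1))
    qed simp
    then show ?case using coeff[of k] unfolding hecke_act_first_coeff[OF w] by simp
  qed
  from this[of "enc _ _"] show "f = g" by (auto intro!: fps_ext)
qed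

text \<open>Solves the triangular system of \<open>hecke_act_first_coeff\<close> by substitution in
  increasing weight; the solution is the power series whose pairings with the odd powers are
  prescribed by l.\<close>

function dual_coeff :: "(nat \<Rightarrow> bit) \<Rightarrow> nat \<times> nat \<Rightarrow> bit" where
  "dual_coeff l p = l (enc (fst p) (snd p)) +
    (\<Sum>q | 2 * fst q + 3 * snd q < 2 * fst p + 3 * snd p.
      dual_coeff l q * first_coeff (fst q) (snd q) (enc (fst p) (snd p)))"
  by auto
termination by (relation "Wellfounded.measure (\<lambda>(l, p). 2 * fst p + 3 * snd p)") auto

declare dual_coeff.simps [simp del]

lemma hecke_act_dual:
  assumes k: "k < n"
  shows "hecke_act n (Abs_fps (\<lambda>i. Abs_fps (\<lambda>j. dual_coeff l (i, j)))) (odd_power k) $ 1 = l k"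
proof -
  let ?b = "Abs_fps (\<lambda>i. Abs_fps (\<lambda>j. dual_coeff l (i, j)))"
  have mem: "odd_power k \<in> cuspF_upto n" by (rule cuspF_upto_closed(4)[OF k])
  \<comment> \<open>\<open>hecke_act_first_coeff\<close> asks for a cut-off above
    \<open>weight k\<close>, which k < n alone does not give.\<close>
  have "hecke_act n ?b (odd_power k) $ 1 = hecke_act (max n (Suc (weight k))) ?b (odd_power k) $ 1"
    by (subst hecke_act_stable[OF mem max.cobounded1]) (rule refl)
  also have "\<dots> = dual_coeff l (code3 k, code5 k) +
      (\<Sum>(i, j) | 2 * i + 3 * j < weight k. dual_coeff l (i, j) * first_coeff i j k)"
    by (subst hecke_act_first_coeff) simp_all
  also have "dual_coeff l (code3 k, code5 k) = l k +
      (\<Sum>(i, j) | 2 * i + 3 * j < weight k. dual_coeff l (i, j) * first_coeff i j k)"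
    by (subst dual_coeff.simps) (simp add: weight_def case_prod_unfold)
  finally show ?thesis by (simp add: add.assoc bit_add_self)
qed

lemma cuspF_upto_even_nth:
  assumes "f \<in> cuspF_upto n" "even m"
  shows "f $ m = 0"
  using assms(1) unfolding cuspF_upto_eq
proof (induction rule: scaleF2.span_induct_alt)
  case (step c x y)
  then obtain k where "x = Delta ^ (2 * k + 1)" by (auto simp: odd_power_def)
  then have "x $ m = 0" using Delta_power_nth_parity[of "2 * k + 1" m] assms(2) by (auto intro: ccontr)
  then show ?case using step by (simp add: scaleF2_nth)
qed simp

text \<open>The coefficient of T_p h at l is that of h at p l, plus that at l / p when p divides l.
  Strong induction over all members of Z at once thus reduces m = p l to smaller indices; even m are
  given, so odd p suffice.\<close>

lemma Hecke_stable_vanish: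
  assumes "\<And>h. h \<in> Z \<Longrightarrow> h $ 1 = 0" "\<And>h m. h \<in> Z \<Longrightarrow> even m \<Longrightarrow> h $ m = 0"
    and stable: "\<And>p h. prime p \<Longrightarrow> odd p \<Longrightarrow> h \<in> Z \<Longrightarrow> Hecke p h \<in> Z"
  shows "h \<in> Z \<Longrightarrow> h = (0 :: bit fps)"
proof -
  have "h $ m = 0" if "h \<in> Z" for m h
    using that
  proof (induction m arbitrary: h rule: less_induct)
    case (less m)
    show ?case
    proof (cases "even m \<or> m = 1")
      case True
      then show ?thesis using assms(1,2) less.prems by blast
    next
      case False
      then obtain p where p: "prime p" "p dvd m" using prime_factor_nat by blast
      then obtain l where m: "m = p * l" by auto
      have "odd p" using False m by simp
      have p1: "p > 1" using p(1) prime_gt_1_nat by blast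
      have l: "l > 0" using False m by (intro Nat.gr0I) auto
      have "l < m" using p1 l by (simp add: m)
      have 1: "Hecke p h $ l = 0" by (rule less.IH[OF \<open>l < m\<close> stable[OF p(1) \<open>odd p\<close> less.prems]])
      have "l div p < m" using \<open>l < m\<close> div_le_dividend[of l p] by linarith
      then have 2: "h $ (l div p) = 0" by (rule less.IH[OF _ less.prems])
      show ?thesis using 1 2 by (simp add: Hecke_nth m split: if_splits)
    qed
  qed
  then show "h \<in> Z \<Longrightarrow> h = 0" by (auto intro!: fps_ext)
qed

lemma psi_surj:
  assumes a: "a \<in> carrier HeckeAlg"
  obtains b where "psi b = a"
proof -
  have a1: "a n \<in> carrier (HeckeAlg_upto n)" if "n \<ge> 1" for n
    using a that by (auto simp: HeckeAlg_def PiE_iff)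
  have a2: "restrict (a (Suc n)) (cuspF_upto n) = a n" if "n \<ge> 1" for n
    using a that by (auto simp: HeckeAlg_def)
  have a3: "a \<in> extensional {1..}" using a by (auto simp: HeckeAlg_def PiE_iff)
  have E: "a n \<in> carrier (EndF n)" if "n \<ge> 1" for n using a1[OF that] HeckeAlg_upto_subset by blast
  have compat: "a (m + d) g = a m g" if "m \<ge> 1" "g \<in> cuspF_upto m" for m d g
  proof (induction d)
    case (Suc d)
    have "g \<in> cuspF_upto (m + d)" using that cuspF_upto_mono[of m "m + d"] by auto
    then have "a (Suc (m + d)) g = a (m + d) g"
      using fun_cong[OF a2[of "m + d"], of g] that by simp
    then show ?case using Suc by simp
  qed simp
  \<comment> \<open>\<open>Suc k\<close> is the smallest level whose space contains this power; by
    \<open>compat\<close> any higher level gives the same value.\<close>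
  define l where "l k = a (Suc k) (odd_power k) $ 1" for k
  define b where "b = Abs_fps (\<lambda>i. Abs_fps (\<lambda>j. dual_coeff l (i, j)))"
  have first: "a n g $ 1 = hecke_act n b g $ 1" if n: "n \<ge> 1" and g: "g \<in> cuspF_upto n" for n g
  proof -
    have "g \<in> cuspF_upto n \<and> a n g $ 1 = hecke_act n b g $ 1"
      using g unfolding cuspF_upto_eq
    proof (induction rule: scaleF2.span_induct_alt)
      case base
      then show ?case using EndF_carrier_0[OF E[OF n]] by (simp add: hecke_act_linear scaleF2.span_zero)
    next
      case (step c x y)
      then obtain k where k: "x = odd_power k" "k < n" by auto
      have mem: "x \<in> cuspF_upto n" "y \<in> cuspF_upto n" "scaleF2 c x \<in> cuspF_upto n"
        using cuspF_upto_closed(3,4) k step(2) by (auto simp: cuspF_upto_eq)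
      have "a n x = a (Suc k) x"
        using compat[of "Suc k" x "n - Suc k"] k cuspF_upto_closed(4)[of k "Suc k"] by simp
      then have x: "a n x $ 1 = hecke_act n b x $ 1"
        using hecke_act_dual[OF k(2), of l] by (simp add: k(1) l_def b_def)
      have sc: "hecke_act n b (scaleF2 c x) = scaleF2 c (hecke_act n b x)"
        by (cases c) (simp_all add: hecke_act_linear scaleF2_simps)
      have "a n (scaleF2 c x + y) = scaleF2 c (a n x) + a n y"
        using EndF_carrierD(2,3)[OF E[OF n]] mem by simp
      then show ?case
        using x sc step mem by (simp add: hecke_act_linear scaleF2_nth cuspF_upto_closed flip: cuspF_upto_eq)
    qed
    then show ?thesis by blast
  qed
  \<comment> \<open>Sums are differences in characteristic 2, so these are the defects a f -
    \<psi>(b) f.\<close>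
  define Z where "Z = {a n f + hecke_act n b f | n f. n \<ge> 1 \<and> f \<in> cuspF_upto n}"
  have Z: "h = 0" if "h \<in> Z" for h
  proof (rule Hecke_stable_vanish[of Z, OF _ _ _ that])
    fix h assume "h \<in> Z"
    then obtain n f where nf: "h = a n f + hecke_act n b f" "n \<ge> 1" "f \<in> cuspF_upto n" unfolding Z_def by blast
    show "h $ 1 = 0" using first[OF nf(2,3)] by (simp add: nf(1) bit_add_self)
    have "a n f \<in> cuspF_upto n" using EndF_carrierD(1)[OF E[OF nf(2)]] nf(3) by blast
    then have mem: "h \<in> cuspF_upto n" by (simp add: nf cuspF_upto_closed hecke_act_closed)
    show "h $ m = 0" if "even m" for m by (rule cuspF_upto_even_nth[OF mem that])
    show "Hecke p h \<in> Z" if p: "prime p" "odd p" for p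
    proof -
      have "Hecke p h = a n (Hecke p f) + hecke_act n b (Hecke p f)"
        using HeckeAlg_upto_commute[OF a1[OF nf(2)] p nf(3)] Hecke_hecke_act[OF p(1)]
        by (simp add: nf(1) Hecke_add)
      then show ?thesis unfolding Z_def using nf Hecke_cuspF_upto[OF p nf(3)] by blast
    qed
  qed
  have "psi b n = a n" if n: "n \<ge> 1" for n
  proof
    fix g
    show "psi b n g = a n g"
    proof (cases "g \<in> cuspF_upto n")
      case True
      then have "a n g + hecke_act n b g = 0" using Z n unfolding Z_def by blast
      then show ?thesis using psi_apply[OF n True] iffD2[OF bit_fps_eq_iff] by metis
    next
      case False
      have "a n \<in> extensional (cuspF_upto n)" using EndF_carrierD(1)[OF E[OF n]] by (simp add: PiE_iff)
      then show ?thesis using False n by (simp add: psi_def psi_upto_eq extensional_def)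
    qed
  qed
  then have "psi b = a" using a3 by (auto simp: psi_def extensional_def fun_eq_iff)
  then show thesis by (rule that)
qed

lemma psi_monomials: "psi X_var = HeckeT 3" "psi Y_var = HeckeT 5"
proof -
  \<comment> \<open>For n = 1 the sum in \<open>hecke_act\<close> has only the term i = j = 0 and
    does not see the variables. Evaluating at \<open>Suc n\<close> and descending by
    \<open>hecke_act_stable\<close> covers this case too.\<close>
  have *: "psi f = HeckeT p" if f: "\<And>n g. n \<ge> 1 \<Longrightarrow> hecke_act (Suc n) f g = Hecke p g" for f p
  proof
    fix n
    have "hecke_act n f g = Hecke p g" if "n \<ge> 1" "g \<in> cuspF_upto n" for g
      using f[OF that(1), of g] hecke_act_stable[OF that(2), of "Suc n" f] by simp
    then show "psi f n = HeckeT p n"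
      by (auto simp: psi_def HeckeT_def HeckeEnd_def psi_upto_eq)
  qed
  show "psi X_var = HeckeT 3"
  proof (rule *)
    fix n :: nat and g assume n: "n \<ge> 1"
    let ?t = "\<lambda>i j. (Hecke 3 ^^ i) ((Hecke 5 ^^ j) g)"
    have "hecke_act (Suc n) X_var g = (\<Sum>i<Suc n. \<Sum>j<Suc n. if i = 1 then if j = 0 then Hecke 3 g else 0 else 0)"
      unfolding hecke_act_expand X_var_def
    proof (intro sum.cong refl)
      fix i j
      show "scaleF2 (fps_X $ i $ j) (?t i j) = (if i = 1 then if j = 0 then Hecke 3 g else 0 else 0)"
        by (simp add: fps_one_nth scaleF2_simps)
    qed
    also have "\<dots> = (\<Sum>i<Suc n. if i = 1 then \<Sum>j<Suc n. if j = 0 then Hecke 3 g else 0 else 0)"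
      by (intro sum.cong refl) (simp del: sum.lessThan_Suc)
    finally show "hecke_act (Suc n) X_var g = Hecke 3 g" using n by (simp del: sum.lessThan_Suc)
  qed
  show "psi Y_var = HeckeT 5"
  proof (rule *)
    fix n :: nat and g assume n: "n \<ge> 1"
    let ?t = "\<lambda>i j. (Hecke 3 ^^ i) ((Hecke 5 ^^ j) g)"
    have "hecke_act (Suc n) Y_var g = (\<Sum>i<Suc n. \<Sum>j<Suc n. if i = 0 then if j = 1 then Hecke 5 g else 0 else 0)"
      unfolding hecke_act_expand Y_var_def
    proof (intro sum.cong refl)
      fix i j
      show "scaleF2 (fps_const fps_X $ i $ j) (?t i j) = (if i = 0 then if j = 1 then Hecke 5 g else 0 else 0)"
        by (simp add: scaleF2_simps)
    qed
    also have "\<dots> = (\<Sum>i<Suc n. if i = 0 then \<Sum>j<Suc n. if j = 1 then Hecke 5 g else 0 else 0)"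
      by (intro sum.cong refl) (simp del: sum.lessThan_Suc)
    finally show "hecke_act (Suc n) Y_var g = Hecke 5 g" using n by (simp del: sum.lessThan_Suc)
  qed
qed

theorem mainTheorem1:
  shows "psi \<in> ring_iso power_series_ring_XY HeckeAlg
    \<and> psi X_var = HeckeT 3 \<and> psi Y_var = HeckeT 5"
proof -
  have "bij_betw psi (carrier power_series_ring_XY) (carrier HeckeAlg)"
    unfolding bij_betw_def
  proof
    show "inj_on psi (carrier power_series_ring_XY)" using psi_inj by (rule inj_on_subset) simp
    have "carrier HeckeAlg \<subseteq> range psi" using psi_surj by (metis rangeI subsetI)
    moreover have "carrier power_series_ring_XY = UNIV" by (simp add: ring_of_type_algebra_def)
    ultimately show "psi ` carrier power_series_ring_XY = carrier HeckeAlg" using psi_carrier by auto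
  qed
  then show ?thesis using psi_hom psi_monomials by (simp add: ring_iso_def)
qed

end
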